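(* Let $n\ge 1$. Let $q\in[1,\infty)$, $c\in(0,\infty]$, $\mathbf{B}=(\beta_0,\beta_\infty)\in\mathbb{R}^2$ be such that either $q=c=1$ and $\mathbf{B}=(0,0)$, or $1<q<\infty$ and $0<c\le\infty$ (with $\mathbf{B}\in\mathbb{R}^2$ arbitrary). Let $p,b\in(0,\infty]$ and $\mathbf{A}=(\alpha_0,\alpha_\infty)\in\mathbb{R}^2$ be such that either $q<p<\infty$ and $0<b\le\infty$, or $p=b=\infty$ and $\mathbf{A}=(0,0)$. Then there is a constant $C>0$, independent of $R$ and $f$, such that for all $R>0$ and all $f\in L^R_{q,c;\mathbf{B}}$ $$\|f\|_{p,b;\mathbf{A}}\le C\,R^{n\left(\frac1q-\frac1p\right)}\,l^{(\overleftarrow{\mathbf{A}}-\overleftarrow{\mathbf{B}})}(R)\,\|f\|_{q,c;\mathbf{B}}.$$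
   Context: Convention: $1/\infty=0$. For a pair $\mathbf{A}=(\alpha_0,\alpha_\infty)\in\mathbb{R}^2$ put $\overleftarrow{\mathbf{A}}=(\alpha_\infty,\alpha_0)$; pairs are added and subtracted componentwise. The broken-logarithmic function is $l^{\mathbf{A}}(t)=(1+|\ln t|)^{\alpha_0}$ for $0<t\le 1$ and $l^{\mathbf{A}}(t)=(1+|\ln t|)^{\alpha_\infty}$ for $t>1$. Functions are complex-valued, measurable on $\mathbb{R}^n$ with Lebesgue measure; $f^*$ is the non-increasing rearrangement of $f$. For $0<p,b\le\infty$, the Lorentz–Zygmund space $L_{p,b;\mathbf{A}}=L_{p,b;\mathbf{A}}(\mathbb{R}^n)$ consists of all measurable $f$ with $$\|f\|_{p,b;\mathbf{A}}:=\left\|t^{\frac1p-\frac1b}\,l^{\mathbf{A}}(t)\,f^*(t)\right\|_{L_b(0,\infty)}<\infty,$$ where $\|\cdot\|_{L_b(0,\infty)}$ is the usual Lebesgue (quasi-)norm in $t$. $S'$ is the space of tempered distributions on $\mathbb{R}^n$ and $\hat f$ is the Fourier transform of $f\in S'$, extending $\hat f(\xi)=\int e^{-2\pi i x\xi}f(x)\,dx$. For $0<R<\infty$, $B_R=\{\xi\in\mathbb{R}^n:|\xi|\le R\}$ and $L^R_{q,c;\mathbf{B}}=\{f\in L_{q,c;\mathbf{B}}\cap S':\operatorname{supp}\hat f\subset B_R\}$. The constant $C$ may depend on $p,b,\mathbf{A},q,c,\mathbf{B}$ and the fixed dimension $n$. *)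

theory Defs
  imports "HOL-Analysis.Analysis" "HOL-Probability.Essential_Supremum"
begin

section \<open>Lorentz--Zygmund spaces\<close>

text \<open>Exponents range over the extended nonnegative reals; in particular
  \<open>recip \<infinity> = 0\<close>.\<close>

definition recip :: "ennreal \<Rightarrow> real" where
  "recip p = enn2real (1 / p)"

definition broken_log :: "real \<times> real \<Rightarrow> real \<Rightarrow> real" where
  "broken_log A t = (if t \<le> 1 then (1 + \<bar>ln t\<bar>) powr fst A else (1 + \<bar>ln t\<bar>) powr snd A)"

definition rearrangement :: "('a::euclidean_space \<Rightarrow> complex) \<Rightarrow> real \<Rightarrow> ennreal" where
  "rearrangement f t =
     Inf {ennreal s | s. 0 \<le> s \<and> emeasure lebesgue {x. s < norm (f x)} \<le> ennreal t}"

text \<open>Only used for exponents \<open>a > 0\<close>, for which \<open>\<infinity>\<close> raised to the power \<open>a\<close> is \<open>\<infinity>\<close>.\<close>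

definition epowr :: "ennreal \<Rightarrow> real \<Rightarrow> ennreal" where
  "epowr x a = (if x = \<infinity> then \<infinity> else ennreal (enn2real x powr a))"

definition Lb_norm :: "ennreal \<Rightarrow> (real \<Rightarrow> ennreal) \<Rightarrow> ennreal" where
  "Lb_norm b g =
     (if b = \<infinity> then esssup (lebesgue_on {0<..}) g
      else epowr (\<integral>\<^sup>+ t. epowr (g t) (enn2real b) \<partial>lebesgue_on {0<..}) (recip b))"

definition LZ_norm ::
    "ennreal \<Rightarrow> ennreal \<Rightarrow> real \<times> real \<Rightarrow> ('a::euclidean_space \<Rightarrow> complex) \<Rightarrow> ennreal" where
  "LZ_norm p b A f =
     Lb_norm b (\<lambda>t. ennreal (t powr (recip p - recip b) * broken_log A t) * rearrangement f t)"

definition LZ_space ::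
    "ennreal \<Rightarrow> ennreal \<Rightarrow> real \<times> real \<Rightarrow> ('a::euclidean_space \<Rightarrow> complex) set" where
  "LZ_space p b A = {f \<in> borel_measurable lebesgue. LZ_norm p b A f < \<infinity>}"

section \<open>Tempered distributions\<close>

text \<open>Iterated partial derivatives are indexed by lists of basis vectors instead of
  multi-indices; for smooth functions the order of differentiation is immaterial.\<close>

fun partials :: "'a::euclidean_space list \<Rightarrow> ('a \<Rightarrow> complex) \<Rightarrow> 'a \<Rightarrow> complex" where
  "partials [] \<phi> = \<phi>"
| "partials (e # es) \<phi> = (\<lambda>x. frechet_derivative (partials es \<phi>) (at x) e)"

definition smooth :: "('a::euclidean_space \<Rightarrow> complex) \<Rightarrow> bool" where
  "smooth \<phi> \<longleftrightarrow> (\<forall>es. set es \<subseteq> Basis \<longrightarrow> (\<forall>x. partials es \<phi> differentiable (at x)))"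

definition schwartz :: "('a::euclidean_space \<Rightarrow> complex) set" where
  "schwartz = {\<phi>. smooth \<phi> \<and>
     (\<forall>k es. set es \<subseteq> Basis \<longrightarrow> bounded (range (\<lambda>x. (1 + norm x) ^ k *\<^sub>R partials es \<phi> x)))}"

definition schwartz_seminorm ::
    "nat \<Rightarrow> 'a::euclidean_space list \<Rightarrow> ('a \<Rightarrow> complex) \<Rightarrow> real" where
  "schwartz_seminorm k es \<phi> = (SUP x. (1 + norm x) ^ k * norm (partials es \<phi> x))"

definition schwartz_topology :: "('a::euclidean_space \<Rightarrow> complex) topology" where
  "schwartz_topology = topology_generated_by
     {{\<psi> \<in> schwartz. schwartz_seminorm k es (\<lambda>x. \<psi> x - \<phi> x) < r} | k es \<phi> r.
        set es \<subseteq> Basis \<and> \<phi> \<in> schwartz \<and> 0 < r}"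

definition tempered_distribution :: "(('a::euclidean_space \<Rightarrow> complex) \<Rightarrow> complex) \<Rightarrow> bool" where
  "tempered_distribution T \<longleftrightarrow>
     (\<forall>\<phi>\<in>schwartz. \<forall>\<psi>\<in>schwartz. \<forall>a b. T (\<lambda>x. a * \<phi> x + b * \<psi> x) = a * T \<phi> + b * T \<psi>) \<and>
     continuous_map schwartz_topology euclidean T"

definition fourier :: "('a::euclidean_space \<Rightarrow> complex) \<Rightarrow> 'a \<Rightarrow> complex" where
  "fourier \<phi> \<xi> = (\<integral>x. exp (- 2 * complex_of_real pi * \<i> * complex_of_real (x \<bullet> \<xi>)) * \<phi> x \<partial>lebesgue)"

definition fourier_distr ::
    "(('a::euclidean_space \<Rightarrow> complex) \<Rightarrow> complex) \<Rightarrow> ('a \<Rightarrow> complex) \<Rightarrow> complex" where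
  "fourier_distr T \<phi> = T (fourier \<phi>)"

definition test_functions :: "'a::euclidean_space set \<Rightarrow> ('a \<Rightarrow> complex) set" where
  "test_functions U =
     {\<phi>. smooth \<phi> \<and> compact (closure {x. \<phi> x \<noteq> 0}) \<and> closure {x. \<phi> x \<noteq> 0} \<subseteq> U}"

definition distr_support :: "(('a::euclidean_space \<Rightarrow> complex) \<Rightarrow> complex) \<Rightarrow> 'a set" where
  "distr_support T = - \<Union>{U. open U \<and> (\<forall>\<phi>\<in>test_functions U. T \<phi> = 0)}"

definition distr_of :: "('a::euclidean_space \<Rightarrow> complex) \<Rightarrow> ('a \<Rightarrow> complex) \<Rightarrow> complex" where
  "distr_of f \<phi> = (\<integral>x. f x * \<phi> x \<partial>lebesgue)"

text \<open>The functions that are tempered distributions through the pairing \<open>distr_of\<close>. The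
  integrability requirement is needed because the library integral of a non-integrable
  function is \<open>0\<close>.\<close>

definition tempered_functions :: "('a::euclidean_space \<Rightarrow> complex) set" where
  "tempered_functions = {f.
     (\<forall>\<phi>\<in>schwartz. integrable lebesgue (\<lambda>x. f x * \<phi> x)) \<and> tempered_distribution (distr_of f)}"

definition LZ_bandlimited ::
    "real \<Rightarrow> ennreal \<Rightarrow> ennreal \<Rightarrow> real \<times> real \<Rightarrow> ('a::euclidean_space \<Rightarrow> complex) set" where
  "LZ_bandlimited R q c B = {f \<in> LZ_space q c B \<inter> tempered_functions.
     distr_support (fourier_distr (distr_of f)) \<subseteq> cball 0 R}"

end

theory Submission
  imports Defs "HOL-Probability.Probability" "HOL-Computational_Algebra.Polynomial"
begin

text \<open>Let \<open>H\<close> be the Fourier transform of a product cutoff that equals \<open>1\<close> near the unit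
  cube; its integral is \<open>1\<close>. If the spectrum of \<open>f\<close> lies in the ball of radius \<open>R\<close>, then the
  smoothing of \<open>f\<close> with the kernel \<open>r\<^sup>n H(r x)\<close> does not depend on \<open>r \<ge> R\<close>; letting \<open>r\<close> tend to
  infinity, Lebesgue differentiation identifies it with \<open>f\<close>. As \<open>H\<close> is integrable and bounded,
  splitting \<open>f\<close> at height \<open>R\<^sup>n \<integral>\<^sub>0\<^sup>a f*\<close> with \<open>a = R\<^sup>-\<^sup>n\<close> bounds \<open>|f|\<close> by a multiple of that height.
  Together with the weak-type bound \<open>f*(t) \<le> K t\<^bsup>-1/q\<^esup> l\<^bsup>-B\<^esup>(t) \<parallel>f\<parallel>\<close> this controls
  \<open>t\<^bsup>1/p\<^esup> l\<^bsup>A\<^esup>(t) f*(t)\<close> by a multiple of \<open>min((t/a)\<^bsup>\<sigma>\<^esup>, (t/a)\<^bsup>-\<sigma>\<^esup>)\<close> for some \<open>\<sigma> > 0\<close>.\<close>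

section \<open>Smooth functions\<close>

fun times_differentiable :: "nat \<Rightarrow> ('a::euclidean_space \<Rightarrow> complex) \<Rightarrow> bool" where
  "times_differentiable 0 \<phi> \<longleftrightarrow> True"
| "times_differentiable (Suc k) \<phi> \<longleftrightarrow> (\<exists>D. (\<forall>x. (\<phi> has_derivative D x) (at x)) \<and>
     (\<forall>e\<in>Basis. times_differentiable k (\<lambda>x. D x e)))"

lemma times_differentiable_SucI:
  assumes "\<And>x. (\<phi> has_derivative D x) (at x)"
    and "\<And>e. e \<in> Basis \<Longrightarrow> times_differentiable k (\<lambda>x. D x e)"
  shows "times_differentiable (Suc k) \<phi>"
  using assms by auto

lemma times_differentiable_SucE:
  assumes "times_differentiable (Suc k) \<phi>"
  obtains D where "\<And>x. (\<phi> has_derivative D x) (at x)"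
    and "\<And>e. e \<in> Basis \<Longrightarrow> times_differentiable k (\<lambda>x. D x e)"
  using assms by auto

lemma times_differentiable_Suc_vectorI:
  fixes g :: "real \<Rightarrow> complex"
  assumes "\<And>x. (g has_vector_derivative g' x) (at x)" and "times_differentiable k g'"
  shows "times_differentiable (Suc k) g"
  using assms
  by (intro times_differentiable_SucI[where D = "\<lambda>x h. h *\<^sub>R g' x"])
     (auto simp: has_vector_derivative_def)

lemma times_differentiable_SucD: "times_differentiable (Suc k) \<phi> \<Longrightarrow> times_differentiable k \<phi>"
proof (induction k arbitrary: \<phi>)
  case (Suc k)
  then show ?case by (metis times_differentiable.simps(2))
qed simp

lemma partials_snoc:
  "partials (es @ [e]) \<phi> = partials es (\<lambda>x. frechet_derivative \<phi> (at x) e)"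
  by (induction es) auto

lemma times_differentiable_iff_partials:
  fixes \<phi> :: "'a::euclidean_space \<Rightarrow> complex"
  shows "times_differentiable k \<phi> \<longleftrightarrow>
     (\<forall>es. set es \<subseteq> Basis \<longrightarrow> length es < k \<longrightarrow> (\<forall>x. partials es \<phi> differentiable (at x)))"
proof (induction k arbitrary: \<phi>)
  case (Suc k)
  show ?case
  proof
    assume "times_differentiable (Suc k) \<phi>"
    then obtain D where deriv: "\<And>x. (\<phi> has_derivative D x) (at x)"
      and components: "\<And>e. e \<in> Basis \<Longrightarrow> times_differentiable k (\<lambda>x. D x e)"
      by (rule times_differentiable_SucE) blast
    have "frechet_derivative \<phi> (at x) = D x" for x
      using frechet_derivative_at[OF deriv] ..
    then have partials_es_e: "partials (es @ [e]) \<phi> = partials es (\<lambda>x. D x e)" for es e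
      by (simp add: partials_snoc)
    show "\<forall>es. set es \<subseteq> Basis \<longrightarrow> length es < Suc k \<longrightarrow> (\<forall>x. partials es \<phi> differentiable (at x))"
    proof (intro allI impI)
      fix es :: "'a list" and x assume "set es \<subseteq> Basis" "length es < Suc k"
      then show "partials es \<phi> differentiable (at x)"
        using deriv components Suc.IH
        by (cases es rule: rev_cases) (auto simp: partials_es_e differentiable_def)
    qed
  next
    assume partials: "\<forall>es. set es \<subseteq> Basis \<longrightarrow> length es < Suc k \<longrightarrow>
      (\<forall>x. partials es \<phi> differentiable (at x))"
    show "times_differentiable (Suc k) \<phi>"
    proof (rule times_differentiable_SucI)
      show "(\<phi> has_derivative frechet_derivative \<phi> (at x)) (at x)" for x
        using partials[rule_format, of "[]"] by (simp add: frechet_derivative_works)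
      show "times_differentiable k (\<lambda>x. frechet_derivative \<phi> (at x) e)" if "e \<in> Basis" for e
        unfolding Suc.IH using partials[rule_format, of "es @ [e]" for es] that
        by (simp add: partials_snoc)
    qed
  qed
qed simp

lemma smooth_iff_times_differentiable: "smooth \<phi> \<longleftrightarrow> (\<forall>k. times_differentiable k \<phi>)"
  unfolding smooth_def times_differentiable_iff_partials by auto

lemma times_differentiable_const: "times_differentiable k (\<lambda>x. c)"
proof (induction k arbitrary: c)
  case (Suc k)
  show ?case
    by (rule times_differentiable_SucI[where D = "\<lambda>_ _. 0"]) (simp_all add: Suc.IH)
qed simp

lemma times_differentiable_add:
  "times_differentiable k \<phi> \<Longrightarrow> times_differentiable k \<psi> \<Longrightarrow>
     times_differentiable k (\<lambda>x. \<phi> x + \<psi> x)"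
proof (induction k arbitrary: \<phi> \<psi>)
  case (Suc k)
  obtain D where deriv_\<phi>: "\<And>x. (\<phi> has_derivative D x) (at x)"
    "\<And>e. e \<in> Basis \<Longrightarrow> times_differentiable k (\<lambda>x. D x e)"
    using Suc.prems(1) by (rule times_differentiable_SucE) blast
  obtain E where deriv_\<psi>: "\<And>x. (\<psi> has_derivative E x) (at x)"
    "\<And>e. e \<in> Basis \<Longrightarrow> times_differentiable k (\<lambda>x. E x e)"
    using Suc.prems(2) by (rule times_differentiable_SucE) blast
  show ?case
    by (rule times_differentiable_SucI[OF has_derivative_add[OF deriv_\<phi>(1) deriv_\<psi>(1)]
          Suc.IH[OF deriv_\<phi>(2) deriv_\<psi>(2)]])
qed simp

lemma times_differentiable_mult:
  "times_differentiable k \<phi> \<Longrightarrow> times_differentiable k \<psi> \<Longrightarrow>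
     times_differentiable k (\<lambda>x. \<phi> x * \<psi> x)"
proof (induction k arbitrary: \<phi> \<psi>)
  case (Suc k)
  obtain D where deriv_\<phi>: "\<And>x. (\<phi> has_derivative D x) (at x)"
    "\<And>e. e \<in> Basis \<Longrightarrow> times_differentiable k (\<lambda>x. D x e)"
    using Suc.prems(1) by (rule times_differentiable_SucE) blast
  obtain E where deriv_\<psi>: "\<And>x. (\<psi> has_derivative E x) (at x)"
    "\<And>e. e \<in> Basis \<Longrightarrow> times_differentiable k (\<lambda>x. E x e)"
    using Suc.prems(2) by (rule times_differentiable_SucE) blast
  show ?case
  proof (rule times_differentiable_SucI[OF has_derivative_mult[OF deriv_\<phi>(1) deriv_\<psi>(1)]])
    show "times_differentiable k (\<lambda>x. \<phi> x * E x e + D x e * \<psi> x)" if "e \<in> Basis" for e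
      using that deriv_\<phi>(2) deriv_\<psi>(2) Suc.prems[THEN times_differentiable_SucD]
      by (intro times_differentiable_add Suc.IH) auto
  qed
qed simp

lemma times_differentiable_inverse:
  assumes "\<And>x. \<phi> x \<noteq> 0"
  shows "times_differentiable k \<phi> \<Longrightarrow> times_differentiable k (\<lambda>x. inverse (\<phi> x))"
proof (induction k)
  case (Suc k)
  obtain D where deriv_\<phi>: "\<And>x. (\<phi> has_derivative D x) (at x)"
    "\<And>e. e \<in> Basis \<Longrightarrow> times_differentiable k (\<lambda>x. D x e)"
    using Suc.prems by (rule times_differentiable_SucE) blast
  have inverse: "times_differentiable k (\<lambda>x. inverse (\<phi> x))"
    using Suc times_differentiable_SucD by blast
  show ?case
  proof (rule times_differentiable_SucI)
    show "((\<lambda>x. inverse (\<phi> x)) has_derivative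
        (\<lambda>h. (-1) * (inverse (\<phi> x) * D x h * inverse (\<phi> x)))) (at x)" for x
      using Deriv.has_derivative_inverse[OF assms deriv_\<phi>(1)] by simp
    show "times_differentiable k (\<lambda>x. (-1) * (inverse (\<phi> x) * D x e * inverse (\<phi> x)))"
      if "e \<in> Basis" for e
      using that by (intro times_differentiable_mult times_differentiable_const inverse deriv_\<phi>(2))
  qed
qed simp

lemma times_differentiable_compose_inner:
  fixes v :: "'a::euclidean_space"
  shows "times_differentiable k g \<Longrightarrow> times_differentiable k (\<lambda>x. g (x \<bullet> v + c))"
proof (induction k arbitrary: g)
  case (Suc k)
  obtain D where deriv_g: "\<And>t. (g has_derivative D t) (at t)"
    "times_differentiable k (\<lambda>t. D t 1)"
    using Suc.prems by (rule times_differentiable_SucE) auto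
  show ?case
  proof (rule times_differentiable_SucI)
    show "((\<lambda>x. g (x \<bullet> v + c)) has_derivative (\<lambda>h. D (x \<bullet> v + c) (h \<bullet> v))) (at x)" for x
      by (rule has_derivative_compose[OF _ deriv_g(1)]) (auto intro!: derivative_eq_intros)
    have "D t (e \<bullet> v) = of_real (e \<bullet> v) * D t 1" for t e
      using linear_scale[OF has_derivative_linear[OF deriv_g(1)], of t "e \<bullet> v" 1]
      by (simp add: scaleR_conv_of_real)
    then show "times_differentiable k (\<lambda>x. D (x \<bullet> v + c) (e \<bullet> v))" for e
      using times_differentiable_mult[OF times_differentiable_const Suc.IH[OF deriv_g(2)]] by simp
  qed
qed simp

lemma times_differentiable_cis: "times_differentiable k (\<lambda>x. cis (x \<bullet> v))"
proof (induction k)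
  case (Suc k)
  show ?case
  proof (rule times_differentiable_SucI)
    show "((\<lambda>x. cis (x \<bullet> v)) has_derivative (\<lambda>h. of_real (h \<bullet> v) * \<i> * cis (x \<bullet> v))) (at x)" for x
      by (auto intro!: derivative_eq_intros simp: scaleR_conv_of_real)
    show "times_differentiable k (\<lambda>x. of_real (e \<bullet> v) * \<i> * cis (x \<bullet> v))" for e
      by (intro times_differentiable_mult times_differentiable_const Suc.IH)
  qed
qed simp

lemma smooth_const: "smooth (\<lambda>x. c)"
  by (simp add: smooth_iff_times_differentiable times_differentiable_const)

lemma smooth_add: "smooth \<phi> \<Longrightarrow> smooth \<psi> \<Longrightarrow> smooth (\<lambda>x. \<phi> x + \<psi> x)"
  by (simp add: smooth_iff_times_differentiable times_differentiable_add)

lemma smooth_mult: "smooth \<phi> \<Longrightarrow> smooth \<psi> \<Longrightarrow> smooth (\<lambda>x. \<phi> x * \<psi> x)"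
  by (simp add: smooth_iff_times_differentiable times_differentiable_mult)

lemma smooth_diff: "smooth \<phi> \<Longrightarrow> smooth \<psi> \<Longrightarrow> smooth (\<lambda>x. \<phi> x - \<psi> x)"
  using smooth_add[OF _ smooth_mult[OF smooth_const[of "-1"]]] by simp

lemma smooth_prod:
  assumes "\<And>i. i \<in> I \<Longrightarrow> smooth (\<phi> i)"
  shows "smooth (\<lambda>x. \<Prod>i\<in>I. \<phi> i x)"
  using assms by (induction I rule: infinite_finite_induct) (simp_all add: smooth_const smooth_mult)

lemma smooth_inverse: "smooth \<phi> \<Longrightarrow> (\<And>x. \<phi> x \<noteq> 0) \<Longrightarrow> smooth (\<lambda>x. inverse (\<phi> x))"
  by (simp add: smooth_iff_times_differentiable times_differentiable_inverse)

lemma smooth_compose_inner: "smooth g \<Longrightarrow> smooth (\<lambda>x. g (x \<bullet> v + c))"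
  by (simp add: smooth_iff_times_differentiable times_differentiable_compose_inner)

lemma smooth_compose_affine: "smooth g \<Longrightarrow> smooth (\<lambda>x::real. g (a * x + c))"
  using smooth_compose_inner[of g a c] by (simp add: mult.commute)

lemma smooth_cis: "smooth (\<lambda>x. cis (x \<bullet> v))"
  by (simp add: smooth_iff_times_differentiable times_differentiable_cis)

lemma smooth_differentiable: "smooth \<phi> \<Longrightarrow> \<phi> differentiable (at x)"
  unfolding smooth_def by (metis empty_set empty_subsetI partials.simps(1))

lemma smooth_continuous_on: "smooth \<phi> \<Longrightarrow> continuous_on A \<phi>"
  by (simp add: continuous_at_imp_continuous_on differentiable_imp_continuous_within
      smooth_differentiable)

lemma smooth_borel_measurable[measurable_dest]: "smooth \<phi> \<Longrightarrow> \<phi> \<in> borel_measurable borel"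
  by (intro borel_measurable_continuous_onI smooth_continuous_on)

lemma smooth_vector_derivativeE:
  fixes g :: "real \<Rightarrow> complex"
  assumes "smooth g"
  obtains g' where "\<And>x. (g has_vector_derivative g' x) (at x)" and "smooth g'"
proof
  show deriv: "(g has_vector_derivative vector_derivative g (at x)) (at x)" for x
    using smooth_differentiable[OF assms] by (simp add: vector_derivative_works)
  have "times_differentiable k (\<lambda>x. vector_derivative g (at x))" for k
  proof -
    obtain D where has_D: "\<And>x. (g has_derivative D x) (at x)"
      "times_differentiable k (\<lambda>x. D x 1)"
      using assms[unfolded smooth_iff_times_differentiable, rule_format, of "Suc k"]
      by (rule times_differentiable_SucE) auto
    have "D x 1 = vector_derivative g (at x)" for x
      using has_derivative_unique[OF has_D(1) deriv[unfolded has_vector_derivative_def]] by simp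
    with has_D(2) show ?thesis by simp
  qed
  then show "smooth (\<lambda>x. vector_derivative g (at x))"
    by (simp add: smooth_iff_times_differentiable)
qed

section \<open>Cutoff functions\<close>

text \<open>The functions \<open>P(1/x) exp(-1/x)\<close>, extended by zero, are closed under differentiation.\<close>

definition flat_exp :: "real poly \<Rightarrow> real \<Rightarrow> real" where
  "flat_exp P x = (if x > 0 then poly P (1 / x) * exp (- 1 / x) else 0)"

lemma flat_exp_tendsto_0: "(flat_exp P \<longlongrightarrow> 0) (at 0)"
proof -
  have "((\<lambda>y. \<Sum>i\<le>degree P. coeff P i * (y ^ i / exp y)) \<longlongrightarrow> (\<Sum>i\<le>degree P. coeff P i * 0)) at_top"
    by (intro tendsto_intros tendsto_power_div_exp_0)
  then have "((\<lambda>y. poly P y * exp (- y)) \<longlongrightarrow> 0) at_top"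
    by (simp add: poly_altdef sum_divide_distrib exp_minus field_simps)
  then have "((\<lambda>x. flat_exp P (inverse x)) \<longlongrightarrow> 0) at_top"
  proof (rule Lim_transform_eventually)
    show "\<forall>\<^sub>F x in at_top. poly P x * exp (- x) = flat_exp P (inverse x)"
      using eventually_gt_at_top[of 0] by eventually_elim (auto simp: flat_exp_def field_simps)
  qed
  then have "(flat_exp P \<longlongrightarrow> 0) (at_right 0)"
    by (simp add: filterlim_at_right_to_top)
  moreover have "(flat_exp P \<longlongrightarrow> 0) (at_left 0)"
    by (rule tendsto_eventually)
       (auto simp: eventually_at_left_field flat_exp_def intro!: exI[of _ "-1"])
  ultimately show ?thesis by (rule filterlim_split_at[rotated])
qed

lemma flat_exp_has_real_derivative:
  "(flat_exp P has_real_derivative flat_exp ([:0,0,1:] * (P - pderiv P)) x) (at x)"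
proof -
  consider "x > 0" | "x < 0" | "x = 0" by linarith
  then show ?thesis
  proof cases
    assume "x > 0"
    then have "((\<lambda>x. poly P (1 / x) * exp (- 1 / x)) has_real_derivative
        flat_exp ([:0,0,1:] * (P - pderiv P)) x) (at x)"
      by (auto intro!: derivative_eq_intros simp: flat_exp_def field_simps power2_eq_square)
    then show ?thesis
      by (rule has_field_derivative_transform_within_open[of _ _ _ "{0<..}"])
         (use \<open>x > 0\<close> in \<open>auto simp: flat_exp_def\<close>)
  next
    assume "x < 0"
    have "((\<lambda>x. 0) has_real_derivative 0) (at x)" by simp
    then have "(flat_exp P has_real_derivative 0) (at x)"
      by (rule has_field_derivative_transform_within_open[of _ _ _ "{..<0}"])
         (use \<open>x < 0\<close> in \<open>auto simp: flat_exp_def\<close>)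
    with \<open>x < 0\<close> show ?thesis by (simp add: flat_exp_def)
  next
    assume "x = 0"
    have "(\<lambda>h. flat_exp P h / h) = flat_exp ([:0,1:] * P)"
      by (auto simp: flat_exp_def fun_eq_iff)
    then have "(flat_exp P has_real_derivative 0) (at 0)"
      using flat_exp_tendsto_0[of "[:0,1:] * P"]
      by (simp add: DERIV_def) (simp add: flat_exp_def)
    with \<open>x = 0\<close> show ?thesis by (simp add: flat_exp_def)
  qed
qed

lemma smooth_flat_exp: "smooth (\<lambda>x. of_real (flat_exp P x))"
proof -
  have "times_differentiable k (\<lambda>x. of_real (flat_exp P x))" for k
  proof (induction k arbitrary: P)
    case (Suc k)
    show ?case
      by (rule times_differentiable_Suc_vectorI
          [OF has_vector_derivative_of_real[OF flat_exp_has_real_derivative] Suc.IH])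
  qed simp
  then show ?thesis by (simp add: smooth_iff_times_differentiable)
qed

definition smooth_step :: "real \<Rightarrow> real" where
  "smooth_step x = flat_exp 1 x / (flat_exp 1 x + flat_exp 1 (1 - x))"

lemma smooth_step_denominator_pos: "flat_exp 1 x + flat_exp 1 (1 - x) > 0"
  by (auto simp: flat_exp_def add_pos_pos)

lemma smooth_step_eq_0: "x \<le> 0 \<Longrightarrow> smooth_step x = 0"
  by (simp add: smooth_step_def flat_exp_def)

lemma smooth_step_eq_1: "x \<ge> 1 \<Longrightarrow> smooth_step x = 1"
  by (simp add: smooth_step_def flat_exp_def)

lemma smooth_smooth_step: "smooth (\<lambda>x. of_real (smooth_step x))"
proof -
  let ?flat = "\<lambda>x. complex_of_real (flat_exp 1 x)"
  have "?flat x + ?flat (- 1 * x + 1) \<noteq> 0" for x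
    using smooth_step_denominator_pos[of x] by (simp flip: of_real_add)
  then have "smooth (\<lambda>x. ?flat x * inverse (?flat x + ?flat (- 1 * x + 1)))"
    by (intro smooth_mult smooth_inverse smooth_add smooth_flat_exp
        smooth_compose_affine[OF smooth_flat_exp])
  then show ?thesis
    by (simp add: smooth_step_def divide_inverse)
qed

definition cutoff :: "real \<Rightarrow> real" where
  "cutoff x = smooth_step (3 + x) * smooth_step (3 - x)"

lemma cutoff_eq_1: "\<bar>x\<bar> \<le> 2 \<Longrightarrow> cutoff x = 1"
  by (simp add: cutoff_def smooth_step_eq_1)

lemma cutoff_eq_0: "\<bar>x\<bar> \<ge> 3 \<Longrightarrow> cutoff x = 0"
  by (cases "x \<ge> 0") (simp_all add: cutoff_def smooth_step_eq_0)

lemma smooth_cutoff: "smooth (\<lambda>x. of_real (cutoff x))"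
  using smooth_mult[OF smooth_compose_affine[OF smooth_smooth_step, of 1 3]
      smooth_compose_affine[OF smooth_smooth_step, of "-1" 3]]
  by (simp add: cutoff_def add.commute)

definition lattice_bump :: "real \<Rightarrow> real" where
  "lattice_bump x = smooth_step (x + 1) - smooth_step x"

lemma lattice_bump_eq_0: "\<bar>x\<bar> \<ge> 1 \<Longrightarrow> lattice_bump x = 0"
  by (cases "x \<ge> 0") (simp_all add: lattice_bump_def smooth_step_eq_0 smooth_step_eq_1)

lemma smooth_lattice_bump: "smooth (\<lambda>x. of_real (lattice_bump x))"
  using smooth_diff[OF smooth_compose_affine[OF smooth_smooth_step, of 1 1] smooth_smooth_step]
  by (simp add: lattice_bump_def)

lemma sum_lattice_bump:
  assumes "\<bar>x\<bar> \<le> real N"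
  shows "(\<Sum>j<2*N+1. lattice_bump (x + real N - real j)) = 1"
proof -
  have "(\<Sum>j<m. lattice_bump (x + real N - real j))
      = smooth_step (x + real N + 1) - smooth_step (x + real N + 1 - real m)" for m
    by (induction m) (simp_all add: lattice_bump_def algebra_simps)
  then show ?thesis
    using assms by (simp add: smooth_step_eq_0 smooth_step_eq_1)
qed

section \<open>Test functions\<close>

lemma test_functions_UNIV_iff: "\<phi> \<in> test_functions UNIV \<longleftrightarrow> smooth \<phi> \<and> bounded {x. \<phi> x \<noteq> 0}"
  by (simp add: test_functions_def compact_closure)

lemma test_functions_UNIV_eq_0E:
  assumes "\<phi> \<in> test_functions UNIV"
  obtains K where "K > 0" "\<And>x. K \<le> norm x \<Longrightarrow> \<phi> x = 0"
proof -
  have "bounded {x. \<phi> x \<noteq> 0}"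
    using assms by (simp add: test_functions_UNIV_iff)
  then obtain K where "K > 0" and support: "{x. \<phi> x \<noteq> 0} \<subseteq> ball 0 K"
    by (auto dest: bounded_subset_ballD)
  moreover have "\<phi> x = 0" if "K \<le> norm x" for x
    using support that by (force simp: subset_iff)
  ultimately show ?thesis using that by blast
qed

lemma test_functions_smooth: "\<phi> \<in> test_functions U \<Longrightarrow> smooth \<phi>"
  by (simp add: test_functions_def)

lemma test_functions_borel_measurable[measurable_dest]:
  "\<phi> \<in> test_functions U \<Longrightarrow> \<phi> \<in> borel_measurable borel"
  by (intro smooth_borel_measurable test_functions_smooth)

lemma test_functions_mult:
  "smooth \<psi> \<Longrightarrow> \<phi> \<in> test_functions UNIV \<Longrightarrow> (\<lambda>x. \<psi> x * \<phi> x) \<in> test_functions UNIV"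
  by (auto simp: test_functions_UNIV_iff smooth_mult elim: bounded_subset)

lemma test_functions_diff:
  assumes "\<phi> \<in> test_functions UNIV" and "\<psi> \<in> test_functions UNIV"
  shows "(\<lambda>x. \<phi> x - \<psi> x) \<in> test_functions UNIV"
proof -
  have "bounded ({x. \<phi> x \<noteq> 0} \<union> {x. \<psi> x \<noteq> 0})"
    using assms by (simp add: test_functions_UNIV_iff)
  then have "bounded {x. \<phi> x - \<psi> x \<noteq> 0}"
    by (rule bounded_subset) auto
  with assms show ?thesis
    by (simp add: test_functions_UNIV_iff smooth_diff)
qed

lemma test_functions_integrable:
  assumes "\<phi> \<in> test_functions UNIV"
  shows "integrable lborel \<phi>"
proof -
  have "compact (closure {x. \<phi> x \<noteq> 0})"
    using assms by (simp add: test_functions_def)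
  then have "integrable lborel (\<lambda>x. indicator (closure {x. \<phi> x \<noteq> 0}) x *\<^sub>R \<phi> x)"
    by (rule borel_integrable_compact)
       (rule smooth_continuous_on[OF test_functions_smooth[OF assms]])
  also have "(\<lambda>x. indicator (closure {x. \<phi> x \<noteq> 0}) x *\<^sub>R \<phi> x) = \<phi>"
    by (auto simp: fun_eq_iff indicator_def closure_def)
  finally show ?thesis .
qed

lemma bounded_range_test_function:
  assumes "\<phi> \<in> test_functions UNIV"
  shows "bounded (range \<phi>)"
proof -
  have "compact (\<phi> ` closure {x. \<phi> x \<noteq> 0})"
    using assms test_functions_smooth[OF assms]
    by (intro compact_continuous_image smooth_continuous_on) (simp_all add: test_functions_def)
  then have "bounded (insert 0 (\<phi> ` closure {x. \<phi> x \<noteq> 0}))"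
    by (simp add: compact_imp_bounded)
  then show ?thesis
    by (rule bounded_subset) (use closure_subset[of "{x. \<phi> x \<noteq> 0}"] in auto)
qed

lemma test_functions_vector_derivativeE:
  fixes g :: "real \<Rightarrow> complex"
  assumes "g \<in> test_functions UNIV"
  obtains g' where "\<And>x. (g has_vector_derivative g' x) (at x)" and "g' \<in> test_functions UNIV"
proof -
  obtain g' where deriv: "\<And>x. (g has_vector_derivative g' x) (at x)" and "smooth g'"
    using smooth_vector_derivativeE[OF test_functions_smooth[OF assms]] by blast
  have "g' x = 0" if "x \<notin> closure {x. g x \<noteq> 0}" for x
  proof -
    have "((\<lambda>x. 0) has_vector_derivative 0) (at x)" by simp
    then have "(g has_vector_derivative 0) (at x)"
      by (rule has_vector_derivative_transform_within_open[of _ _ _ "- closure {x. g x \<noteq> 0}"])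
         (use that closure_subset[of "{x. g x \<noteq> 0}"] in auto)
    with deriv show ?thesis using vector_derivative_unique_at by blast
  qed
  then have "{x. g' x \<noteq> 0} \<subseteq> closure {x. g x \<noteq> 0}" by blast
  moreover have "bounded (closure {x. g x \<noteq> 0})"
    using assms by (simp add: test_functions_UNIV_iff bounded_closure)
  ultimately have "g' \<in> test_functions UNIV"
    using \<open>smooth g'\<close> bounded_subset by (auto simp: test_functions_UNIV_iff)
  with deriv that show ?thesis by blast
qed

lemma integral_vector_derivative_test_function:
  fixes g :: "real \<Rightarrow> complex"
  assumes g_test: "g \<in> test_functions UNIV"
    and deriv: "\<And>x. (g has_vector_derivative g' x) (at x)"
  shows "integral\<^sup>L lborel g' = 0"
proof -
  have g'_test: "g' \<in> test_functions UNIV"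
  proof -
    obtain d where "\<And>x. (g has_vector_derivative d x) (at x)" "d \<in> test_functions UNIV"
      using test_functions_vector_derivativeE[OF g_test] by blast
    moreover from this(1) deriv have "g' = d"
      using vector_derivative_unique_at by blast
    ultimately show ?thesis by simp
  qed
  obtain K where g_eq_0: "K > 0" "\<And>x. K \<le> norm x \<Longrightarrow> g x = 0"
    using test_functions_UNIV_eq_0E[OF g_test] by blast
  obtain K' where g'_eq_0: "K' > 0" "\<And>x. K' \<le> norm x \<Longrightarrow> g' x = 0"
    using test_functions_UNIV_eq_0E[OF g'_test] by blast
  define L where "L = max K K'"
  have "has_bochner_integral lborel (\<lambda>x. indicator {-L..L} x *\<^sub>R g' x) (g L - g (-L))"
  proof (rule has_bochner_integral_FTC_Icc)
    show "continuous_on {-L..L} g'"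
      by (rule smooth_continuous_on[OF test_functions_smooth[OF g'_test]])
  qed (use g_eq_0 deriv in \<open>auto simp: L_def intro: has_vector_derivative_at_within\<close>)
  moreover have "(\<lambda>x. indicator {-L..L} x *\<^sub>R g' x) = g'"
    using g'_eq_0 by (auto simp: fun_eq_iff indicator_def L_def abs_le_iff split: if_splits)
  moreover have "g L - g (-L) = 0"
    using g_eq_0 by (simp add: L_def)
  ultimately show ?thesis
    by (auto dest: has_bochner_integral_integral_eq)
qed

definition tensor :: "('a::euclidean_space \<Rightarrow> real \<Rightarrow> complex) \<Rightarrow> 'a \<Rightarrow> complex" where
  "tensor g x = (\<Prod>b\<in>Basis. g b (x \<bullet> b))"

lemma tensor_mult: "tensor (\<lambda>b t. g b t * h b t) x = tensor g x * tensor h x"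
  by (simp add: tensor_def prod.distrib)

lemma tensor_eq_0: "b \<in> Basis \<Longrightarrow> g b (x \<bullet> b) = 0 \<Longrightarrow> tensor g x = 0"
  by (auto simp: tensor_def)

lemma borel_measurable_tensor[measurable]:
  assumes [measurable]: "\<And>b. b \<in> Basis \<Longrightarrow> g b \<in> borel_measurable borel"
  shows "tensor g \<in> borel_measurable borel"
  unfolding tensor_def by measurable

lemma smooth_tensor:
  assumes "\<And>b. b \<in> Basis \<Longrightarrow> smooth (g b)"
  shows "smooth (tensor g)"
proof -
  have "smooth (\<lambda>x. g b (x \<bullet> b))" if "b \<in> Basis" for b
    using smooth_compose_inner[OF assms[OF that], of b 0] by simp
  then show ?thesis
    unfolding tensor_def[abs_def] by (rule smooth_prod)
qed

lemma tensor_in_test_functions: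
  assumes "\<And>b. b \<in> Basis \<Longrightarrow> g b \<in> test_functions UNIV"
  shows "tensor g \<in> test_functions UNIV"
proof -
  have "\<exists>K. \<forall>t. K \<le> \<bar>t\<bar> \<longrightarrow> g b t = 0" if "b \<in> Basis" for b
    using test_functions_UNIV_eq_0E[OF assms[OF that]] by (metis real_norm_def)
  then obtain K where components_eq_0: "\<And>b t. b \<in> Basis \<Longrightarrow> K b \<le> \<bar>t\<bar> \<Longrightarrow> g b t = 0"
    by metis
  have "norm x \<le> (\<Sum>b\<in>Basis. K b)" if "tensor g x \<noteq> 0" for x
  proof (rule order_trans[OF norm_le_l1 sum_mono])
    show "\<bar>x \<bullet> b\<bar> \<le> K b" if "b \<in> Basis" for b
      using components_eq_0[OF that] tensor_eq_0[OF that] \<open>tensor g x \<noteq> 0\<close> by (meson linear)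
  qed
  then have "bounded {x. tensor g x \<noteq> 0}"
    by (auto simp: bounded_iff)
  then show ?thesis
    using assms by (simp add: test_functions_UNIV_iff smooth_tensor test_functions_smooth)
qed

lemma
  fixes g :: "'a::euclidean_space \<Rightarrow> real \<Rightarrow> complex"
  assumes integrable_g: "\<And>b. b \<in> Basis \<Longrightarrow> integrable lborel (g b)"
  shows integrable_tensor: "integrable lborel (tensor g)"
    and integral_tensor: "integral\<^sup>L lborel (tensor g) = (\<Prod>b\<in>Basis. integral\<^sup>L lborel (g b))"
proof -
  interpret product_sigma_finite "\<lambda>_::'a. lborel :: real measure" ..
  have [measurable]: "g b \<in> borel_measurable borel" if "b \<in> Basis" for b
    using integrable_g[OF that] by auto
  have tensor_sum: "tensor g (\<Sum>b\<in>Basis. f b *\<^sub>R b) = (\<Prod>b\<in>Basis. g b (f b))" for f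
    unfolding tensor_def by (intro prod.cong refl) simp
  show "integrable lborel (tensor g)"
    by (subst lborel_eq, subst integrable_distr_eq)
       (auto simp: tensor_sum intro!: product_integrable_prod integrable_g)
  show "integral\<^sup>L lborel (tensor g) = (\<Prod>b\<in>Basis. integral\<^sup>L lborel (g b))"
    by (subst lborel_eq, subst integral_distr)
       (auto simp: tensor_sum intro!: product_integral_prod integrable_g)
qed

section \<open>The Fourier transform\<close>

lemma
  fixes F :: "'a::euclidean_space \<Rightarrow> 'b::{banach, second_countable_topology}"
  assumes [measurable]: "F \<in> borel_measurable borel" and "c > 0"
  shows lborel_integral_affine:
      "integral\<^sup>L lborel F = c ^ DIM('a) *\<^sub>R (\<integral>x. F (t + c *\<^sub>R x) \<partial>lborel)"
    and lborel_integrable_affine_iff: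
      "integrable lborel (\<lambda>x. F (t + c *\<^sub>R x)) \<longleftrightarrow> integrable lborel F"
proof -
  have affine: "lborel = density (distr lborel borel (\<lambda>x. t + c *\<^sub>R x)) (\<lambda>_. ennreal (c ^ DIM('a)))"
    using lborel_affine[of c t] \<open>c > 0\<close> by (simp add: ennreal_power)
  show "integral\<^sup>L lborel F = c ^ DIM('a) *\<^sub>R (\<integral>x. F (t + c *\<^sub>R x) \<partial>lborel)"
    using \<open>c > 0\<close> by (subst affine, subst integral_density) (auto simp: integral_distr)
  have "integrable lborel F
      \<longleftrightarrow> integrable (distr lborel borel (\<lambda>x. t + c *\<^sub>R x)) (\<lambda>x. c ^ DIM('a) *\<^sub>R F x)"
    using \<open>c > 0\<close> by (subst affine, subst integrable_density) auto
  also have "\<dots> \<longleftrightarrow> integrable lborel (\<lambda>x. F (t + c *\<^sub>R x))"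
    using \<open>c > 0\<close> integrable_scaleR_right[of "1 / c ^ DIM('a)" lborel
        "\<lambda>x. c ^ DIM('a) *\<^sub>R F (t + c *\<^sub>R x)"]
    by (subst integrable_distr_eq) auto
  finally show "integrable lborel (\<lambda>x. F (t + c *\<^sub>R x)) \<longleftrightarrow> integrable lborel F" ..
qed

lemma integral_mult_scale_tendsto:
  fixes H J :: "'a::euclidean_space \<Rightarrow> complex"
  assumes integrable_H: "integrable lborel H" and [measurable]: "J \<in> borel_measurable borel"
    and bounded_J: "bounded (range J)" and "isCont J 0" and "s \<longlonglongrightarrow> 0"
  shows "(\<lambda>k. \<integral>x. H x * J (s k *\<^sub>R x) \<partial>lborel) \<longlonglongrightarrow> integral\<^sup>L lborel H * J 0"
proof -
  obtain B where J_le: "\<And>x. norm (J x) \<le> B"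
    using bounded_J by (auto simp: bounded_iff)
  have [measurable]: "H \<in> borel_measurable borel" using integrable_H by auto
  have "(\<lambda>k. \<integral>x. H x * J (s k *\<^sub>R x) \<partial>lborel) \<longlonglongrightarrow> (\<integral>x. H x * J 0 \<partial>lborel)"
  proof (rule integral_dominated_convergence)
    show "integrable lborel (\<lambda>x. norm (H x) * B)" using integrable_H by auto
    have "(\<lambda>k. s k *\<^sub>R x) \<longlonglongrightarrow> 0" for x :: 'a
      using tendsto_scaleR[OF \<open>s \<longlonglongrightarrow> 0\<close> tendsto_const, of x] by simp
    then show "AE x in lborel. (\<lambda>k. H x * J (s k *\<^sub>R x)) \<longlonglongrightarrow> H x * J 0"
      by (intro AE_I2 tendsto_intros isCont_tendsto_compose[OF \<open>isCont J 0\<close>])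
    show "AE x in lborel. norm (H x * J (s k *\<^sub>R x)) \<le> norm (H x) * B" for k
      unfolding norm_mult by (intro AE_I2 mult_left_mono J_le) auto
  qed auto
  then show ?thesis by simp
qed

definition character :: "'a::euclidean_space \<Rightarrow> 'a \<Rightarrow> complex" where
  "character \<xi> x = cis (2 * pi * (x \<bullet> \<xi>))"

lemma norm_character[simp]: "norm (character \<xi> x) = 1"
  by (simp add: character_def)

lemma character_0[simp]: "character 0 x = 1"
  by (simp add: character_def)

lemma character_commute: "character \<xi> x = character x \<xi>"
  by (simp add: character_def inner_commute)

lemma character_add: "character (\<xi> + \<eta>) x = character \<xi> x * character \<eta> x"
  by (simp add: character_def inner_add_right distrib_left cis_mult)

lemma smooth_character: "smooth (character \<xi>)"
  using smooth_cis[of "(2 * pi) *\<^sub>R \<xi>"] by (simp add: character_def[abs_def])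

lemma borel_measurable_character[measurable (raw)]:
  assumes [measurable]: "f \<in> borel_measurable M" "g \<in> borel_measurable M"
  shows "(\<lambda>x. character (f x) (g x)) \<in> borel_measurable M"
  unfolding character_def
  by (rule borel_measurable_continuous_on[of cis]) (auto intro!: continuous_intros)

lemma character_eq_tensor: "character \<xi> x = tensor (\<lambda>b. character (\<xi> \<bullet> b)) x"
proof -
  have "2 * pi * (x \<bullet> \<xi>) = (\<Sum>b\<in>Basis. 2 * pi * ((x \<bullet> b) * (\<xi> \<bullet> b)))"
    by (subst euclidean_inner) (simp add: sum_distrib_left)
  moreover have "cis (\<Sum>b\<in>I. f b) = (\<Prod>b\<in>I. cis (f b))" for f :: "'a \<Rightarrow> real" and I
    by (induction I rule: infinite_finite_induct) (simp_all flip: cis_mult)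
  ultimately show ?thesis
    by (simp add: character_def tensor_def)
qed

lemma fourier_eq:
  assumes [measurable]: "\<phi> \<in> borel_measurable borel"
  shows "fourier \<phi> \<xi> = (\<integral>x. character (- \<xi>) x * \<phi> x \<partial>lborel)"
proof -
  have "fourier \<phi> \<xi> = (\<integral>x. character (- \<xi>) x * \<phi> x \<partial>lebesgue)"
    unfolding fourier_def character_def cis_conv_exp by (simp add: mult_ac)
  also have "\<dots> = (\<integral>x. character (- \<xi>) x * \<phi> x \<partial>lborel)"
    by (rule integral_completion) measurable
  finally show ?thesis .
qed

lemma borel_measurable_fourier[measurable]:
  assumes [measurable]: "\<phi> \<in> borel_measurable borel"
  shows "fourier \<phi> \<in> borel_measurable borel"
  unfolding fourier_eq[OF assms, abs_def] by measurable

lemma integrable_character_mult: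
  assumes "integrable lborel \<phi>"
  shows "integrable lborel (\<lambda>x. character \<xi> x * \<phi> x)"
  by (rule Bochner_Integration.integrable_bound[OF assms])
     (use assms in \<open>auto simp: norm_mult\<close>)

lemma norm_fourier_le:
  assumes "integrable lborel \<phi>"
  shows "norm (fourier \<phi> \<xi>) \<le> (\<integral>x. norm (\<phi> x) \<partial>lborel)"
proof -
  have "norm (fourier \<phi> \<xi>) \<le> (\<integral>x. norm (character (- \<xi>) x * \<phi> x) \<partial>lborel)"
    using assms by (simp add: fourier_eq)
  then show ?thesis by (simp add: norm_mult)
qed

lemma fourier_diff:
  assumes "integrable lborel \<phi>" and "integrable lborel \<psi>"
  shows "fourier (\<lambda>x. \<phi> x - \<psi> x) \<xi> = fourier \<phi> \<xi> - fourier \<psi> \<xi>"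
  using assms by (simp add: fourier_eq right_diff_distrib integrable_character_mult)

lemma fourier_sum:
  assumes "\<And>i. i \<in> I \<Longrightarrow> integrable lborel (\<phi> i)"
  shows "fourier (\<lambda>x. \<Sum>i\<in>I. \<phi> i x) \<xi> = (\<Sum>i\<in>I. fourier (\<phi> i) \<xi>)"
  using assms by (simp add: fourier_eq sum_distrib_left integrable_character_mult)

lemma fourier_modulate:
  assumes "\<phi> \<in> borel_measurable borel"
  shows "fourier (\<lambda>x. character \<eta> x * \<phi> x) \<xi> = fourier \<phi> (\<xi> - \<eta>)"
proof -
  have "character (- (\<xi> - \<eta>)) x = character (- \<xi>) x * character \<eta> x" for x
    by (simp flip: character_add)
  with assms show ?thesis by (simp add: fourier_eq mult.assoc)
qed

lemma fourier_dilate: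
  fixes \<phi> :: "'a::euclidean_space \<Rightarrow> complex"
  assumes [measurable]: "\<phi> \<in> borel_measurable borel" and "r > 0"
  shows "fourier (\<lambda>x. \<phi> (x /\<^sub>R r)) \<xi> = of_real r ^ DIM('a) * fourier \<phi> (r *\<^sub>R \<xi>)"
proof -
  have "fourier (\<lambda>x. \<phi> (x /\<^sub>R r)) \<xi>
      = r ^ DIM('a) *\<^sub>R (\<integral>x. character (- \<xi>) (0 + r *\<^sub>R x) * \<phi> ((0 + r *\<^sub>R x) /\<^sub>R r) \<partial>lborel)"
    using assms by (subst fourier_eq, simp, subst lborel_integral_affine[where t = 0]) auto
  also have "\<dots> = of_real r ^ DIM('a) * fourier \<phi> (r *\<^sub>R \<xi>)"
    using assms by (simp add: fourier_eq character_def scaleR_conv_of_real)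
  finally show ?thesis .
qed

lemma integral_fourier_mult:
  fixes \<phi> \<psi> :: "'a::euclidean_space \<Rightarrow> complex"
  assumes integrable_\<phi>: "integrable lborel \<phi>" and integrable_\<psi>: "integrable lborel \<psi>"
  shows "(\<integral>\<xi>. fourier \<phi> \<xi> * \<psi> \<xi> \<partial>lborel) = (\<integral>x. \<phi> x * fourier \<psi> x \<partial>lborel)"
proof -
  have [measurable]: "\<phi> \<in> borel_measurable borel" "\<psi> \<in> borel_measurable borel"
    using integrable_\<phi> integrable_\<psi> by auto
  define F where "F x \<xi> = character (- \<xi>) x * \<phi> x * \<psi> \<xi>" for x \<xi>
  have F_eq: "F x \<xi> = \<phi> x * (character (- x) \<xi> * \<psi> \<xi>)" for x \<xi>
    using character_commute[of x "- \<xi>"] by (simp add: F_def character_def)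
  have "integrable (lborel \<Otimes>\<^sub>M lborel) (case_prod F)"
  proof (rule lborel_pair.Fubini_integrable)
    have "(\<integral>\<xi>. norm (F x \<xi>) \<partial>lborel) = norm (\<phi> x) * (\<integral>\<xi>. norm (\<psi> \<xi>) \<partial>lborel)" for x
      by (simp add: F_def norm_mult)
    then show "integrable lborel (\<lambda>x. \<integral>\<xi>. norm (case_prod F (x, \<xi>)) \<partial>lborel)"
      using integrable_\<phi> by simp
    show "AE x in lborel. integrable lborel (\<lambda>\<xi>. case_prod F (x, \<xi>))"
      unfolding prod.case F_eq 
      by (intro AE_I2 integrable_mult_right integrable_character_mult integrable_\<psi>)
  qed (unfold F_def, measurable)
  then have "(\<integral>\<xi>. (\<integral>x. F x \<xi> \<partial>lborel) \<partial>lborel) = (\<integral>x. (\<integral>\<xi>. F x \<xi> \<partial>lborel) \<partial>lborel)"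
    by (rule lborel_pair.Fubini_integral)
  moreover have "(\<integral>x. F x \<xi> \<partial>lborel) = fourier \<phi> \<xi> * \<psi> \<xi>" for \<xi>
    unfolding F_def by (simp add: fourier_eq)
  moreover have "(\<integral>\<xi>. F x \<xi> \<partial>lborel) = \<phi> x * fourier \<psi> x" for x
    unfolding F_eq by (simp add: fourier_eq)
  ultimately show ?thesis by simp
qed

lemma fourier_tensor:
  assumes integrable_g: "\<And>b. b \<in> Basis \<Longrightarrow> integrable lborel (g b)"
  shows "fourier (tensor g) = tensor (\<lambda>b. fourier (g b))"
proof
  fix \<xi>
  have [measurable]: "g b \<in> borel_measurable borel" if "b \<in> Basis" for b
    using integrable_g[OF that] by auto
  have "character (- \<xi>) x * tensor g x = tensor (\<lambda>b t. character (- \<xi> \<bullet> b) t * g b t) x" for x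
    by (simp only: tensor_mult character_eq_tensor[of "- \<xi>"])
  then have "fourier (tensor g) \<xi>
      = integral\<^sup>L lborel (tensor (\<lambda>b t. character (- \<xi> \<bullet> b) t * g b t))"
    by (simp add: fourier_eq)
  also have "\<dots> = tensor (\<lambda>b. fourier (g b)) \<xi>"
    by (simp add: integral_tensor integrable_character_mult integrable_g tensor_def fourier_eq)
  finally show "fourier (tensor g) \<xi> = tensor (\<lambda>b. fourier (g b)) \<xi>" .
qed

lemma fourier_vector_derivative:
  fixes g g' :: "real \<Rightarrow> complex"
  assumes g_test: "g \<in> test_functions UNIV" and g'_test: "g' \<in> test_functions UNIV"
    and deriv: "\<And>x. (g has_vector_derivative g' x) (at x)"
  shows "fourier g' \<xi> = 2 * pi * \<i> * \<xi> * fourier g \<xi>"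
proof -
  let ?e = "character (- \<xi>)" and ?c = "- (2 * pi * \<i> * complex_of_real \<xi>)"
  have "(?e has_vector_derivative ?c * ?e x) (at x)" for x
    unfolding character_def has_vector_derivative_def
    by (auto intro!: derivative_eq_intros simp: scaleR_conv_of_real)
  from has_vector_derivative_mult[OF this deriv]
  have "((\<lambda>x. ?e x * g x) has_vector_derivative ?e x * g' x + ?c * (?e x * g x)) (at x)" for x
    by (simp add: mult.assoc)
  then have "(\<integral>x. ?e x * g' x + ?c * (?e x * g x) \<partial>lborel) = 0"
    by (rule integral_vector_derivative_test_function[rotated])
       (intro test_functions_mult smooth_character g_test)
  then have "fourier g' \<xi> + ?c * fourier g \<xi> = 0"
    using g_test g'_test
    by (simp add: fourier_eq test_functions_borel_measurable test_functions_integrable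
        integrable_character_mult)
  then show ?thesis by simp
qed

lemma fourier_decay:
  fixes g :: "real \<Rightarrow> complex"
  assumes g_test: "g \<in> test_functions UNIV"
  obtains C where "\<And>\<xi>. norm (fourier g \<xi>) \<le> C / (1 + \<xi>\<^sup>2)"
proof -
  obtain g' where deriv: "\<And>x. (g has_vector_derivative g' x) (at x)"
    and g'_test: "g' \<in> test_functions UNIV"
    using test_functions_vector_derivativeE[OF g_test] by blast
  obtain g'' where deriv': "\<And>x. (g' has_vector_derivative g'' x) (at x)"
    and g''_test: "g'' \<in> test_functions UNIV"
    using test_functions_vector_derivativeE[OF g'_test] by blast
  define C where "C = (\<integral>x. norm (g x) \<partial>lborel) + (\<integral>x. norm (g'' x) \<partial>lborel)"
  have "norm (fourier g \<xi>) \<le> C / (1 + \<xi>\<^sup>2)" for \<xi>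
  proof -
    have "fourier g'' \<xi> = (2 * pi * \<i> * \<xi>)\<^sup>2 * fourier g \<xi>"
      using fourier_vector_derivative[OF g_test g'_test deriv]
        fourier_vector_derivative[OF g'_test g''_test deriv']
      by (simp add: power2_eq_square mult_ac)
    then have "norm (fourier g'' \<xi>) = (2 * pi)\<^sup>2 * \<xi>\<^sup>2 * norm (fourier g \<xi>)"
      by (simp add: norm_mult norm_power power_mult_distrib)
    moreover have "1 * \<xi>\<^sup>2 * norm (fourier g \<xi>) \<le> (2 * pi)\<^sup>2 * \<xi>\<^sup>2 * norm (fourier g \<xi>)"
      using pi_gt3 by (intro mult_right_mono one_le_power) auto
    ultimately have "(1 + \<xi>\<^sup>2) * norm (fourier g \<xi>) \<le> C"
      using norm_fourier_le[OF test_functions_integrable[OF g_test], of \<xi>]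
        norm_fourier_le[OF test_functions_integrable[OF g''_test], of \<xi>]
      unfolding C_def by (simp add: algebra_simps)
    then show ?thesis
      by (simp add: field_simps add_pos_nonneg)
  qed
  then show ?thesis by (rule that)
qed

lemma integrable_fourier_real_test_function:
  fixes g :: "real \<Rightarrow> complex"
  assumes g_test: "g \<in> test_functions UNIV"
  shows "integrable lborel (fourier g)"
proof -
  obtain C where decay: "\<And>\<xi>. norm (fourier g \<xi>) \<le> C / (1 + \<xi>\<^sup>2)"
    using fourier_decay[OF g_test] by blast
  have "integrable lborel (\<lambda>\<xi>::real. C * inverse (1 + \<xi>\<^sup>2))"
    using integrable_inverse_1_plus_square by (simp add: set_integrable_def)
  then show ?thesis
  proof (rule Bochner_Integration.integrable_bound)
    show "AE \<xi> in lborel. norm (fourier g \<xi>) \<le> norm (C * inverse (1 + \<xi>\<^sup>2))"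
      by (intro AE_I2 order_trans[OF decay]) (simp add: divide_inverse)
  qed (use g_test in measurable)
qed

definition gaussian :: "'a::euclidean_space \<Rightarrow> complex" where
  "gaussian x = of_real (exp (- pi * (norm x)\<^sup>2))"

lemma gaussian_0[simp]: "gaussian 0 = 1"
  by (simp add: gaussian_def)

lemma gaussian_eq_tensor: "gaussian = tensor (\<lambda>_. gaussian)"
proof
  fix x :: 'a
  have "(norm x)\<^sup>2 = (\<Sum>b\<in>Basis. (x \<bullet> b)\<^sup>2)"
    by (simp add: norm_eq_sqrt_inner euclidean_inner[of x x] power2_eq_square sum_nonneg)
  then show "gaussian x = tensor (\<lambda>_. gaussian) x"
    by (simp add: gaussian_def tensor_def exp_sum sum_distrib_left flip: of_real_prod)
qed

lemma gaussian_continuous: "isCont gaussian x"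
  unfolding gaussian_def by (intro continuous_intros)

lemma gaussian_borel_measurable[measurable]: "gaussian \<in> borel_measurable borel"
  by (intro borel_measurable_continuous_onI continuous_at_imp_continuous_on ballI
      gaussian_continuous)

lemma gaussian_real_eq_std_normal_density:
  "gaussian (x::real) = of_real (sqrt (2 * pi) * std_normal_density (sqrt (2 * pi) * x))"
  by (simp add: gaussian_def std_normal_density_def power_mult_distrib mult_ac)

lemma integrable_gaussian_real: "integrable lborel (gaussian :: real \<Rightarrow> complex)"
proof -
  have "integrable lborel (\<lambda>x. std_normal_density (0 + sqrt (2 * pi) * x))"
    by (intro lborel_integrable_real_affine) auto
  then show ?thesis
    by (simp add: gaussian_real_eq_std_normal_density[abs_def])
qed

lemma fourier_gaussian_real: "fourier gaussian = (gaussian :: real \<Rightarrow> complex)"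
proof
  fix \<xi> :: real
  let ?s = "sqrt (2 * pi)"
  have scale: "?s > 0" "?s * ?s = 2 * pi" by simp_all
  have "gaussian \<xi> = char std_normal_distribution (- ?s * \<xi>)"
    by (simp add: char_std_normal_distribution gaussian_def power_mult_distrib)
  also have "\<dots> = (\<integral>x. of_real (std_normal_density x) * cis (- ?s * \<xi> * x) \<partial>lborel)"
    unfolding char_def by (subst integral_density) (auto simp: scaleR_conv_of_real cis_conv_exp)
  also have "\<dots> = ?s * (\<integral>x. of_real (std_normal_density (?s * x))
      * cis (- ?s * \<xi> * (?s * x)) \<partial>lborel)"
    using scale by (subst lborel_integral_real_affine[where c = ?s and t = 0]) 
      (auto simp: scaleR_conv_of_real)
  also have "\<dots> = (\<integral>x. ?s * (of_real (std_normal_density (?s * x))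
      * cis (- ?s * \<xi> * (?s * x))) \<partial>lborel)"
    by (rule integral_mult_right_zero[symmetric])
  also have "\<dots> = (\<integral>x. character (- \<xi>) x * gaussian x \<partial>lborel)"
  proof (rule Bochner_Integration.integral_cong[OF refl])
    fix x
    have "- ?s * \<xi> * (?s * x) = - (?s * ?s * (x * \<xi>))"
      by (simp only: mult_ac mult_minus_left)
    also have "\<dots> = 2 * pi * (x \<bullet> - \<xi>)"
      unfolding scale(2) by simp
    finally have "cis (- ?s * \<xi> * (?s * x)) = character (- \<xi>) x"
      by (simp only: character_def)
    then show "?s * (of_real (std_normal_density (?s * x)) * cis (- ?s * \<xi> * (?s * x)))
        = character (- \<xi>) x * gaussian x"
      by (simp add: gaussian_real_eq_std_normal_density)
  qed
  also have "\<dots> = fourier gaussian \<xi>"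
    by (simp add: fourier_eq)
  finally show "fourier gaussian \<xi> = gaussian \<xi>" ..
qed

lemma integrable_gaussian: "integrable lborel gaussian"
  by (subst gaussian_eq_tensor) (intro integrable_tensor integrable_gaussian_real)

lemma fourier_gaussian: "fourier gaussian = gaussian"
proof -
  have "fourier (tensor (\<lambda>_. gaussian)) = tensor (\<lambda>_::'a. fourier gaussian)"
    by (intro fourier_tensor integrable_gaussian_real)
  then show ?thesis
    by (simp only: fourier_gaussian_real gaussian_eq_tensor[symmetric])
qed

lemma integral_gaussian: "integral\<^sup>L lborel (gaussian :: 'a::euclidean_space \<Rightarrow> complex) = 1"
proof -
  have "integral\<^sup>L lborel (gaussian :: 'a \<Rightarrow> complex) = fourier gaussian (0::'a)"
    by (simp add: fourier_eq[of gaussian])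
  then show ?thesis by (simp add: fourier_gaussian)
qed

lemma integral_fourier_mult_gaussian:
  fixes \<phi> :: "'a::euclidean_space \<Rightarrow> complex"
  assumes integrable_\<phi>: "integrable lborel \<phi>" and "s > 0"
  shows "(\<integral>x. fourier \<phi> x * gaussian (s *\<^sub>R x) \<partial>lborel)
    = (\<integral>x. gaussian x * \<phi> (s *\<^sub>R x) \<partial>lborel)"
proof -
  have [measurable]: "\<phi> \<in> borel_measurable borel" using integrable_\<phi> by auto
  have "fourier (\<lambda>x. gaussian (s *\<^sub>R x)) x = of_real (1 / s) ^ DIM('a) * gaussian (x /\<^sub>R s)"
    for x :: 'a
    using fourier_dilate[of gaussian "1 / s" x] \<open>s > 0\<close>
    by (simp add: fourier_gaussian divide_inverse)
  moreover have "integrable lborel (\<lambda>x::'a. gaussian (s *\<^sub>R x))"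
    using lborel_integrable_affine_iff[of "gaussian :: 'a \<Rightarrow> complex" s 0] \<open>s > 0\<close>
      integrable_gaussian by simp
  ultimately have "(\<integral>x. fourier \<phi> x * gaussian (s *\<^sub>R x) \<partial>lborel)
      = (\<integral>x. \<phi> x * (of_real (1 / s) ^ DIM('a) * gaussian (x /\<^sub>R s)) \<partial>lborel)"
    by (simp add: integral_fourier_mult[OF integrable_\<phi>])
  also have "\<dots> = of_real (1 / s) ^ DIM('a) * (\<integral>x. gaussian (x /\<^sub>R s) * \<phi> x \<partial>lborel)"
    by (simp only: integral_mult_right_zero[symmetric] mult_ac)
  also have "(\<integral>x. gaussian (x /\<^sub>R s) * \<phi> x \<partial>lborel)
      = s ^ DIM('a) *\<^sub>R (\<integral>x. gaussian x * \<phi> (s *\<^sub>R x) \<partial>lborel)"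
    using \<open>s > 0\<close> by (subst lborel_integral_affine[where c = s and t = 0]) auto
  also have "of_real (1 / s) ^ DIM('a) * \<dots> = (\<integral>x. gaussian x * \<phi> (s *\<^sub>R x) \<partial>lborel)"
    using \<open>s > 0\<close> by (simp add: scaleR_conv_of_real power_divide)
  finally show ?thesis .
qed

lemma integral_fourier:
  fixes \<phi> :: "'a::euclidean_space \<Rightarrow> complex"
  assumes "integrable lborel \<phi>" "bounded (range \<phi>)" "isCont \<phi> 0"
    and integrable_fourier: "integrable lborel (fourier \<phi>)"
  shows "integral\<^sup>L lborel (fourier \<phi>) = \<phi> 0"
proof -
  define s where "s k = inverse (real (Suc k))" for k
  have s_tendsto: "s \<longlonglongrightarrow> 0" and s_pos: "s k > 0" for k
    unfolding s_def by (rule LIMSEQ_inverse_real_of_nat) simp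
  have "bounded (range (gaussian :: 'a \<Rightarrow> complex))"
    by (auto simp: bounded_iff gaussian_def intro!: exI[of _ 1])
  then have "(\<lambda>k. \<integral>x. fourier \<phi> x * gaussian (s k *\<^sub>R x) \<partial>lborel)
      \<longlonglongrightarrow> integral\<^sup>L lborel (fourier \<phi>) * gaussian (0::'a)"
    by (intro integral_mult_scale_tendsto integrable_fourier gaussian_borel_measurable
        gaussian_continuous s_tendsto)
  moreover have "(\<lambda>k. \<integral>x. gaussian x * \<phi> (s k *\<^sub>R x) \<partial>lborel)
      \<longlonglongrightarrow> integral\<^sup>L lborel (gaussian :: 'a \<Rightarrow> complex) * \<phi> 0"
    by (intro integral_mult_scale_tendsto integrable_gaussian s_tendsto) (use assms in auto)
  ultimately have "integral\<^sup>L lborel (fourier \<phi>) * gaussian (0::'a)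
      = integral\<^sup>L lborel (gaussian :: 'a \<Rightarrow> complex) * \<phi> 0"
    unfolding integral_fourier_mult_gaussian[OF assms(1) s_pos] by (rule LIMSEQ_unique)
  then show ?thesis
    by (simp add: integral_gaussian)
qed

section \<open>Testing the spectrum with tensor products\<close>

definition spectrum :: "('a::euclidean_space \<Rightarrow> complex) \<Rightarrow> 'a set" where
  "spectrum f = distr_support (fourier_distr (distr_of f))"

lemma distr_support_Lebesgue_number:
  assumes "compact K" and "K \<inter> distr_support T = {}"
  obtains e where "e > 0" "\<And>x \<phi>. x \<in> K \<Longrightarrow> \<phi> \<in> test_functions (ball x e) \<Longrightarrow> T \<phi> = 0"
proof -
  let ?\<U> = "{U. open U \<and> (\<forall>\<phi>\<in>test_functions U. T \<phi> = 0)}"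
  have "K \<subseteq> \<Union>?\<U>"
    using assms(2) by (auto simp: distr_support_def)
  then obtain e where "e > 0" and ball_subset: "\<And>x. x \<in> K \<Longrightarrow> \<exists>U\<in>?\<U>. ball x e \<subseteq> U"
    using Heine_Borel_lemma[OF assms(1), of ?\<U>] by blast
  moreover have "T \<phi> = 0" if "x \<in> K" "\<phi> \<in> test_functions (ball x e)" for x \<phi>
    using ball_subset[OF that(1)] that(2) by (auto simp: test_functions_def)
  ultimately show ?thesis using that by blast
qed

text \<open>Test functions of this form have integrable Fourier transforms by reduction to one variable,
  and the class is stable under the localisation by products of bumps.\<close>

inductive_set tensor_test_functions :: "('a::euclidean_space \<Rightarrow> complex) set" where
  tensor: "(\<And>b. b \<in> Basis \<Longrightarrow> g b \<in> test_functions UNIV) \<Longrightarrow> tensor g \<in> tensor_test_functions"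
| diff: "\<phi> \<in> tensor_test_functions \<Longrightarrow> \<psi> \<in> tensor_test_functions \<Longrightarrow>
    (\<lambda>x. \<phi> x - \<psi> x) \<in> tensor_test_functions"

lemma tensor_test_functions_subset: "\<phi> \<in> tensor_test_functions \<Longrightarrow> \<phi> \<in> test_functions UNIV"
  by (induction rule: tensor_test_functions.induct)
     (simp_all add: tensor_in_test_functions test_functions_diff)

lemma tensor_test_functions_integrable:
  "\<phi> \<in> tensor_test_functions \<Longrightarrow> integrable lborel \<phi>"
  by (intro test_functions_integrable tensor_test_functions_subset)

lemma integrable_fourier_tensor_test_function:
  "\<phi> \<in> tensor_test_functions \<Longrightarrow> integrable lborel (fourier \<phi>)"
proof (induction rule: tensor_test_functions.induct)
  case (tensor g)
  then show ?case
    by (simp add: fourier_tensor test_functions_integrable integrable_tensor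
        integrable_fourier_real_test_function)
next
  case (diff \<phi> \<psi>)
  have "fourier (\<lambda>x. \<phi> x - \<psi> x) = (\<lambda>\<xi>. fourier \<phi> \<xi> - fourier \<psi> \<xi>)"
    using diff.hyps by (intro ext fourier_diff tensor_test_functions_integrable)
  with diff.IH show ?case by simp
qed

lemma tensor_test_functions_mult_tensor:
  assumes smooth_w: "\<And>b. b \<in> Basis \<Longrightarrow> smooth (w b)" and "\<phi> \<in> tensor_test_functions"
  shows "(\<lambda>x. tensor w x * \<phi> x) \<in> tensor_test_functions"
  using assms(2)
proof (induction rule: tensor_test_functions.induct)
  case (tensor g)
  then have "tensor (\<lambda>b t. w b t * g b t) \<in> tensor_test_functions"
    by (intro tensor_test_functions.tensor test_functions_mult smooth_w)
  then show ?case by (simp add: tensor_mult[abs_def])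
next
  case (diff \<phi> \<psi>)
  then show ?case
    using tensor_test_functions.diff[OF diff.IH] by (simp add: right_diff_distrib)
qed

definition lattice_weight :: "real \<Rightarrow> nat \<Rightarrow> nat \<Rightarrow> real \<Rightarrow> complex" where
  "lattice_weight \<delta> N j t = of_real (lattice_bump (t / \<delta> + real N - real j))"

lemma smooth_lattice_weight: "smooth (lattice_weight \<delta> N j)"
  using smooth_compose_affine[OF smooth_lattice_bump, of "1 / \<delta>" "real N - real j"]
  by (simp add: lattice_weight_def[abs_def] add_diff_eq)

lemma sum_tensor_lattice_weight:
  fixes x :: "'a::euclidean_space"
  assumes "\<delta> > 0" and "norm x \<le> \<delta> * real N"
  shows "(\<Sum>k\<in>PiE Basis (\<lambda>_. {..<2*N+1}). tensor (\<lambda>b. lattice_weight \<delta> N (k b)) x) = 1"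
proof -
  have "(\<Sum>j<2*N+1. lattice_weight \<delta> N j (x \<bullet> b)) = 1" if "b \<in> Basis" for b
  proof -
    have "\<bar>x \<bullet> b / \<delta>\<bar> \<le> real N"
      using Basis_le_norm[OF that, of x] assms by (simp add: abs_divide field_simps)
    then show ?thesis
      unfolding lattice_weight_def
      by (simp only: of_real_sum[symmetric] sum_lattice_bump of_real_1)
  qed
  then have "(\<Prod>b\<in>Basis. \<Sum>j<2*N+1. lattice_weight \<delta> N j (x \<bullet> b)) = 1"
    by (rule prod.neutral[OF ballI])
  then show ?thesis
    unfolding tensor_def by (subst (asm) prod_sum_PiE) auto
qed

lemma dist_le_if_lattice_weight_nonzero:
  fixes x y :: "'a::euclidean_space"
  assumes "\<delta> > 0"
    and x: "tensor (\<lambda>b. lattice_weight \<delta> N (k b)) x \<noteq> 0"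
    and y: "tensor (\<lambda>b. lattice_weight \<delta> N (k b)) y \<noteq> 0"
  shows "dist x y \<le> 2 * \<delta> * real DIM('a)"
proof -
  have near: "\<bar>z \<bullet> b / \<delta> + real N - real (k b)\<bar> < 1"
    if "b \<in> Basis" "tensor (\<lambda>b. lattice_weight \<delta> N (k b)) z \<noteq> 0" for b z
    using tensor_eq_0[OF that(1), of "\<lambda>b. lattice_weight \<delta> N (k b)" z] that(2)
    unfolding lattice_weight_def by (metis lattice_bump_eq_0 not_le of_real_0)
  have "\<bar>(x - y) \<bullet> b\<bar> \<le> 2 * \<delta>" if "b \<in> Basis" for b
  proof -
    have "\<bar>x \<bullet> b / \<delta> - y \<bullet> b / \<delta>\<bar> \<le> 2"
      using near[OF that x] near[OF that y] by linarith
    then show ?thesis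
      using \<open>\<delta> > 0\<close> by (simp add: inner_diff_left abs_divide field_simps flip: diff_divide_distrib)
  qed
  then have "norm (x - y) \<le> (\<Sum>b\<in>(Basis::'a set). 2 * \<delta>)"
    by (intro order_trans[OF norm_le_l1] sum_mono)
  then show ?thesis by (simp add: dist_norm mult_ac)
qed

lemma test_functions_ballI:
  assumes "\<phi> \<in> test_functions UNIV" and near: "\<And>y. \<phi> y \<noteq> 0 \<Longrightarrow> dist x y \<le> d" and "d < e"
  shows "\<phi> \<in> test_functions (ball x e)"
proof -
  have "closure {y. \<phi> y \<noteq> 0} \<subseteq> cball x d"
    by (rule closure_minimal) (use near in auto)
  also have "\<dots> \<subseteq> ball x e"
    using \<open>d < e\<close> by auto
  finally show ?thesis
    using assms(1) by (simp add: test_functions_def)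
qed

section \<open>Sums of integrable and bounded functions\<close>

definition large_part :: "real \<Rightarrow> ('a \<Rightarrow> complex) \<Rightarrow> 'a \<Rightarrow> real" where
  "large_part s f x = (if s < norm (f x) then norm (f x) else 0)"

lemma large_part_nonneg: "0 \<le> large_part s f x"
  by (simp add: large_part_def)

lemma norm_le_large_part: "0 \<le> s \<Longrightarrow> norm (f x) \<le> large_part s f x + s"
  by (simp add: large_part_def)

lemma borel_measurable_large_part[measurable]:
  assumes [measurable]: "f \<in> borel_measurable M"
  shows "large_part s f \<in> borel_measurable M"
  unfolding large_part_def[abs_def] by measurable

locale L1_plus_bounded =
  fixes f :: "'a::euclidean_space \<Rightarrow> complex" and s :: real
  assumes borel [measurable]: "f \<in> borel_measurable borel" and s_nonneg: "0 \<le> s"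
    and integrable_large_part: "integrable lborel (large_part s f)"
begin

lemma
  assumes integrable_k: "integrable lborel k" and norm_k_le: "\<And>x. norm (k x) \<le> D"
  shows integrable_mult: "integrable lborel (\<lambda>x. f x * k x)"
    and norm_integral_mult_le: "norm (\<integral>x. f x * k x \<partial>lborel)
      \<le> D * (\<integral>x. large_part s f x \<partial>lborel) + s * (\<integral>x. norm (k x) \<partial>lborel)"
proof -
  have [measurable]: "k \<in> borel_measurable borel" using integrable_k by auto
  have pointwise: "norm (f x * k x) \<le> D * large_part s f x + s * norm (k x)" for x
  proof -
    have "norm (f x * k x) \<le> (large_part s f x + s) * norm (k x)"
      unfolding norm_mult by (intro mult_right_mono norm_le_large_part s_nonneg) auto
    also have "\<dots> \<le> D * large_part s f x + s * norm (k x)"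
      using mult_right_mono[OF norm_k_le large_part_nonneg] by (simp add: algebra_simps)
    finally show ?thesis .
  qed
  have majorant: "integrable lborel (\<lambda>x. D * large_part s f x + s * norm (k x))"
    using integrable_large_part integrable_k by auto
  show integrable: "integrable lborel (\<lambda>x. f x * k x)"
    by (rule Bochner_Integration.integrable_bound[OF majorant])
       (auto intro!: AE_I2 order_trans[OF pointwise])
  have "norm (\<integral>x. f x * k x \<partial>lborel) \<le> (\<integral>x. D * large_part s f x + s * norm (k x) \<partial>lborel)"
    by (rule Bochner_Integration.integral_norm_bound_integral[OF integrable majorant])
      (rule pointwise)
  also have "\<dots> = D * (\<integral>x. large_part s f x \<partial>lborel) + s * (\<integral>x. norm (k x) \<partial>lborel)"
    using integrable_large_part integrable_k by simp
  finally show "norm (\<integral>x. f x * k x \<partial>lborel)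
      \<le> D * (\<integral>x. large_part s f x \<partial>lborel) + s * (\<integral>x. norm (k x) \<partial>lborel)" .
qed

lemma fourier_distr_eq_integral:
  assumes "\<phi> \<in> borel_measurable borel"
  shows "fourier_distr (distr_of f) \<phi> = (\<integral>x. f x * fourier \<phi> x \<partial>lborel)"
proof -
  note [measurable] = borel_measurable_fourier[OF assms]
  show ?thesis
    unfolding fourier_distr_def distr_of_def by (rule integral_completion) measurable
qed

lemma integrable_mult_fourier:
  "integrable lborel \<phi> \<Longrightarrow> integrable lborel (fourier \<phi>) \<Longrightarrow>
     integrable lborel (\<lambda>x. f x * fourier \<phi> x)"
  by (rule integrable_mult) (assumption, rule norm_fourier_le)

lemma fourier_distr_sum:
  assumes "\<And>i. i \<in> I \<Longrightarrow> integrable lborel (\<phi> i)"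
    and "\<And>i. i \<in> I \<Longrightarrow> integrable lborel (fourier (\<phi> i))"
  shows "fourier_distr (distr_of f) (\<lambda>x. \<Sum>i\<in>I. \<phi> i x) = (\<Sum>i\<in>I. fourier_distr (distr_of f) (\<phi> i))"
  using assms
  by (simp add: fourier_distr_eq_integral fourier_sum sum_distrib_left integrable_mult_fourier)

lemma fourier_distr_lattice_decomposition:
  assumes \<phi>: "\<phi> \<in> tensor_test_functions" and "\<delta> > 0"
  obtains N and I :: "('a \<Rightarrow> nat) set" where "fourier_distr (distr_of f) \<phi>
    = (\<Sum>k\<in>I. fourier_distr (distr_of f) (\<lambda>x. tensor (\<lambda>b. lattice_weight \<delta> N (k b)) x * \<phi> x))"
proof -
  obtain \<rho> where \<phi>_eq_0: "\<And>x. \<rho> \<le> norm x \<Longrightarrow> \<phi> x = 0"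
    using test_functions_UNIV_eq_0E[OF tensor_test_functions_subset[OF \<phi>]] by blast
  obtain N where "\<rho> / \<delta> \<le> real N" using real_arch_simple by blast
  then have N: "\<rho> \<le> \<delta> * real N" using \<open>\<delta> > 0\<close> by (simp add: field_simps)
  define I where "I = PiE (Basis :: 'a set) (\<lambda>_. {..<2*N+1})"
  define \<psi> where "\<psi> k x = tensor (\<lambda>b. lattice_weight \<delta> N (k b)) x * \<phi> x" for k x
  have \<psi>: "\<psi> k \<in> tensor_test_functions" for k
    unfolding \<psi>_def by (rule tensor_test_functions_mult_tensor[OF smooth_lattice_weight \<phi>])
  have "\<phi> = (\<lambda>x. \<Sum>k\<in>I. \<psi> k x)"
  proof
    fix x
    have "\<phi> x = 0 \<or> norm x \<le> \<delta> * real N"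
      using \<phi>_eq_0[of x] N by (meson linear order_trans)
    then show "\<phi> x = (\<Sum>k\<in>I. \<psi> k x)"
      using sum_tensor_lattice_weight[OF \<open>\<delta> > 0\<close>, of x N]
      by (auto simp: \<psi>_def I_def simp flip: sum_distrib_right)
  qed
  then have "fourier_distr (distr_of f) \<phi> = (\<Sum>k\<in>I. fourier_distr (distr_of f) (\<psi> k))"
    using fourier_distr_sum[of I \<psi>] \<psi>
    by (simp add: tensor_test_functions_integrable integrable_fourier_tensor_test_function)
  then show ?thesis
    unfolding \<psi>_def by (rule that)
qed

lemma fourier_distr_eq_0_off_spectrum:
  assumes \<phi>: "\<phi> \<in> tensor_test_functions" and disjoint: "closure {x. \<phi> x \<noteq> 0} \<inter> spectrum f = {}"
  shows "fourier_distr (distr_of f) \<phi> = 0"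
proof -
  let ?L = "fourier_distr (distr_of f)"
  have "compact (closure {x. \<phi> x \<noteq> 0})"
    using tensor_test_functions_subset[OF \<phi>] by (simp add: test_functions_def)
  then obtain e where "e > 0" and locally_0: "\<And>x \<psi>. x \<in> closure {x. \<phi> x \<noteq> 0} \<Longrightarrow>
      \<psi> \<in> test_functions (ball x e) \<Longrightarrow> ?L \<psi> = 0"
    using disjoint unfolding spectrum_def by (rule distr_support_Lebesgue_number) blast
  define \<delta> where "\<delta> = e / (4 * real DIM('a))"
  have "\<delta> > 0" and \<delta>: "2 * \<delta> * real DIM('a) < e"
    using \<open>e > 0\<close> by (simp_all add: \<delta>_def)
  obtain N and I :: "('a \<Rightarrow> nat) set" where decomposition:
    "?L \<phi> = (\<Sum>k\<in>I. ?L (\<lambda>x. tensor (\<lambda>b. lattice_weight \<delta> N (k b)) x * \<phi> x))"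
    by (rule fourier_distr_lattice_decomposition[OF \<phi> \<open>\<delta> > 0\<close>])
  have "?L (\<lambda>x. tensor (\<lambda>b. lattice_weight \<delta> N (k b)) x * \<phi> x) = 0" for k
  proof (cases "\<exists>x. tensor (\<lambda>b. lattice_weight \<delta> N (k b)) x * \<phi> x \<noteq> 0")
    case True
    let ?\<psi> = "\<lambda>x. tensor (\<lambda>b. lattice_weight \<delta> N (k b)) x * \<phi> x"
    obtain x where x: "?\<psi> x \<noteq> 0" using True ..
    have "?\<psi> \<in> test_functions UNIV"
      by (intro tensor_test_functions_subset tensor_test_functions_mult_tensor
          smooth_lattice_weight \<phi>)
    then have "?\<psi> \<in> test_functions (ball x e)"
      using x dist_le_if_lattice_weight_nonzero[OF \<open>\<delta> > 0\<close>, of N k x]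
      by (elim test_functions_ballI[OF _ _ \<delta>]) simp
    moreover have "x \<in> closure {x. \<phi> x \<noteq> 0}"
      using x closure_subset[of "{x. \<phi> x \<noteq> 0}"] by auto
    ultimately show ?thesis by (rule locally_0[rotated])
  next
    case False
    then have "tensor (\<lambda>b. lattice_weight \<delta> N (k b)) x * \<phi> x = 0" for x by blast
    then show ?thesis
      by (simp only: fourier_distr_def distr_of_def fourier_def) simp
  qed
  with decomposition show ?thesis by simp
qed

end

section \<open>The reproducing kernel\<close>

definition cutoff_symbol :: "'a::euclidean_space \<Rightarrow> complex" where
  "cutoff_symbol = tensor (\<lambda>_ t. of_real (cutoff t))"

definition cutoff_kernel :: "'a::euclidean_space \<Rightarrow> complex" where
  "cutoff_kernel = fourier cutoff_symbol"

definition rescale :: "('a::euclidean_space \<Rightarrow> complex) \<Rightarrow> real \<Rightarrow> 'a \<Rightarrow> 'a \<Rightarrow> complex" where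
  "rescale H r y x = of_real r ^ DIM('a) * H (r *\<^sub>R (x - y))"

lemma cutoff_in_test_functions:
  assumes "r > 0"
  shows "(\<lambda>t. of_real (cutoff (t / r))) \<in> test_functions UNIV"
proof -
  have "smooth (\<lambda>t. complex_of_real (cutoff (t / r)))"
    using smooth_compose_affine[OF smooth_cutoff, of "1 / r" 0] by simp
  moreover have "\<bar>t\<bar> \<le> 3 * r" if "cutoff (t / r) \<noteq> 0" for t
    using that cutoff_eq_0[of "t / r"] assms by (auto simp: abs_divide field_simps intro: ccontr)
  then have "bounded {t. complex_of_real (cutoff (t / r)) \<noteq> 0}"
    by (auto simp: bounded_iff)
  ultimately show ?thesis by (simp add: test_functions_UNIV_iff)
qed

lemma cutoff_symbol_in_tensor_test_functions: "cutoff_symbol \<in> tensor_test_functions"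
  unfolding cutoff_symbol_def
  using cutoff_in_test_functions[of 1] by (intro tensor_test_functions.tensor) simp

lemma cutoff_symbol_eq_1:
  assumes "norm x \<le> 2"
  shows "cutoff_symbol x = 1"
  using assms Basis_le_norm[of _ x] unfolding cutoff_symbol_def tensor_def
  by (intro prod.neutral) (auto intro!: cutoff_eq_1 intro: order_trans)

lemma integrable_cutoff_kernel: "integrable lborel cutoff_kernel"
  unfolding cutoff_kernel_def
  by (intro integrable_fourier_tensor_test_function cutoff_symbol_in_tensor_test_functions)

lemma norm_cutoff_kernel_le:
  "norm (cutoff_kernel (x::'a::euclidean_space)) \<le> (\<integral>x. norm (cutoff_symbol (x::'a)) \<partial>lborel)"
  unfolding cutoff_kernel_def
  by (intro norm_fourier_le tensor_test_functions_integrable cutoff_symbol_in_tensor_test_functions)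

lemma integral_cutoff_kernel:
  "integral\<^sup>L lborel (cutoff_kernel :: 'a::euclidean_space \<Rightarrow> complex) = 1"
proof -
  have symbol_test: "(cutoff_symbol :: 'a \<Rightarrow> complex) \<in> test_functions UNIV"
    by (intro tensor_test_functions_subset cutoff_symbol_in_tensor_test_functions)
  then have "isCont (cutoff_symbol :: 'a \<Rightarrow> complex) 0"
    by (intro differentiable_imp_continuous_within smooth_differentiable test_functions_smooth)
  with symbol_test have "integral\<^sup>L lborel (cutoff_kernel :: 'a \<Rightarrow> complex) = cutoff_symbol (0::'a)"
    using integrable_cutoff_kernel[where 'a = 'a] unfolding cutoff_kernel_def
    by (simp add: integral_fourier test_functions_integrable bounded_range_test_function)
  then show ?thesis by (simp add: cutoff_symbol_eq_1)
qed

lemma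
  fixes H :: "'a::euclidean_space \<Rightarrow> complex"
  assumes integrable_H: "integrable lborel H" and "r > 0"
  shows integrable_rescale: "integrable lborel (rescale H r y)"
    and integral_norm_rescale: "(\<integral>x. norm (rescale H r y x) \<partial>lborel) = (\<integral>x. norm (H x) \<partial>lborel)"
proof -
  have [measurable]: "H \<in> borel_measurable borel" using integrable_H by auto
  have affine: "(- r) *\<^sub>R y + r *\<^sub>R x = r *\<^sub>R (x - y)" for x
    by (simp add: algebra_simps)
  have "integrable lborel (\<lambda>x. H (r *\<^sub>R (x - y)))"
    using lborel_integrable_affine_iff[of H r "(- r) *\<^sub>R y"] integrable_H \<open>r > 0\<close>
    by (simp only: affine) simp
  then show "integrable lborel (rescale H r y)"
    by (simp add: rescale_def[abs_def])
  show "(\<integral>x. norm (rescale H r y x) \<partial>lborel) = (\<integral>x. norm (H x) \<partial>lborel)"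
    using lborel_integral_affine[of "\<lambda>x. norm (H x)" r "(- r) *\<^sub>R y"] \<open>r > 0\<close>
    by (simp only: affine) (simp add: rescale_def norm_mult norm_power)
qed

definition modulated_cutoff :: "'a::euclidean_space \<Rightarrow> real \<Rightarrow> 'a \<Rightarrow> complex" where
  "modulated_cutoff y r x = character y x * cutoff_symbol (x /\<^sub>R r)"

lemma modulated_cutoff_in_tensor_test_functions:
  assumes "r > 0"
  shows "modulated_cutoff y r \<in> tensor_test_functions"
proof -
  have "tensor (\<lambda>b t. character (y \<bullet> b) t * of_real (cutoff (t / r))) \<in> tensor_test_functions"
    using assms by (intro tensor_test_functions.tensor test_functions_mult smooth_character
        cutoff_in_test_functions)
  also have "tensor (\<lambda>b t. character (y \<bullet> b) t * of_real (cutoff (t / r))) = modulated_cutoff y r"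
    by (simp add: tensor_mult[abs_def] modulated_cutoff_def[abs_def] character_eq_tensor[of y]
        cutoff_symbol_def tensor_def divide_inverse mult.commute)
  finally show ?thesis .
qed

lemma fourier_modulated_cutoff:
  fixes y :: "'a::euclidean_space"
  assumes "r > 0"
  shows "fourier (modulated_cutoff y r) x = rescale cutoff_kernel r y x"
proof -
  have [measurable]: "(cutoff_symbol :: 'a \<Rightarrow> complex) \<in> borel_measurable borel"
    using tensor_test_functions_subset[OF cutoff_symbol_in_tensor_test_functions]
    by (rule test_functions_borel_measurable)
  show ?thesis
    unfolding modulated_cutoff_def[abs_def] rescale_def cutoff_kernel_def using assms
    by (simp add: fourier_modulate fourier_dilate)
qed

lemma modulated_cutoff_eq_character:
  "r > 0 \<Longrightarrow> norm x \<le> 2 * r \<Longrightarrow> modulated_cutoff y r x = character y x"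
  by (simp add: modulated_cutoff_def cutoff_symbol_eq_1 field_simps)

context L1_plus_bounded
begin

text \<open>The modulated symbols of scale at least \<open>R\<close> all agree near the spectrum.\<close>

lemma integral_rescaled_cutoff_kernel:
  assumes spectrum: "spectrum f \<subseteq> cball 0 R" and "0 < R" "R \<le> r"
  shows "(\<integral>x. f x * rescale cutoff_kernel r y x \<partial>lborel)
    = (\<integral>x. f x * rescale cutoff_kernel R y x \<partial>lborel)"
proof -
  have "r > 0" using assms by simp
  note cutoffs = modulated_cutoff_in_tensor_test_functions[OF \<open>r > 0\<close>, of y]
    modulated_cutoff_in_tensor_test_functions[OF \<open>0 < R\<close>, of y]
  define \<psi> where "\<psi> x = modulated_cutoff y r x - modulated_cutoff y R x" for x
  have \<psi>: "\<psi> \<in> tensor_test_functions"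
    unfolding \<psi>_def by (rule tensor_test_functions.diff[OF cutoffs])
  have "2 * R \<le> norm x" if "\<psi> x \<noteq> 0" for x
    using that modulated_cutoff_eq_character[of r x y] modulated_cutoff_eq_character[of R x y] assms
    by (fastforce simp: \<psi>_def)
  then have "closure {x. \<psi> x \<noteq> 0} \<subseteq> {x. 2 * R \<le> norm x}"
    by (intro closure_minimal closed_Collect_le continuous_intros) auto
  with spectrum \<open>0 < R\<close> have "closure {x. \<psi> x \<noteq> 0} \<inter> spectrum f = {}"
    by (force simp: subset_iff)
  then have "fourier_distr (distr_of f) \<psi> = 0"
    by (rule fourier_distr_eq_0_off_spectrum[OF \<psi>])
  moreover have "fourier \<psi> x = rescale cutoff_kernel r y x - rescale cutoff_kernel R y x" for x
    unfolding \<psi>_def using cutoffs \<open>r > 0\<close> \<open>0 < R\<close>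
    by (simp add: fourier_diff tensor_test_functions_integrable fourier_modulated_cutoff)
  ultimately have
    "(\<integral>x. f x * rescale cutoff_kernel r y x - f x * rescale cutoff_kernel R y x \<partial>lborel) = 0"
    using tensor_test_functions_integrable[OF \<psi>]
    by (simp add: fourier_distr_eq_integral right_diff_distrib)
  moreover have "integrable lborel (\<lambda>x. f x * rescale cutoff_kernel \<tau> y x)" if "\<tau> > 0" for \<tau>
    using integrable_mult_fourier[of "modulated_cutoff y \<tau>"]
      modulated_cutoff_in_tensor_test_functions[OF that, of y]
    by (simp add: tensor_test_functions_integrable integrable_fourier_tensor_test_function
        fourier_modulated_cutoff[OF that])
  ultimately show ?thesis
    using \<open>r > 0\<close> \<open>0 < R\<close> by simp
qed

end

section \<open>Approximate identities\<close>

lemma AE_bounded_if_cube_averages_bounded: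
  fixes f :: "'a::euclidean_space \<Rightarrow> complex"
  assumes integrable: "\<And>a b. f integrable_on cbox a b"
    and average_le: "\<And>x h. 0 < h \<Longrightarrow> norm (integral (cbox x (x + h *\<^sub>R One)) f) \<le> M * h ^ DIM('a)"
  shows "AE x in lborel. norm (f x) \<le> M"
proof -
  let ?average = "\<lambda>x h. integral (cbox x (x + h *\<^sub>R One)) f /\<^sub>R h ^ DIM('a)"
  obtain N where "negligible N" and average_tendsto: "\<And>x e. \<lbrakk>x \<notin> N; 0 < e\<rbrakk> \<Longrightarrow>
      \<exists>d>0. \<forall>h. 0 < h \<and> h < d \<longrightarrow> norm (?average x h - f x) < e"
    using integrable_ccontinuous_explicit[OF integrable] by blast
  have "norm (f x) \<le> M" if outside: "x \<notin> N" for x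
  proof (rule field_le_epsilon)
    fix e :: real assume "e > 0"
    then obtain d where "d > 0"
      and close: "\<And>h. 0 < h \<Longrightarrow> h < d \<Longrightarrow> norm (?average x h - f x) < e"
      using average_tendsto[OF outside] by blast
    define h where "h = d / 2"
    have "0 < h" "h < d" using \<open>d > 0\<close> by (auto simp: h_def)
    have "norm (?average x h) \<le> M"
      using average_le[OF \<open>0 < h\<close>, of x] \<open>0 < h\<close> by (simp add: field_simps)
    with close[OF \<open>0 < h\<close> \<open>h < d\<close>] norm_triangle_sub[of "f x" "?average x h"]
    show "norm (f x) \<le> M + e"
      by (simp only: norm_minus_commute[of "f x"])
  qed
  moreover have "AE x in lborel. x \<notin> N"
    using \<open>negligible N\<close> AE_not_in[of N lebesgue]
    by (simp add: negligible_iff_null_sets AE_completion_iff)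
  ultimately show ?thesis by auto
qed

definition window_integral :: "('a::euclidean_space \<Rightarrow> complex) \<Rightarrow> 'a set \<Rightarrow> 'a \<Rightarrow> complex" where
  "window_integral f Q z = (\<integral>y. indicator Q y *\<^sub>R f (z + y) \<partial>lborel)"

context L1_plus_bounded
begin

lemma
  assumes [measurable]: "Q \<in> sets borel" and finite_Q: "emeasure lborel Q < \<infinity>"
  shows integrable_window: "integrable lborel (\<lambda>y. indicator Q y *\<^sub>R f (z + y))"
    and integral_norm_window_le: "(\<integral>y. norm (indicator Q y *\<^sub>R f (z + y)) \<partial>lborel)
      \<le> (\<integral>y. large_part s f y \<partial>lborel) + s * measure lborel Q"
proof -
  have shift: "integrable lborel (\<lambda>y. large_part s f (z + y))"
      "(\<integral>y. large_part s f (z + y) \<partial>lborel) = (\<integral>y. large_part s f y \<partial>lborel)"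
    using lborel_integrable_affine_iff[of "large_part s f" 1 z]
      lborel_integral_affine[of "large_part s f" 1 z] integrable_large_part by simp_all
  have indicator: "integrable lborel (indicator Q :: 'a \<Rightarrow> real)"
    using finite_Q by (intro integrable_real_indicator) auto
  have majorant: "integrable lborel (\<lambda>y. large_part s f (z + y) + s * indicator Q y)"
    using shift indicator by auto
  have pointwise: "norm (indicator Q y *\<^sub>R f (z + y))
      \<le> large_part s f (z + y) + s * indicator Q y" for y
    using norm_le_large_part[OF s_nonneg, of f "z + y"] large_part_nonneg[of s f "z + y"]
    by (auto simp: indicator_def)
  show integrable: "integrable lborel (\<lambda>y. indicator Q y *\<^sub>R f (z + y))"
    by (rule Bochner_Integration.integrable_bound[OF majorant _
            AE_I2[OF order_trans[OF pointwise]]])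
      auto
  have "(\<integral>y. norm (indicator Q y *\<^sub>R f (z + y)) \<partial>lborel)
      \<le> (\<integral>y. large_part s f (z + y) + s * indicator Q y \<partial>lborel)"
    by (rule integral_mono[OF integrable_norm[OF integrable] majorant pointwise])
  also have "\<dots> = (\<integral>y. large_part s f y \<partial>lborel) + s * measure lborel Q"
    using shift indicator by simp
  finally show "(\<integral>y. norm (indicator Q y *\<^sub>R f (z + y)) \<partial>lborel)
      \<le> (\<integral>y. large_part s f y \<partial>lborel) + s * measure lborel Q" .
qed

lemma bounded_range_window_integral:
  assumes "Q \<in> sets borel" and "emeasure lborel Q < \<infinity>"
  shows "bounded (range (window_integral f Q))"
proof -
  have "norm (window_integral f Q z) \<le> (\<integral>y. large_part s f y \<partial>lborel) + s * measure lborel Q" for z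
    unfolding window_integral_def
    by (rule order_trans[OF integral_norm_bound integral_norm_window_le[OF assms]])
  then show ?thesis by (auto simp: bounded_iff)
qed

lemma borel_measurable_window_integral[measurable]:
  assumes [measurable]: "Q \<in> sets borel"
  shows "window_integral f Q \<in> borel_measurable borel"
  unfolding window_integral_def[abs_def] by measurable

lemma
  shows integrable_on_cbox: "f integrable_on cbox a b"
    and window_integral_cbox: "window_integral f (cbox a b) z = integral (cbox (a + z) (b + z)) f"
proof -
  have set_integrable: "set_integrable lborel (cbox a b) (\<lambda>y. f (z + y))" for z
    using integrable_window[of "cbox a b" z]
    by (simp add: set_integrable_def emeasure_lborel_cbox_eq)
  from set_borel_integral_eq_integral(1)[OF this[of 0]] show "f integrable_on cbox a b" by simp
  have "window_integral f (cbox a b) z = integral (cbox a b) (\<lambda>y. f (z + y))"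
    using set_borel_integral_eq_integral(2)[OF set_integrable, of z]
    by (simp add: window_integral_def set_lebesgue_integral_def)
  also have "\<dots> = integral (cbox (a + z) (b + z)) f"
    using integral_shift_cbox_plus[of a b f z] by (simp add: o_def)
  finally show "window_integral f (cbox a b) z = integral (cbox (a + z) (b + z)) f" .
qed

lemma isCont_window_integral: "isCont (window_integral f (cbox a b)) z"
  unfolding continuous_at_eps_delta
proof (intro allI impI)
  fix e :: real assume "e > 0"
  have "bounded (cball (a + z) 1 \<union> cball (b + z) 1)" by simp
  then obtain c where balls: "cball (a + z) 1 \<union> cball (b + z) 1 \<subseteq> cbox (- c) c"
    by (rule bounded_subset_cbox_symmetric)
  then have "a + z \<in> cbox (- c) c" "b + z \<in> cbox (- c) c"
    by (auto simp: subset_iff)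
  from indefinite_integral_continuous[OF integrable_on_cbox this \<open>e > 0\<close>]
  obtain d where "d > 0" and close: "\<And>a' b'. \<lbrakk>a' \<in> cbox (- c) c; b' \<in> cbox (- c) c;
      norm (a' - (a + z)) \<le> d; norm (b' - (b + z)) \<le> d\<rbrakk> \<Longrightarrow>
      norm (integral (cbox a' b') f - integral (cbox (a + z) (b + z)) f) < e"
    by blast
  have "dist (window_integral f (cbox a b) z') (window_integral f (cbox a b) z) < e"
    if "dist z' z < min d 1" for z'
  proof -
    have "a + z' \<in> cball (a + z) 1" "b + z' \<in> cball (b + z) 1"
      using that by (simp_all add: dist_norm norm_minus_commute)
    with balls have "a + z' \<in> cbox (- c) c" "b + z' \<in> cbox (- c) c" by auto
    then show ?thesis
      using close[of "a + z'" "b + z'"] that by (simp add: window_integral_cbox dist_norm)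
  qed
  then show "\<exists>d>0. \<forall>z'. dist z' z < d \<longrightarrow>
      dist (window_integral f (cbox a b) z') (window_integral f (cbox a b) z) < e"
    using \<open>d > 0\<close> by (intro exI[of _ "min d 1"]) auto
qed

lemma integral_mult_rescale:
  assumes [measurable]: "H \<in> borel_measurable borel" and "r > 0"
  shows "(\<integral>x. f x * rescale H r y x \<partial>lborel) = (\<integral>x. H x * f (x /\<^sub>R r + y) \<partial>lborel)"
proof -
  have "(\<integral>x. f x * rescale H r y x \<partial>lborel)
      = (1 / r) ^ DIM('a) *\<^sub>R (\<integral>x. of_real r ^ DIM('a) * (H x * f (y + (1 / r) *\<^sub>R x)) \<partial>lborel)"
    using \<open>r > 0\<close> by (subst lborel_integral_affine[where c = "1 / r" and t = y])
      (auto simp: rescale_def[abs_def] mult_ac)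
  also have "\<dots> = (\<integral>x. H x * f (y + (1 / r) *\<^sub>R x) \<partial>lborel)"
    using \<open>r > 0\<close> by (simp add: scaleR_conv_of_real power_divide)
  finally show ?thesis by (simp add: divide_inverse add.commute)
qed

lemma integrable_pair_mult_window:
  assumes integrable_H: "integrable lborel H"
    and [measurable]: "Q \<in> sets borel" and finite_Q: "emeasure lborel Q < \<infinity>"
  shows "integrable (lborel \<Otimes>\<^sub>M lborel) (\<lambda>(x, y). H x * (indicator Q y *\<^sub>R f (x /\<^sub>R r + y)))"
    (is "integrable _ (\<lambda>(x, y). ?G x y)")
proof (rule lborel_pair.Fubini_integrable)
  have [measurable]: "H \<in> borel_measurable borel" using integrable_H by auto
  define B where "B = (\<integral>y. large_part s f y \<partial>lborel) + s * measure lborel Q"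
  have "(\<integral>y. norm (?G x y) \<partial>lborel) \<le> norm (H x) * B" for x
    unfolding norm_mult integral_mult_right_zero B_def
    by (intro mult_left_mono integral_norm_window_le finite_Q) auto
  then have "AE x in lborel. norm (\<integral>y. norm (case (x, y) of (x, y) \<Rightarrow> ?G x y) \<partial>lborel)
      \<le> norm (norm (H x) * B)"
    by (intro AE_I2) (auto intro!: order_trans[OF _ abs_ge_self])
  then show "integrable lborel (\<lambda>x. \<integral>y. norm (case (x, y) of (x, y) \<Rightarrow> ?G x y) \<partial>lborel)"
    by (rule Bochner_Integration.integrable_bound[rotated 2]) (use integrable_H in simp, measurable)
  show "AE x in lborel. integrable lborel (\<lambda>y. case (x, y) of (x, y) \<Rightarrow> ?G x y)"
    unfolding prod.case by (intro AE_I2 integrable_mult_right integrable_window finite_Q) auto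
  show "(\<lambda>(x, y). ?G x y) \<in> borel_measurable (lborel \<Otimes>\<^sub>M lborel)"
    by measurable
qed

lemma norm_integral_mult_window_le:
  assumes integrable_H: "integrable lborel H" and "r > 0"
    and [measurable]: "Q \<in> sets borel" and finite_Q: "emeasure lborel Q < \<infinity>"
    and rescaled_le: "\<And>y. norm (\<integral>x. f x * rescale H r y x \<partial>lborel) \<le> M"
  shows "norm (\<integral>x. H x * window_integral f Q (x /\<^sub>R r) \<partial>lborel) \<le> M * measure lborel Q"
proof -
  have [measurable]: "H \<in> borel_measurable borel" using integrable_H by auto
  define G where "G x y = H x * (indicator Q y *\<^sub>R f (x /\<^sub>R r + y))" for x y
  have integrable_G: "integrable (lborel \<Otimes>\<^sub>M lborel) (\<lambda>(x, y). G x y)"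
    unfolding G_def by (rule integrable_pair_mult_window[OF integrable_H _ finite_Q]) measurable
  have "(\<integral>x. H x * window_integral f Q (x /\<^sub>R r) \<partial>lborel) = (\<integral>x. (\<integral>y. G x y \<partial>lborel) \<partial>lborel)"
    unfolding G_def window_integral_def by (simp only: integral_mult_right_zero)
  also have "\<dots> = (\<integral>y. (\<integral>x. G x y \<partial>lborel) \<partial>lborel)"
    by (rule lborel_pair.Fubini_integral[OF integrable_G, symmetric])
  also have "norm \<dots> \<le> (\<integral>y. M * indicator Q y \<partial>lborel)"
  proof (rule Bochner_Integration.integral_norm_bound_integral)
    show "integrable lborel (\<lambda>y. \<integral>x. G x y \<partial>lborel)"
      by (rule lborel_pair.integrable_snd[OF integrable_G])
    show "integrable lborel (\<lambda>y. M * indicator Q y :: real)"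
      using finite_Q by (intro integrable_mult_right integrable_real_indicator) auto
    have "norm (\<integral>x. H x * f (x /\<^sub>R r + y) \<partial>lborel) \<le> M" for y
      using rescaled_le[of y] \<open>r > 0\<close> by (simp add: integral_mult_rescale)
    then show "norm (\<integral>x. G x y \<partial>lborel) \<le> M * indicator Q y" for y
      by (auto simp: G_def indicator_def)
  qed
  also have "\<dots> = M * measure lborel Q" using finite_Q by simp
  finally show ?thesis .
qed

lemma AE_bounded_if_rescaled_bounded:
  assumes integrable_H: "integrable lborel H" and "integral\<^sup>L lborel H = 1" and "R > 0"
    and rescaled_le: "\<And>r y. R \<le> r \<Longrightarrow> norm (\<integral>x. f x * rescale H r y x \<partial>lborel) \<le> M"
  shows "AE x in lborel. norm (f x) \<le> M"
proof (rule AE_bounded_if_cube_averages_bounded[OF integrable_on_cbox])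
  fix a :: 'a and h :: real assume "0 < h"
  define Q where "Q = cbox a (a + h *\<^sub>R One)"
  have Q: "Q \<in> sets borel" "emeasure lborel Q < \<infinity>"
    by (simp_all add: Q_def emeasure_lborel_cbox_eq)
  define z where "z k = inverse (R + real k)" for k
  have "z \<longlonglongrightarrow> 0"
    unfolding z_def by (intro tendsto_inverse_0_at_top filterlim_real_sequentially
        filterlim_tendsto_add_at_top[OF tendsto_const])
  then have "(\<lambda>k. \<integral>x. H x * window_integral f Q (z k *\<^sub>R x) \<partial>lborel)
      \<longlonglongrightarrow> integral\<^sup>L lborel H * window_integral f Q 0"
    by (intro integral_mult_scale_tendsto integrable_H borel_measurable_window_integral
        bounded_range_window_integral Q) (simp_all add: Q_def isCont_window_integral)
  then have tendsto: "(\<lambda>k. norm (\<integral>x. H x * window_integral f Q (z k *\<^sub>R x) \<partial>lborel))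
      \<longlonglongrightarrow> norm (window_integral f Q 0)"
    using \<open>integral\<^sup>L lborel H = 1\<close> by (auto dest: tendsto_norm)
  have "norm (\<integral>x. H x * window_integral f Q (z k *\<^sub>R x) \<partial>lborel) \<le> M * measure lborel Q" for k
    unfolding z_def using \<open>R > 0\<close>
    by (intro norm_integral_mult_window_le integrable_H Q rescaled_le) auto
  then have "norm (window_integral f Q 0) \<le> M * measure lborel Q"
    by (intro LIMSEQ_le_const2[OF tendsto]) auto
  moreover have "measure lborel Q = h ^ DIM('a)"
    using \<open>0 < h\<close> unfolding Q_def by (subst measure_lborel_cbox) (auto simp: inner_simps)
  ultimately show "norm (integral (cbox a (a + h *\<^sub>R One)) f) \<le> M * h ^ DIM('a)"
    by (simp add: Q_def window_integral_cbox)
qed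

lemma AE_norm_le_if_spectrum_subset:
  assumes spectrum: "spectrum f \<subseteq> cball 0 R" and "R > 0"
  shows "AE x in lborel. norm (f x)
    \<le> (\<integral>x. norm (cutoff_symbol (x::'a)) \<partial>lborel) * R ^ DIM('a) * (\<integral>x. large_part s f x \<partial>lborel)
      + s * (\<integral>x. norm (cutoff_kernel (x::'a)) \<partial>lborel)"
proof (rule AE_bounded_if_rescaled_bounded[OF integrable_cutoff_kernel integral_cutoff_kernel
      \<open>R > 0\<close>])
  fix r :: real and y :: 'a assume "R \<le> r"
  let ?D = "(\<integral>x. norm (cutoff_symbol (x::'a)) \<partial>lborel) * R ^ DIM('a)"
  have "norm (rescale cutoff_kernel R y x) \<le> ?D" for x
    using \<open>R > 0\<close> norm_cutoff_kernel_le by (simp add: rescale_def norm_mult norm_power)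
  then have "norm (\<integral>x. f x * rescale cutoff_kernel R y x \<partial>lborel)
      \<le> ?D * (\<integral>x. large_part s f x \<partial>lborel) + s * (\<integral>x. norm (rescale cutoff_kernel R y x) \<partial>lborel)"
    by (intro norm_integral_mult_le integrable_rescale integrable_cutoff_kernel \<open>R > 0\<close>)
  then show "norm (\<integral>x. f x * rescale cutoff_kernel r y x \<partial>lborel)
      \<le> ?D * (\<integral>x. large_part s f x \<partial>lborel) + s * (\<integral>x. norm (cutoff_kernel (x::'a)) \<partial>lborel)"
    using integral_rescaled_cutoff_kernel[OF spectrum \<open>R > 0\<close> \<open>R \<le> r\<close>]
      integral_norm_rescale[OF integrable_cutoff_kernel[where 'a = 'a] \<open>R > 0\<close>] by simp
qed

end

lemma bandlimited_AE_bound: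
  obtains C :: real where "C > 0"
    "\<And>R s (f :: 'a::euclidean_space \<Rightarrow> complex). R > 0 \<Longrightarrow> L1_plus_bounded f s \<Longrightarrow>
       spectrum f \<subseteq> cball 0 R \<Longrightarrow>
       AE x in lborel. norm (f x) \<le> C * (R ^ DIM('a) * (\<integral>x. large_part s f x \<partial>lborel) + s)"
proof -
  define D where "D = (\<integral>x. norm (cutoff_symbol (x::'a)) \<partial>lborel)"
  define E where "E = (\<integral>x. norm (cutoff_kernel (x::'a)) \<partial>lborel)"
  have nonneg: "0 \<le> D" "0 \<le> E" by (simp_all add: D_def E_def)
  have "AE x in lborel. norm (f x)
      \<le> (D + E + 1) * (R ^ DIM('a) * (\<integral>x. large_part s f x \<partial>lborel) + s)"
    if "R > 0" and f: "L1_plus_bounded f s" and spectrum: "spectrum f \<subseteq> cball 0 R"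
    for R s and f :: "'a \<Rightarrow> complex"
  proof -
    interpret L1_plus_bounded f s by (rule f)
    let ?I = "R ^ DIM('a) * (\<integral>x. large_part s f x \<partial>lborel)"
    have "0 \<le> ?I" using \<open>R > 0\<close> by (simp add: large_part_nonneg)
    then have "D * ?I \<le> (D + E + 1) * ?I" "E * s \<le> (D + E + 1) * s"
      using nonneg s_nonneg by (intro mult_right_mono; simp)+
    then have "D * ?I + s * E \<le> (D + E + 1) * (?I + s)"
      by (simp add: distrib_left mult.commute)
    moreover have "AE x in lborel. norm (f x) \<le> D * ?I + s * E"
      using AE_norm_le_if_spectrum_subset[OF spectrum \<open>R > 0\<close>] by (simp add: D_def E_def mult.assoc)
    ultimately show ?thesis by (auto elim!: eventually_mono)
  qed
  moreover have "D + E + 1 > 0" using nonneg by simp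
  ultimately show ?thesis using that by blast
qed

section \<open>Rearrangements\<close>

definition distribution_function :: "('a::euclidean_space \<Rightarrow> complex) \<Rightarrow> real \<Rightarrow> ennreal" where
  "distribution_function f s = emeasure lebesgue {x. s < norm (f x)}"

lemma sets_lebesgue_less_norm:
  assumes [measurable]: "f \<in> borel_measurable lebesgue"
  shows "{x. s < norm (f x)} \<in> sets lebesgue"
proof -
  have "{x \<in> space lebesgue. s < norm (f x)} \<in> sets lebesgue" by measurable
  then show ?thesis by simp
qed

lemma distribution_function_antimono:
  assumes "f \<in> borel_measurable lebesgue" and "s \<le> s'"
  shows "distribution_function f s' \<le> distribution_function f s"
  unfolding distribution_function_def
  using assms by (intro emeasure_mono sets_lebesgue_less_norm) auto

lemma distribution_function_right_continuous:
  assumes measurable_f: "f \<in> borel_measurable lebesgue"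
  shows "(SUP k. distribution_function f (s + 1 / real (Suc k))) = distribution_function f s"
proof -
  define A where "A k = {x. s + 1 / real (Suc k) < norm (f x)}" for k
  have "(SUP k. emeasure lebesgue (A k)) = emeasure lebesgue (\<Union>k. A k)"
  proof (rule SUP_emeasure_incseq)
    show "incseq A"
      unfolding A_def by (intro monoI Collect_mono impI)
        (auto elim!: le_less_trans[rotated] intro!: divide_left_mono)
  qed (use sets_lebesgue_less_norm[OF measurable_f] in \<open>auto simp: A_def\<close>)
  also have "(\<Union>k. A k) = {x. s < norm (f x)}"
  proof (intro set_eqI iffI)
    fix x assume "x \<in> {x. s < norm (f x)}"
    then obtain k where "inverse (real (Suc k)) < norm (f x) - s"
      using reals_Archimedean[of "norm (f x) - s"] by auto
    then show "x \<in> (\<Union>k. A k)"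
      by (auto simp: A_def inverse_eq_divide intro!: exI[of _ k])
  qed (auto simp: A_def elim!: le_less_trans[rotated])
  finally show ?thesis
    by (simp add: distribution_function_def A_def)
qed

lemma rearrangement_le_iff:
  assumes measurable_f: "f \<in> borel_measurable lebesgue" and "0 \<le> s"
  shows "rearrangement f t \<le> ennreal s \<longleftrightarrow> distribution_function f s \<le> ennreal t"
proof
  assume "distribution_function f s \<le> ennreal t"
  with \<open>0 \<le> s\<close> show "rearrangement f t \<le> ennreal s"
    unfolding rearrangement_def distribution_function_def by (intro Inf_lower) auto
next
  assume "rearrangement f t \<le> ennreal s"
  have "distribution_function f (s + 1 / real (Suc k)) \<le> ennreal t" for k
  proof -
    have "rearrangement f t < ennreal (s + 1 / real (Suc k))"
      using \<open>rearrangement f t \<le> ennreal s\<close> \<open>0 \<le> s\<close>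
      by (elim le_less_trans) (simp add: ennreal_lessI)
    then obtain s' where "0 \<le> s'" "ennreal s' < ennreal (s + 1 / real (Suc k))"
      and admissible: "distribution_function f s' \<le> ennreal t"
      unfolding rearrangement_def distribution_function_def Inf_less_iff by auto
    then have "s' \<le> s + 1 / real (Suc k)"
      by (simp add: ennreal_less_iff)
    from order_trans[OF distribution_function_antimono[OF measurable_f this] admissible]
    show ?thesis .
  qed
  then have "(SUP k. distribution_function f (s + 1 / real (Suc k))) \<le> ennreal t"
    by (rule SUP_least)
  then show "distribution_function f s \<le> ennreal t"
    by (simp only: distribution_function_right_continuous[OF measurable_f])
qed

lemma less_rearrangement_iff:
  assumes "f \<in> borel_measurable lebesgue" and "0 \<le> s"
  shows "ennreal s < rearrangement f t \<longleftrightarrow> ennreal t < distribution_function f s"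
  using rearrangement_le_iff[OF assms, of t] by (simp add: not_le[symmetric])

lemma rearrangement_antimono: "u \<le> t \<Longrightarrow> rearrangement f t \<le> rearrangement f u"
  unfolding rearrangement_def by (rule Inf_superset_mono) (blast intro: order_trans ennreal_leI)

lemma borel_measurable_rearrangement[measurable]: "rearrangement f \<in> borel_measurable borel"
proof (rule borel_measurableI_greater)
  fix y
  have "is_interval {t. y < rearrangement f t}"
    unfolding is_interval_1 by (auto intro: less_le_trans rearrangement_antimono)
  then show "{t \<in> space borel. y < rearrangement f t} \<in> sets borel"
    by (simp add: real_interval_borel_measurable)
qed

lemma rearrangement_le_if_AE_le:
  assumes measurable_f: "f \<in> borel_measurable lebesgue"
    and AE_le: "AE x in lebesgue. norm (f x) \<le> M" and "0 \<le> M"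
  shows "rearrangement f t \<le> ennreal M"
proof -
  have "distribution_function f M = emeasure lebesgue ({} :: 'a set)"
    unfolding distribution_function_def using AE_le
    by (intro emeasure_eq_AE sets_lebesgue_less_norm measurable_f) (auto elim!: eventually_mono)
  then show ?thesis
    by (simp add: rearrangement_le_iff[OF measurable_f \<open>0 \<le> M\<close>])
qed

lemma rearrangement_cong_AE:
  assumes "f \<in> borel_measurable lebesgue" and "g \<in> borel_measurable lebesgue"
    and AE_eq: "AE x in lebesgue. f x = g x"
  shows "rearrangement f = rearrangement g"
proof -
  have "emeasure lebesgue {x. s < norm (f x)} = emeasure lebesgue {x. s < norm (g x)}" for s
    using AE_eq
    by (intro emeasure_eq_AE sets_lebesgue_less_norm assms) (auto elim!: eventually_mono)
  then show ?thesis
    unfolding rearrangement_def by simp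
qed

lemma mult_rearrangement_le_nn_integral:
  assumes "0 \<le> a"
  shows "ennreal a * rearrangement f a \<le> (\<integral>\<^sup>+u\<in>{0<..<a}. rearrangement f u \<partial>lborel)"
proof -
  have "ennreal a * rearrangement f a = (\<integral>\<^sup>+u\<in>{0<..<a}. rearrangement f a \<partial>lborel)"
    using assms by (simp add: nn_integral_cmult_indicator mult.commute)
  also have "\<dots> \<le> (\<integral>\<^sup>+u\<in>{0<..<a}. rearrangement f u \<partial>lborel)"
    by (intro nn_integral_mono) (auto simp: indicator_def intro: rearrangement_antimono)
  finally show ?thesis .
qed

lemma emeasure_lborel_less_ennreal: "emeasure lborel {r. 0 < r \<and> ennreal r < y} = y"
proof (cases y)
  case (real c)
  then have "{r. 0 < r \<and> ennreal r < y} = {0<..<c}"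
    by (auto simp: ennreal_less_iff)
  then show ?thesis using real by simp
next
  case top
  have "emeasure lborel {0::real<..} = top"
  proof (rule ccontr)
    assume "emeasure lborel {0::real<..} \<noteq> top"
    then obtain c where "emeasure lborel {0::real<..} = ennreal c" "0 \<le> c"
      by (cases "emeasure lborel {0::real<..}") auto
    moreover have "emeasure lborel {0<..<c + 1} \<le> emeasure lborel {0::real<..}"
      by (intro emeasure_mono) auto
    ultimately show False by (simp add: ennreal_le_iff)
  qed
  moreover have "{r::real. 0 < r} = {0<..}" by auto
  ultimately show ?thesis using top by simp
qed

lemma (in sigma_finite_measure) nn_integral_layer_cake:
  assumes [measurable]: "g \<in> borel_measurable M"
  shows "(\<integral>\<^sup>+x. g x \<partial>M) = (\<integral>\<^sup>+r\<in>{0<..}. emeasure M {x \<in> space M. ennreal r < g x} \<partial>lborel)"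
proof -
  interpret pair_sigma_finite M lborel ..
  have "(\<integral>\<^sup>+x. g x \<partial>M) = (\<integral>\<^sup>+x. (\<integral>\<^sup>+r. indicator {r. 0 < r \<and> ennreal r < g x} r \<partial>lborel) \<partial>M)"
    by (simp add: emeasure_lborel_less_ennreal)
  also have "\<dots> = (\<integral>\<^sup>+r. (\<integral>\<^sup>+x. indicator {r. 0 < r \<and> ennreal r < g x} r \<partial>M) \<partial>lborel)"
    by (rule Fubini'[symmetric]) measurable
  also have "\<dots> = (\<integral>\<^sup>+r\<in>{0<..}. emeasure M {x \<in> space M. ennreal r < g x} \<partial>lborel)"
  proof (rule nn_integral_cong)
    fix r :: real
    have "(\<integral>\<^sup>+x. indicator {r. 0 < r \<and> ennreal r < g x} r \<partial>M)
        = (\<integral>\<^sup>+x. indicator {0<..} r * indicator {x \<in> space M. ennreal r < g x} x \<partial>M)"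
      by (intro nn_integral_cong) (auto simp: indicator_def)
    also have "\<dots> = emeasure M {x \<in> space M. ennreal r < g x} * indicator {0<..} r"
      by (subst nn_integral_cmult) (simp_all add: mult.commute)
    finally show "(\<integral>\<^sup>+x. indicator {r. 0 < r \<and> ennreal r < g x} r \<partial>M)
        = emeasure M {x \<in> space M. ennreal r < g x} * indicator {0<..} r" .
  qed
  finally show ?thesis .
qed

lemma nn_integral_le_rearrangement:
  fixes f :: "'a::euclidean_space \<Rightarrow> complex"
  assumes [measurable]: "f \<in> borel_measurable borel" "E \<in> sets borel"
    and measure_E: "emeasure lborel E \<le> ennreal a"
  shows "(\<integral>\<^sup>+x\<in>E. ennreal (norm (f x)) \<partial>lborel) \<le> (\<integral>\<^sup>+u\<in>{0<..<a}. rearrangement f u \<partial>lborel)"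
proof -
  have measurable_f: "f \<in> borel_measurable lebesgue"
    by (intro measurable_completion) simp
  have emeasure_level_le: "emeasure lborel {x. ennreal r < ennreal (norm (f x)) * indicator E x}
      \<le> emeasure lborel {u. ennreal r < rearrangement f u * indicator {0<..<a} u}"
    if "0 < r" for r
  proof -
    have "emeasure lborel {x. ennreal r < ennreal (norm (f x)) * indicator E x}
        \<le> min (emeasure lborel E) (emeasure lborel {x. r < norm (f x)})"
      using that by (intro min.boundedI emeasure_mono)
        (auto simp: indicator_def ennreal_less_iff split: if_splits)
    also have "\<dots> \<le> min (ennreal a) (distribution_function f r)"
      using measure_E by (intro min.mono) (simp_all add: distribution_function_def)
    also have "\<dots>
        = emeasure lborel {u. 0 < u \<and> ennreal u < min (ennreal a) (distribution_function f r)}"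
      by (rule emeasure_lborel_less_ennreal[symmetric])
    also have "\<dots> \<le> emeasure lborel {u. ennreal r < rearrangement f u * indicator {0<..<a} u}"
    proof (rule emeasure_mono)
      show "{u. 0 < u \<and> ennreal u < min (ennreal a) (distribution_function f r)}
          \<subseteq> {u. ennreal r < rearrangement f u * indicator {0<..<a} u}"
        using that
        by (auto simp: less_rearrangement_iff[OF measurable_f] ennreal_less_iff indicator_def)
    qed measurable
    finally show ?thesis .
  qed
  have "(\<integral>\<^sup>+x\<in>E. ennreal (norm (f x)) \<partial>lborel) = (\<integral>\<^sup>+r\<in>{0<..}.
      emeasure lborel {x. ennreal r < ennreal (norm (f x)) * indicator E x} \<partial>lborel)"
    by (subst lborel.nn_integral_layer_cake) simp_all
  also have "\<dots> \<le> (\<integral>\<^sup>+r\<in>{0<..}.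
      emeasure lborel {u. ennreal r < rearrangement f u * indicator {0<..<a} u} \<partial>lborel)"
    using emeasure_level_le by (intro nn_integral_mono) (simp split: split_indicator)
  also have "\<dots> = (\<integral>\<^sup>+u\<in>{0<..<a}. rearrangement f u \<partial>lborel)"
    by (subst lborel.nn_integral_layer_cake) simp_all
  finally show ?thesis .
qed

section \<open>Rearrangements of functions with bounded spectrum\<close>

lemma spectrum_cong_AE:
  assumes [measurable]: "f \<in> borel_measurable lebesgue" "g \<in> borel_measurable lebesgue"
    and AE_eq: "AE x in lebesgue. f x = g x"
  shows "spectrum f = spectrum g"
proof -
  have "fourier_distr (distr_of f) \<phi> = fourier_distr (distr_of g) \<phi>" if "smooth \<phi>" for \<phi>
  proof -
    have "fourier \<phi> \<in> borel_measurable lborel"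
      using borel_measurable_fourier[OF smooth_borel_measurable[OF that]] by simp
    then have [measurable]: "fourier \<phi> \<in> borel_measurable lebesgue"
      by (rule measurable_completion)
    show ?thesis
      unfolding fourier_distr_def distr_of_def
      by (rule integral_cong_AE) (use AE_eq in \<open>auto elim!: eventually_mono\<close>)
  qed
  then have "(\<forall>\<phi>\<in>test_functions U. fourier_distr (distr_of f) \<phi> = 0)
      \<longleftrightarrow> (\<forall>\<phi>\<in>test_functions U. fourier_distr (distr_of g) \<phi> = 0)" for U
    by (auto simp: test_functions_def)
  then show ?thesis unfolding spectrum_def distr_support_def by simp
qed

lemma borel_measurable_lebesgueE:
  fixes f :: "'a::euclidean_space \<Rightarrow> complex"
  assumes [measurable]: "f \<in> borel_measurable lebesgue"
  obtains g where "g \<in> borel_measurable borel" "AE x in lebesgue. f x = g x"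
proof -
  have "(\<lambda>x. Re (f x)) \<in> borel_measurable lebesgue" "(\<lambda>x. Im (f x)) \<in> borel_measurable lebesgue"
    by measurable
  from this[THEN completion_ex_borel_measurable_real] obtain u v where
    [measurable]: "u \<in> borel_measurable borel" "v \<in> borel_measurable borel" and
    AE_eq: "AE x in lborel. Re (f x) = u x" "AE x in lborel. Im (f x) = v x"
    by auto
  have "AE x in lborel. f x = Complex (u x) (v x)"
    using AE_eq by eventually_elim (simp add: complex_eq_iff)
  then have "AE x in lebesgue. f x = Complex (u x) (v x)"
    by (simp add: AE_completion_iff)
  moreover have "(\<lambda>x. Complex (u x) (v x)) \<in> borel_measurable borel"
    by (simp add: borel_measurable_complex_iff)
  ultimately show ?thesis using that by blast
qed

lemma
  fixes f :: "'a::euclidean_space \<Rightarrow> complex"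
  assumes [measurable]: "f \<in> borel_measurable borel" and "0 \<le> s" "0 \<le> I"
    and "(\<integral>\<^sup>+x\<in>{x. s < norm (f x)}. ennreal (norm (f x)) \<partial>lborel) \<le> ennreal I"
  shows L1_plus_bounded_if_nn_integral_le: "L1_plus_bounded f s"
    and integral_large_part_le: "(\<integral>x. large_part s f x \<partial>lborel) \<le> I"
proof -
  have "(\<integral>\<^sup>+x. ennreal (large_part s f x) \<partial>lborel)
      = (\<integral>\<^sup>+x\<in>{x. s < norm (f x)}. ennreal (norm (f x)) \<partial>lborel)"
    by (intro nn_integral_cong) (auto simp: large_part_def)
  then have nn_integral_le: "(\<integral>\<^sup>+x. ennreal (large_part s f x) \<partial>lborel) \<le> ennreal I"
    using assms(4) by simp
  have integrable: "integrable lborel (large_part s f)"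
    by (rule integrableI_bounded)
       (use nn_integral_le in \<open>auto simp: large_part_nonneg intro: le_less_trans\<close>)
  then show "L1_plus_bounded f s"
    using \<open>0 \<le> s\<close> by unfold_locales auto
  have "ennreal (\<integral>x. large_part s f x \<partial>lborel) \<le> ennreal I"
    using nn_integral_le nn_integral_eq_integral[OF integrable] by (simp add: large_part_nonneg)
  then show "(\<integral>x. large_part s f x \<partial>lborel) \<le> I"
    using \<open>0 \<le> I\<close> by (simp add: ennreal_le_iff)
qed

text \<open>The height at which \<open>f\<close> is split is chosen such that the part above it lives on a set of
  measure at most \<open>R\<^sup>-\<^sup>n\<close>.\<close>

lemma L1_plus_bounded_at_rearrangement_average:
  fixes f :: "'a::euclidean_space \<Rightarrow> complex"
  assumes borel_f: "f \<in> borel_measurable borel" and "R > 0" "0 \<le> I"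
    and integral: "(\<integral>\<^sup>+u\<in>{0<..<1 / R ^ DIM('a)}. rearrangement f u \<partial>lborel) = ennreal I"
  shows "L1_plus_bounded f (R ^ DIM('a) * I)"
    and "(\<integral>x. large_part (R ^ DIM('a) * I) f x \<partial>lborel) \<le> I"
proof -
  note [measurable] = borel_f
  have lebesgue_f: "f \<in> borel_measurable lebesgue"
    by (intro measurable_completion) simp
  define a where "a = 1 / R ^ DIM('a)"
  have "a > 0" using \<open>R > 0\<close> by (simp add: a_def)
  define s where "s = R ^ DIM('a) * I"
  have "s \<ge> 0" using \<open>R > 0\<close> \<open>0 \<le> I\<close> by (simp add: s_def)
  have "ennreal (1 / a) * (ennreal a * rearrangement f a) \<le> ennreal (1 / a) * ennreal I"
    using mult_rearrangement_le_nn_integral[of a f] \<open>a > 0\<close> integral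
    by (intro mult_left_mono) (simp_all add: a_def)
  then have "rearrangement f a \<le> ennreal s"
    using \<open>a > 0\<close> \<open>0 \<le> I\<close>
    by (simp add: mult.assoc[symmetric] ennreal_mult[symmetric])
      (simp add: a_def s_def mult.commute)
  then have "emeasure lborel {x. s < norm (f x)} \<le> ennreal a"
    using rearrangement_le_iff[OF lebesgue_f \<open>s \<ge> 0\<close>, of a] by (simp add: distribution_function_def)
  then have "(\<integral>\<^sup>+x\<in>{x. s < norm (f x)}. ennreal (norm (f x)) \<partial>lborel) \<le> ennreal I"
    using nn_integral_le_rearrangement[of f "{x. s < norm (f x)}" a] integral by (simp add: a_def)
  then show "L1_plus_bounded f (R ^ DIM('a) * I)"
      "(\<integral>x. large_part (R ^ DIM('a) * I) f x \<partial>lborel) \<le> I"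
    using L1_plus_bounded_if_nn_integral_le[OF borel_f \<open>s \<ge> 0\<close> \<open>0 \<le> I\<close>]
      integral_large_part_le[OF borel_f \<open>s \<ge> 0\<close> \<open>0 \<le> I\<close>] by (simp_all add: s_def)
qed

lemma bandlimited_rearrangement_le_borel:
  obtains C :: real where "C > 0"
    "\<And>R t (f :: 'a::euclidean_space \<Rightarrow> complex).
       R > 0 \<Longrightarrow> f \<in> borel_measurable borel \<Longrightarrow> spectrum f \<subseteq> cball 0 R \<Longrightarrow>
       rearrangement f t
         \<le> ennreal (C * R ^ DIM('a)) * (\<integral>\<^sup>+u\<in>{0<..<1 / R ^ DIM('a)}. rearrangement f u \<partial>lborel)"
proof -
  obtain C where "C > 0" and AE_bound: "\<And>R s (f :: 'a \<Rightarrow> complex). R > 0 \<Longrightarrow>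
      L1_plus_bounded f s \<Longrightarrow> spectrum f \<subseteq> cball 0 R \<Longrightarrow>
      AE x in lborel. norm (f x) \<le> C * (R ^ DIM('a) * (\<integral>x. large_part s f x \<partial>lborel) + s)"
    by (rule bandlimited_AE_bound) blast
  have "rearrangement f t \<le> ennreal (2 * C * R ^ DIM('a))
      * (\<integral>\<^sup>+u\<in>{0<..<1 / R ^ DIM('a)}. rearrangement f u \<partial>lborel)"
    if "R > 0" and borel_f: "f \<in> borel_measurable borel" and spectrum: "spectrum f \<subseteq> cball 0 R"
    for R t and f :: "'a \<Rightarrow> complex"
  proof (cases "\<integral>\<^sup>+u\<in>{0<..<1 / R ^ DIM('a)}. rearrangement f u \<partial>lborel")
    case top
    then show ?thesis using \<open>C > 0\<close> \<open>R > 0\<close> by (simp add: ennreal_mult_top)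
  next
    case (real I)
    note [measurable] = borel_f
    have lebesgue_f: "f \<in> borel_measurable lebesgue"
      by (intro measurable_completion) simp
    define s where "s = R ^ DIM('a) * I"
    have large_part: "L1_plus_bounded f s" "(\<integral>x. large_part s f x \<partial>lborel) \<le> I"
      unfolding s_def
      by (rule L1_plus_bounded_at_rearrangement_average[OF borel_f \<open>R > 0\<close> real])+
    have "AE x in lborel. norm (f x) \<le> 2 * C * R ^ DIM('a) * I"
      using AE_bound[OF \<open>R > 0\<close> large_part(1) spectrum]
    proof eventually_elim
      case (elim x)
      also have "C * (R ^ DIM('a) * (\<integral>x. large_part s f x \<partial>lborel) + s) \<le> C * (R ^ DIM('a) * I + s)"
        using \<open>C > 0\<close> \<open>R > 0\<close> large_part(2) by (intro mult_left_mono add_right_mono) auto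
      also have "\<dots> = 2 * C * R ^ DIM('a) * I" by (simp add: s_def)
      finally show ?case .
    qed
    then have "rearrangement f t \<le> ennreal (2 * C * R ^ DIM('a) * I)"
      by (intro rearrangement_le_if_AE_le[OF lebesgue_f])
         (use \<open>C > 0\<close> \<open>R > 0\<close> real in \<open>auto simp: AE_completion_iff\<close>)
    then show ?thesis
      using \<open>C > 0\<close> \<open>R > 0\<close> real by (simp add: ennreal_mult)
  qed
  then show ?thesis
    using \<open>C > 0\<close> that[of "2 * C"] by simp
qed

lemma bandlimited_rearrangement_le:
  obtains C :: real where "C > 0"
    "\<And>R t (f :: 'a::euclidean_space \<Rightarrow> complex).
       R > 0 \<Longrightarrow> f \<in> borel_measurable lebesgue \<Longrightarrow> spectrum f \<subseteq> cball 0 R \<Longrightarrow>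
       rearrangement f t
         \<le> ennreal (C * R ^ DIM('a)) * (\<integral>\<^sup>+u\<in>{0<..<1 / R ^ DIM('a)}. rearrangement f u \<partial>lborel)"
proof -
  obtain C where "C > 0" and borel_bound: "\<And>R t (f :: 'a \<Rightarrow> complex).
      R > 0 \<Longrightarrow> f \<in> borel_measurable borel \<Longrightarrow> spectrum f \<subseteq> cball 0 R \<Longrightarrow>
      rearrangement f t
        \<le> ennreal (C * R ^ DIM('a)) * (\<integral>\<^sup>+u\<in>{0<..<1 / R ^ DIM('a)}. rearrangement f u \<partial>lborel)"
    by (rule bandlimited_rearrangement_le_borel) blast
  have "rearrangement f t
      \<le> ennreal (C * R ^ DIM('a)) * (\<integral>\<^sup>+u\<in>{0<..<1 / R ^ DIM('a)}. rearrangement f u \<partial>lborel)"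
    if "R > 0" and lebesgue_f: "f \<in> borel_measurable lebesgue" and "spectrum f \<subseteq> cball 0 R"
    for R t and f :: "'a \<Rightarrow> complex"
  proof -
    obtain g where borel_g: "g \<in> borel_measurable borel" and AE_eq: "AE x in lebesgue. f x = g x"
      using borel_measurable_lebesgueE[OF lebesgue_f] by blast
    have lebesgue_g: "g \<in> borel_measurable lebesgue"
      using borel_g by (intro measurable_completion) simp
    show ?thesis
      using borel_bound[OF \<open>R > 0\<close> borel_g, of t] \<open>spectrum f \<subseteq> cball 0 R\<close>
      by (simp add: rearrangement_cong_AE[OF lebesgue_f lebesgue_g AE_eq]
          spectrum_cong_AE[OF lebesgue_f lebesgue_g AE_eq])
  qed
  with \<open>C > 0\<close> show ?thesis by (rule that)
qed

section \<open>Logarithmic weights\<close>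

lemma broken_log_pos: "0 < broken_log A t"
proof -
  have "1 + \<bar>ln t\<bar> \<noteq> 0" by linarith
  then show ?thesis
    by (cases "t \<le> 1") (simp_all only: broken_log_def powr_gt_zero if_True if_False simp_thms)
qed

lemma broken_log_eq_prod:
  assumes "t > 0"
  shows "broken_log A t = (1 + max 0 (- ln t)) powr fst A * (1 + max 0 (ln t)) powr snd A"
  using assms by (simp add: broken_log_def max_def abs_if)

lemma broken_log_inverse:
  assumes "t > 0"
  shows "broken_log A (1 / t) = broken_log (prod.swap A) t"
  using assms by (simp add: broken_log_eq_prod ln_div)

lemma powr_le_mult_powr:
  fixes x y w :: real
  assumes "1 \<le> x" "1 \<le> y" "1 \<le> w" and "x \<le> w * y" "y \<le> w * x"
  shows "x powr a \<le> w powr \<bar>a\<bar> * y powr a"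
proof (cases "a \<ge> 0")
  case True
  then have "x powr a \<le> (w * y) powr a"
    using assms by (intro powr_mono2) auto
  with True assms show ?thesis by (simp add: powr_mult)
next
  case False
  then have "y powr (- a) \<le> (w * x) powr (- a)"
    using assms by (intro powr_mono2) auto
  then have "y powr (- a) \<le> w powr (- a) * x powr (- a)"
    using assms by (simp add: powr_mult)
  with False assms show ?thesis
    by (simp add: powr_minus field_simps)
qed

lemma broken_log_le_if_comparable:
  assumes "s > 0" "t > 0" "w \<ge> 1"
    and "1 + max 0 (ln s) \<le> w * (1 + max 0 (ln t))" "1 + max 0 (ln t) \<le> w * (1 + max 0 (ln s))"
    and "1 + max 0 (- ln s) \<le> w * (1 + max 0 (- ln t))"
    and "1 + max 0 (- ln t) \<le> w * (1 + max 0 (- ln s))"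
  shows "broken_log A s \<le> w powr (\<bar>fst A\<bar> + \<bar>snd A\<bar>) * broken_log A t"
proof -
  have "(1 + max 0 (- ln s)) powr fst A \<le> w powr \<bar>fst A\<bar> * (1 + max 0 (- ln t)) powr fst A"
    "(1 + max 0 (ln s)) powr snd A \<le> w powr \<bar>snd A\<bar> * (1 + max 0 (ln t)) powr snd A"
    using assms by (intro powr_le_mult_powr; simp)+
  then have "broken_log A s \<le> (w powr \<bar>fst A\<bar> * (1 + max 0 (- ln t)) powr fst A)
      * (w powr \<bar>snd A\<bar> * (1 + max 0 (ln t)) powr snd A)"
    unfolding broken_log_eq_prod[OF assms(1)] by (intro mult_mono) auto
  then show ?thesis
    unfolding broken_log_eq_prod[OF assms(2)] by (simp add: powr_add mult_ac)
qed

lemma broken_log_le_ratio: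
  assumes "s > 0" and "t > 0"
  shows "broken_log A s \<le> (1 + \<bar>ln (s / t)\<bar>) powr (\<bar>fst A\<bar> + \<bar>snd A\<bar>) * broken_log A t"
proof -
  have comparable: "1 + max 0 x \<le> (1 + \<bar>ln (s / t)\<bar>) * (1 + max 0 y)"
    if "\<bar>x - y\<bar> = \<bar>ln (s / t)\<bar>" for x y
  proof -
    have "1 + max 0 x \<le> 1 + \<bar>ln (s / t)\<bar> + max 0 y" using that by linarith
    also have "\<dots> \<le> (1 + \<bar>ln (s / t)\<bar>) * (1 + max 0 y)" by (simp add: algebra_simps)
    finally show ?thesis .
  qed
  show ?thesis
    using assms by (intro broken_log_le_if_comparable comparable) (auto simp: ln_div)
qed

lemma broken_log_power_le:
  assumes "t > 0" and "n \<ge> 1"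
  shows "broken_log A (t ^ n) \<le> real n powr (\<bar>fst A\<bar> + \<bar>snd A\<bar>) * broken_log A t"
proof -
  have max_mult: "max 0 (real n * x) = real n * max 0 x" for x
    by (simp add: max_mult_distrib_left)
  have comparable: "1 + real n * max 0 x \<le> real n * (1 + max 0 x)"
    "1 + max 0 x \<le> real n * (1 + real n * max 0 x)" for x
  proof -
    have n_ge_1: "1 \<le> real n" using assms(2) by simp
    then show "1 + real n * max 0 x \<le> real n * (1 + max 0 x)" by (simp add: algebra_simps)
    have "max 0 x \<le> real n * max 0 x"
      using mult_right_mono[OF n_ge_1, of "max 0 x"] by simp
    also have "\<dots> \<le> real n * (real n * max 0 x)"
      using mult_right_mono[OF n_ge_1, of "real n * max 0 x"] by simp
    finally show "1 + max 0 x \<le> real n * (1 + real n * max 0 x)"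
      using n_ge_1 by (simp add: distrib_left)
  qed
  have "ln (t ^ n) = real n * ln t" "- ln (t ^ n) = real n * (- ln t)"
    using assms by (simp_all add: ln_realpow)
  then show ?thesis
    using assms comparable
    by (intro broken_log_le_if_comparable) (simp_all only: max_mult, auto)
qed

lemma one_plus_powr_le_exp:
  fixes M \<delta> :: real
  assumes "M \<ge> 0" "\<delta> > 0"
  obtains K where "K > 0" "\<And>y. y \<ge> 0 \<Longrightarrow> (1 + y) powr M \<le> K * exp (\<delta> * y)"
proof -
  define c where "c = min 1 (\<delta> / (M + 1))"
  have c_bounds: "0 < c" "c \<le> 1" using assms by (auto simp: c_def)
  have "c * M \<le> \<delta> / (M + 1) * M" using assms by (intro mult_right_mono) (auto simp: c_def)
  also have "\<dots> \<le> \<delta>" using assms by (simp add: field_simps)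
  finally have cM_le: "c * M \<le> \<delta>" .
  have "(1 + y) powr M \<le> (1 / c) powr M * exp (\<delta> * y)" if "y \<ge> 0" for y
  proof -
    have "c * (1 + y) \<le> 1 + c * y" using c_bounds by (simp add: distrib_left)
    also have "\<dots> \<le> exp (c * y)" by (rule exp_ge_add_one_self)
    finally have "(1 + y) powr M \<le> (1 / c * exp (c * y)) powr M"
      using \<open>y \<ge> 0\<close> c_bounds assms by (intro powr_mono2) (auto simp: field_simps)
    also have "\<dots> = (1 / c) powr M * exp (c * M * y)"
      using c_bounds by (subst powr_mult) (simp_all add: exp_powr_real mult_ac)
    also have "\<dots> \<le> (1 / c) powr M * exp (\<delta> * y)"
      using \<open>y \<ge> 0\<close> cM_le by (intro mult_left_mono) (auto intro: mult_right_mono)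
    finally show ?thesis .
  qed
  then show ?thesis using c_bounds by (intro that[of "(1 / c) powr M"]) auto
qed

definition log_power :: "real \<Rightarrow> real \<times> real \<Rightarrow> real \<Rightarrow> real" where
  "log_power e A t = t powr e * broken_log A t"

lemma log_power_pos: "t > 0 \<Longrightarrow> 0 < log_power e A t"
  by (simp add: log_power_def broken_log_pos)

lemma log_power_nonneg: "0 \<le> log_power e A t"
  by (simp add: log_power_def less_imp_le[OF broken_log_pos])

lemma log_power_0:
  assumes "t > 0"
  shows "log_power 0 (0, 0) t = 1"
proof -
  have "1 + \<bar>ln t\<bar> \<noteq> 0" by linarith
  then have "broken_log (0, 0) t = 1"
    by (simp only: broken_log_def fst_conv snd_conv powr_zero_eq_one simp_thms if_cancel if_False)
  with assms show ?thesis by (simp add: log_power_def)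
qed

lemma log_power_mult: "log_power e A t * log_power d B t = log_power (e + d) (A + B) t"
  by (simp add: log_power_def broken_log_def powr_add)

lemma powr_mult_log_power: "t powr d * log_power e A t = log_power (d + e) A t"
  by (simp add: log_power_def powr_add)

lemma log_power_uminus: "log_power (- e) (- A) t = 1 / log_power e A t"
  by (simp add: log_power_def broken_log_def powr_minus divide_inverse)

lemma borel_measurable_log_power[measurable]: "log_power e A \<in> borel_measurable borel"
  unfolding log_power_def broken_log_def by measurable

lemma log_power_le:
  fixes \<delta> :: real
  assumes "\<delta> > 0"
  obtains K where "K > 0" "\<And>s t. s > 0 \<Longrightarrow> t > 0 \<Longrightarrow>
    log_power e A s \<le> K * log_power e A t * exp (e * ln (s / t) + \<delta> * \<bar>ln (s / t)\<bar>)"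
proof -
  obtain K where "K > 0" and powr_le:
    "\<And>y. y \<ge> 0 \<Longrightarrow> (1 + y) powr (\<bar>fst A\<bar> + \<bar>snd A\<bar>) \<le> K * exp (\<delta> * y)"
    using one_plus_powr_le_exp[of "\<bar>fst A\<bar> + \<bar>snd A\<bar>" \<delta>] assms by auto
  have "log_power e A s \<le> K * log_power e A t * exp (e * ln (s / t) + \<delta> * \<bar>ln (s / t)\<bar>)"
    if "s > 0" "t > 0" for s t
  proof -
    have "broken_log A s \<le> (1 + \<bar>ln (s / t)\<bar>) powr (\<bar>fst A\<bar> + \<bar>snd A\<bar>) * broken_log A t"
      by (rule broken_log_le_ratio[OF that])
    also have "\<dots> \<le> K * exp (\<delta> * \<bar>ln (s / t)\<bar>) * broken_log A t"
      by (intro mult_right_mono powr_le less_imp_le[OF broken_log_pos]) simp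
    finally have "s powr e * broken_log A s
        \<le> s powr e * (K * exp (\<delta> * \<bar>ln (s / t)\<bar>) * broken_log A t)"
      by (rule mult_left_mono) simp
    moreover have "s powr e = t powr e * exp (e * ln (s / t))"
      using that by (simp add: powr_def ln_div algebra_simps flip: exp_add)
    ultimately show ?thesis
      by (simp add: log_power_def exp_add mult_ac)
  qed
  with \<open>K > 0\<close> show ?thesis by (rule that)
qed

lemma log_power_decay:
  assumes "0 < \<sigma>" and "\<sigma> < \<bar>e\<bar>"
  obtains K where "K > 0" "\<And>s t. s > 0 \<Longrightarrow> t > 0 \<Longrightarrow> e * ln (s / t) \<le> 0 \<Longrightarrow>
    log_power e A s \<le> K * log_power e A t * exp (- \<sigma> * \<bar>ln (s / t)\<bar>)"
proof -
  obtain K where "K > 0" and "\<And>s t. s > 0 \<Longrightarrow> t > 0 \<Longrightarrow>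
      log_power e A s \<le> K * log_power e A t * exp (e * ln (s / t) + (\<bar>e\<bar> - \<sigma>) * \<bar>ln (s / t)\<bar>)"
    using log_power_le[of "\<bar>e\<bar> - \<sigma>" e A] assms by auto
  moreover have "e * ln (s / t) + (\<bar>e\<bar> - \<sigma>) * \<bar>ln (s / t)\<bar> = - \<sigma> * \<bar>ln (s / t)\<bar>"
    if "e * ln (s / t) \<le> 0" for s t
    using that abs_mult[of e "ln (s / t)"] by (simp add: abs_of_nonpos left_diff_distrib)
  ultimately show ?thesis using that by metis
qed

lemma log_power_le_on_dyadic_interval:
  obtains K where "K > 0"
    "\<And>s t. t > 0 \<Longrightarrow> s \<in> {t / 2..t} \<Longrightarrow> log_power e A t \<le> K * log_power e A s"
proof -
  obtain K where "K > 0" and growth: "\<And>s t. s > 0 \<Longrightarrow> t > 0 \<Longrightarrow>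
      log_power e A s \<le> K * log_power e A t * exp (e * ln (s / t) + 1 * \<bar>ln (s / t)\<bar>)"
    using log_power_le[of 1 e A] by auto
  have "log_power e A t \<le> (K * exp ((\<bar>e\<bar> + 1) * ln 2)) * log_power e A s"
    if "t > 0" and s: "s \<in> {t / 2..t}" for s t
  proof -
    have "s > 0" using s \<open>t > 0\<close> by auto
    then have "1 \<le> t / s" "t / s \<le> 2" using s by (auto simp: field_simps)
    then have ln_bounds: "0 \<le> ln (t / s)" "ln (t / s) \<le> ln 2" by auto
    have "e * ln (t / s) + 1 * \<bar>ln (t / s)\<bar> \<le> (\<bar>e\<bar> + 1) * ln (t / s)"
      using ln_bounds mult_right_mono[of e "\<bar>e\<bar>" "ln (t / s)"] by (simp add: distrib_right)
    also have "\<dots> \<le> (\<bar>e\<bar> + 1) * ln 2"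
      using ln_bounds by (intro mult_left_mono) auto
    finally have "K * log_power e A s * exp (e * ln (t / s) + 1 * \<bar>ln (t / s)\<bar>)
        \<le> K * log_power e A s * exp ((\<bar>e\<bar> + 1) * ln 2)"
      using \<open>K > 0\<close> log_power_nonneg[of e A s] by (intro mult_left_mono) auto
    with growth[OF \<open>t > 0\<close> \<open>s > 0\<close>] show ?thesis by (simp add: mult_ac)
  qed
  then show ?thesis using \<open>K > 0\<close> by (intro that[of "K * exp ((\<bar>e\<bar> + 1) * ln 2)"]) auto
qed

lemma log_power_mult_max_le:
  assumes "0 < e" and "e < d"
  obtains \<sigma> K where "\<sigma> > 0" "K > 0" "\<And>t a. t > 0 \<Longrightarrow> a > 0 \<Longrightarrow>
    log_power e A t * log_power (- d) (- B) (max t a)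
      \<le> K * log_power (e - d) (A - B) a * exp (- \<sigma> * \<bar>ln (t / a)\<bar>)"
proof -
  define \<sigma> where "\<sigma> = min e (d - e) / 2"
  have \<sigma>: "\<sigma> > 0" "\<sigma> < \<bar>e\<bar>" "\<sigma> < \<bar>e - d\<bar>" using assms by (auto simp: \<sigma>_def)
  obtain K\<^sub>1 where "K\<^sub>1 > 0" and below: "\<And>t a. t > 0 \<Longrightarrow> a > 0 \<Longrightarrow> e * ln (t / a) \<le> 0 \<Longrightarrow>
      log_power e A t \<le> K\<^sub>1 * log_power e A a * exp (- \<sigma> * \<bar>ln (t / a)\<bar>)"
    using log_power_decay[OF \<sigma>(1,2)] by blast
  obtain K\<^sub>2 where "K\<^sub>2 > 0" and above: "\<And>t a. t > 0 \<Longrightarrow> a > 0 \<Longrightarrow> (e - d) * ln (t / a) \<le> 0 \<Longrightarrow>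
      log_power (e - d) (A - B) t \<le> K\<^sub>2 * log_power (e - d) (A - B) a * exp (- \<sigma> * \<bar>ln (t / a)\<bar>)"
    using log_power_decay[OF \<sigma>(1,3)] by blast
  have product: "log_power e A s * log_power (- d) (- B) s = log_power (e - d) (A - B) s" for s
    using log_power_mult[of e A s "- d" "- B"] by simp
  have "log_power e A t * log_power (- d) (- B) (max t a)
      \<le> max K\<^sub>1 K\<^sub>2 * (log_power (e - d) (A - B) a * exp (- \<sigma> * \<bar>ln (t / a)\<bar>))"
    if "t > 0" "a > 0" for t a
  proof (cases "t \<le> a")
    case True
    then have "log_power e A t \<le> K\<^sub>1 * log_power e A a * exp (- \<sigma> * \<bar>ln (t / a)\<bar>)"
      using assms that by (intro below) (auto simp: mult_nonneg_nonpos)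
    then have "log_power e A t * log_power (- d) (- B) a
        \<le> K\<^sub>1 * log_power e A a * exp (- \<sigma> * \<bar>ln (t / a)\<bar>) * log_power (- d) (- B) a"
      by (rule mult_right_mono[OF _ log_power_nonneg])
    also have "\<dots> = K\<^sub>1 * (log_power (e - d) (A - B) a * exp (- \<sigma> * \<bar>ln (t / a)\<bar>))"
      by (simp only: product[symmetric] mult_ac)
    also have "\<dots> \<le> max K\<^sub>1 K\<^sub>2 * (log_power (e - d) (A - B) a * exp (- \<sigma> * \<bar>ln (t / a)\<bar>))"
      by (intro mult_right_mono mult_nonneg_nonneg log_power_nonneg) auto
    finally show ?thesis
      using True by (simp only: max.absorb2)
  next
    case False
    then have "log_power (e - d) (A - B) t
        \<le> K\<^sub>2 * log_power (e - d) (A - B) a * exp (- \<sigma> * \<bar>ln (t / a)\<bar>)"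
      using assms that by (intro above) (auto simp: mult_nonpos_nonneg)
    also have "\<dots> \<le> max K\<^sub>1 K\<^sub>2 * (log_power (e - d) (A - B) a * exp (- \<sigma> * \<bar>ln (t / a)\<bar>))"
      unfolding mult.assoc by (intro mult_right_mono mult_nonneg_nonneg log_power_nonneg) auto
    finally show ?thesis
      using False by (simp only: product max.absorb1 not_le less_imp_le)
  qed
  then show ?thesis
    using \<sigma>(1) \<open>K\<^sub>1 > 0\<close> by (intro that[of \<sigma> "max K\<^sub>1 K\<^sub>2"]) (auto simp: mult.assoc)
qed

lemma log_power_inverse_power_le:
  assumes "R > 0" and "n \<ge> 1"
  shows "log_power e A (1 / R ^ n)
    \<le> real n powr (\<bar>fst A\<bar> + \<bar>snd A\<bar>) * (R powr (- (real n * e)) * broken_log (prod.swap A) R)"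
proof -
  have "broken_log A (1 / R ^ n) \<le> real n powr (\<bar>fst A\<bar> + \<bar>snd A\<bar>) * broken_log (prod.swap A) R"
    using broken_log_power_le[OF assms, of "prod.swap A"] assms(1)
    by (simp add: broken_log_inverse add.commute)
  then have "(1 / R ^ n) powr e * broken_log A (1 / R ^ n)
      \<le> (1 / R ^ n) powr e * (real n powr (\<bar>fst A\<bar> + \<bar>snd A\<bar>) * broken_log (prod.swap A) R)"
    by (rule mult_left_mono) simp
  moreover have "(1 / R ^ n) powr e = R powr (- (real n * e))"
    using assms(1) by (simp add: powr_def ln_div ln_realpow mult_ac)
  ultimately show ?thesis by (simp add: log_power_def mult_ac)
qed

section \<open>The weighted norms\<close>

lemma recip_ennreal: "x > 0 \<Longrightarrow> recip (ennreal x) = 1 / x"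
  unfolding recip_def by (simp add: divide_ennreal[of 1 x, simplified])

lemma recip_top: "recip top = 0"
  by (simp add: recip_def)

lemma recip_1: "recip 1 = 1"
  using recip_ennreal[of 1] by simp

lemma recip_pos: "0 < p \<Longrightarrow> p < \<infinity> \<Longrightarrow> 0 < recip p"
  by (cases p) (auto simp: recip_ennreal)

lemma recip_strict_antimono:
  assumes "0 < q" and "q < p"
  shows "recip p < recip q"
proof (cases p)
  case (real p')
  with assms obtain q' where "q = ennreal q'" "0 < q'" "q' < p'"
    by (cases q) (auto simp: ennreal_less_iff)
  with real show ?thesis by (simp add: recip_ennreal frac_less2)
next
  case top
  with assms show ?thesis using recip_pos[of q] by (simp add: recip_top)
qed

lemma borel_measurable_epowr[measurable]: "(\<lambda>x. epowr x a) \<in> borel_measurable borel"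
  unfolding epowr_def by measurable

lemma epowr_mono:
  assumes "x \<le> y" "a > 0"
  shows "epowr x a \<le> epowr y a"
proof (cases y)
  case (real r)
  then obtain r' where "x = ennreal r'" "0 \<le> r'" "r' \<le> r"
    using assms(1) by (cases x) (auto simp: top_unique)
  with real assms show ?thesis by (auto simp: epowr_def intro!: ennreal_leI powr_mono2)
qed (simp add: epowr_def)

lemma epowr_mult:
  assumes "y > 0" "a > 0"
  shows "epowr (ennreal y * x) a = ennreal (y powr a) * epowr x a"
proof (cases x)
  case (real r)
  then show ?thesis
    using assms by (simp add: epowr_def ennreal_mult[symmetric] powr_mult ennreal_mult_eq_top_iff)
next
  case top
  then show ?thesis using assms by (simp add: epowr_def ennreal_mult_top)
qed

lemma epowr_epowr_inverse:
  assumes "a > 0"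
  shows "epowr (epowr x a) (1 / a) = x"
  using assms by (cases x) (simp_all add: epowr_def powr_powr)

lemma AE_lebesgue_on_Ioi_iff:
  "(AE t in lebesgue_on {0<..}. P t) \<longleftrightarrow> (AE t in lborel. 0 < t \<longrightarrow> P (t::real))"
proof -
  have "(AE t in lebesgue_on {0<..}. P t) \<longleftrightarrow> (AE t in lebesgue. t \<in> {0<..} \<longrightarrow> P t)"
    by (rule AE_restrict_space_iff) auto
  then show ?thesis by (simp add: AE_completion_iff)
qed

lemma borel_measurable_lebesgue_on_Ioi:
  "g \<in> borel_measurable borel \<Longrightarrow> g \<in> borel_measurable (lebesgue_on {0::real<..})"
  by (intro measurable_restrict_space1 measurable_completion) simp

lemma Lb_norm_ennreal:
  assumes [measurable]: "g \<in> borel_measurable borel" and "\<beta> > 0"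
  shows "Lb_norm (ennreal \<beta>) g = epowr (\<integral>\<^sup>+t\<in>{0<..}. epowr (g t) \<beta> \<partial>lborel) (1 / \<beta>)"
proof -
  have "(\<integral>\<^sup>+t. epowr (g t) \<beta> \<partial>lebesgue_on {0<..}) = (\<integral>\<^sup>+t\<in>{0<..}. epowr (g t) \<beta> \<partial>lebesgue)"
    by (rule nn_integral_restrict_space) auto
  also have "\<dots> = (\<integral>\<^sup>+t\<in>{0<..}. epowr (g t) \<beta> \<partial>lborel)"
    by (rule nn_integral_completion)
  finally show ?thesis
    using assms(2) by (simp add: Lb_norm_def recip_ennreal)
qed

lemma Lb_norm_top_le:
  assumes "g \<in> borel_measurable borel" and "\<And>t. t > 0 \<Longrightarrow> g t \<le> m"
  shows "Lb_norm \<infinity> g \<le> m"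
  using esssup_I[OF borel_measurable_lebesgue_on_Ioi[OF assms(1)], of m] assms(2)
  by (simp add: Lb_norm_def AE_lebesgue_on_Ioi_iff)

lemma Lb_norm_mono:
  assumes [measurable]: "g \<in> borel_measurable borel" "h \<in> borel_measurable borel"
    and "0 < b" and pointwise: "\<And>t. t > 0 \<Longrightarrow> g t \<le> h t"
  shows "Lb_norm b g \<le> Lb_norm b h"
proof (cases b)
  case (real \<beta>)
  with \<open>0 < b\<close> have "\<beta> > 0" by auto
  then have "(\<integral>\<^sup>+t\<in>{0<..}. epowr (g t) \<beta> \<partial>lborel) \<le> (\<integral>\<^sup>+t\<in>{0<..}. epowr (h t) \<beta> \<partial>lborel)"
    by (intro nn_integral_mono) (auto simp: indicator_def intro: epowr_mono pointwise)
  then show ?thesis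
    using \<open>\<beta> > 0\<close> real by (simp add: Lb_norm_ennreal epowr_mono)
next
  case top
  have "g \<in> borel_measurable (lebesgue_on {0<..})"
    by (rule borel_measurable_lebesgue_on_Ioi) simp
  then have "esssup (lebesgue_on {0<..}) g \<le> esssup (lebesgue_on {0<..}) h"
    by (rule esssup_AE_mono) (simp add: AE_lebesgue_on_Ioi_iff pointwise)
  with top show ?thesis by (simp add: Lb_norm_def)
qed

lemma Lb_norm_top_ge_if_ge_on_interval:
  assumes "0 < a" "a < d" and ge: "\<And>s. s \<in> {a..d} \<Longrightarrow> m \<le> g s"
  shows "m \<le> Lb_norm \<infinity> g"
proof (rule ccontr)
  assume "\<not> m \<le> Lb_norm \<infinity> g"
  have "AE s in lebesgue_on {0<..}. g s \<le> Lb_norm \<infinity> g"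
    by (simp add: Lb_norm_def esssup_AE)
  then have "AE s in lborel. s \<notin> {a..d}"
    unfolding AE_lebesgue_on_Ioi_iff
  proof eventually_elim
    case (elim s)
    show ?case
    proof
      assume "s \<in> {a..d}"
      with \<open>0 < a\<close> elim have "g s \<le> Lb_norm \<infinity> g" by auto
      with ge[OF \<open>s \<in> {a..d}\<close>] \<open>\<not> m \<le> Lb_norm \<infinity> g\<close> show False by simp
    qed
  qed
  moreover have "{a..d} \<in> sets lborel" by simp
  ultimately have "{a..d} \<in> null_sets lborel"
    by (simp only: AE_iff_null_sets)
  with \<open>a < d\<close> show False by (auto dest: null_setsD1)
qed

lemma Lb_norm_ge_if_ge_on_dyadic_interval:
  assumes [measurable]: "g \<in> borel_measurable borel"
    and "0 < b" "t > 0" and ge: "\<And>s. s \<in> {t / 2..t} \<Longrightarrow> m \<le> g s"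
  shows "ennreal ((t / 2) powr recip b) * m \<le> Lb_norm b g"
proof (cases b)
  case (real \<beta>)
  with \<open>0 < b\<close> have "\<beta> > 0" by auto
  have "ennreal (t / 2) * epowr m \<beta> = (\<integral>\<^sup>+s\<in>{t / 2..t}. epowr m \<beta> \<partial>lborel)"
    using \<open>t > 0\<close> by (simp add: nn_integral_cmult_indicator mult.commute)
  also have "\<dots> \<le> (\<integral>\<^sup>+s\<in>{0<..}. epowr (g s) \<beta> \<partial>lborel)"
  proof (rule nn_integral_mono)
    show "epowr m \<beta> * indicator {t / 2..t} s \<le> epowr (g s) \<beta> * indicator {0<..} s" for s
      using epowr_mono[OF ge[of s] \<open>\<beta> > 0\<close>] \<open>t > 0\<close> by (cases "s \<in> {t / 2..t}") auto
  qed
  finally have "epowr (ennreal (t / 2) * epowr m \<beta>) (1 / \<beta>) \<le> Lb_norm b g"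
    using \<open>\<beta> > 0\<close> real by (simp add: Lb_norm_ennreal epowr_mono)
  then show ?thesis
    using \<open>t > 0\<close> \<open>\<beta> > 0\<close> real by (simp add: epowr_mult epowr_epowr_inverse recip_ennreal)
next
  case top
  with \<open>t > 0\<close> Lb_norm_top_ge_if_ge_on_interval[of "t / 2" t m g] ge show ?thesis
    by (simp add: recip_top)
qed

lemma two_sided_power_eq:
  fixes s t a :: real
  assumes "t > 0" and "a > 0"
  shows "t powr (-1) * exp (- s * \<bar>ln (t / a)\<bar>)
    = (if t \<le> a then a powr (- s) * t powr (s - 1) else a powr s * t powr (- s - 1))"
  using assms by (auto simp: powr_def ln_div abs_if algebra_simps simp flip: exp_add)

lemma nn_integral_powr_from_0:
  assumes "e > -1" "0 \<le> a"
  shows "(\<integral>\<^sup>+t\<in>{0..a}. ennreal (t powr e) \<partial>lborel) = ennreal (a powr (e + 1) / (e + 1))"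
  by (rule nn_integral_has_integral_lebesgue'[OF _ has_integral_powr_from_0]) (use assms in auto)

lemma nn_integral_powr_to_inf:
  assumes "e < -1" "0 < a"
  shows "(\<integral>\<^sup>+t\<in>{a..}. ennreal (t powr e) \<partial>lborel) = ennreal (- (a powr (e + 1)) / (e + 1))"
  by (rule nn_integral_has_integral_lebesgue'[OF _ has_integral_powr_to_inf]) (use assms in auto)

lemma nn_integral_two_sided_power_le:
  assumes "s > 0" and "a > 0"
  shows "(\<integral>\<^sup>+t\<in>{0<..}. ennreal (t powr (-1) * exp (- s * \<bar>ln (t / a)\<bar>)) \<partial>lborel) \<le> ennreal (2 / s)"
proof -
  have "(\<integral>\<^sup>+t\<in>{0<..}. ennreal (t powr (-1) * exp (- s * \<bar>ln (t / a)\<bar>)) \<partial>lborel)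
      \<le> (\<integral>\<^sup>+t. ennreal (a powr (- s)) * (ennreal (t powr (s - 1)) * indicator {0..a} t)
          + ennreal (a powr s) * (ennreal (t powr (- s - 1)) * indicator {a..} t) \<partial>lborel)"
  proof (rule nn_integral_mono)
    fix t :: real
    show "ennreal (t powr (-1) * exp (- s * \<bar>ln (t / a)\<bar>)) * indicator {0<..} t
        \<le> ennreal (a powr (- s)) * (ennreal (t powr (s - 1)) * indicator {0..a} t)
          + ennreal (a powr s) * (ennreal (t powr (- s - 1)) * indicator {a..} t)"
    proof (cases "t > 0")
      case True
      then show ?thesis
        unfolding two_sided_power_eq[OF True \<open>a > 0\<close>]
        by (auto simp: ennreal_mult split: split_indicator)
    qed simp
  qed
  also have "\<dots> = ennreal (a powr (- s)) * ennreal (a powr s / s)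
      + ennreal (a powr s) * ennreal (a powr (- s) / s)"
    using assms nn_integral_powr_from_0[of "s - 1" a] nn_integral_powr_to_inf[of "- s - 1" a]
    by (subst nn_integral_add) (auto simp: nn_integral_cmult)
  also have "\<dots> = ennreal (2 / s)"
    using assms
    by (simp add: ennreal_mult[symmetric] ennreal_plus[symmetric] powr_minus del: ennreal_plus)
  finally show ?thesis .
qed

lemma nn_integral_log_power_le:
  assumes "d > 0"
  obtains K where "K > 0" "\<And>a. a > 0 \<Longrightarrow>
    (\<integral>\<^sup>+t\<in>{0<..<a}. ennreal (log_power (d - 1) A t) \<partial>lborel) \<le> ennreal (K * log_power d A a)"
proof -
  obtain L where "L > 0" and decay: "\<And>s t. s > 0 \<Longrightarrow> t > 0 \<Longrightarrow> d * ln (s / t) \<le> 0 \<Longrightarrow>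
      log_power d A s \<le> L * log_power d A t * exp (- (d / 2) * \<bar>ln (s / t)\<bar>)"
    using log_power_decay[of "d / 2" d A] \<open>d > 0\<close> by auto
  have "(\<integral>\<^sup>+t\<in>{0<..<a}. ennreal (log_power (d - 1) A t) \<partial>lborel)
      \<le> ennreal (L * (2 / (d / 2)) * log_power d A a)" if "a > 0" for a
  proof -
    define E where "E t = t powr (-1) * exp (- (d / 2) * \<bar>ln (t / a)\<bar>)" for t
    define D where "D = L * log_power d A a"
    have "D \<ge> 0" using \<open>L > 0\<close> log_power_nonneg by (simp add: D_def)
    have pointwise: "log_power (d - 1) A t \<le> D * E t" if "0 < t" "t < a" for t
    proof -
      have "log_power (d - 1) A t = t powr (-1) * log_power d A t"
        by (simp only: powr_mult_log_power) simp
      also have "\<dots> \<le> t powr (-1) * (D * exp (- (d / 2) * \<bar>ln (t / a)\<bar>))"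
        unfolding D_def using that \<open>d > 0\<close> \<open>a > 0\<close>
        by (intro mult_left_mono decay) (auto simp: mult_nonneg_nonpos)
      finally show ?thesis by (simp add: E_def mult_ac)
    qed
    have "(\<integral>\<^sup>+t\<in>{0<..<a}. ennreal (log_power (d - 1) A t) \<partial>lborel)
        \<le> (\<integral>\<^sup>+t. ennreal D * (ennreal (E t) * indicator {0<..} t) \<partial>lborel)"
      using pointwise \<open>D \<ge> 0\<close>
      by (intro nn_integral_mono)
        (auto simp: ennreal_mult'[symmetric] intro: ennreal_leI split: split_indicator)
    also have "\<dots> = ennreal D * (\<integral>\<^sup>+t\<in>{0<..}. ennreal (E t) \<partial>lborel)"
      unfolding E_def by (rule nn_integral_cmult) measurable
    also have "\<dots> \<le> ennreal D * ennreal (2 / (d / 2))"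
      unfolding E_def using \<open>d > 0\<close> \<open>a > 0\<close>
      by (intro mult_left_mono nn_integral_two_sided_power_le) auto
    also have "\<dots> = ennreal (L * (2 / (d / 2)) * log_power d A a)"
      using \<open>D \<ge> 0\<close> \<open>d > 0\<close> by (simp add: D_def mult_ac flip: ennreal_mult)
    finally show ?thesis .
  qed
  then show ?thesis using \<open>L > 0\<close> \<open>d > 0\<close> by (intro that[of "L * (2 / (d / 2))"]) auto
qed

lemma Lb_norm_ennreal_two_sided_power_le:
  assumes "0 < \<beta>" "0 < \<sigma>" "0 < a"
  shows "Lb_norm (ennreal \<beta>) (\<lambda>t. ennreal (t powr (- (1 / \<beta>)) * exp (- \<sigma> * \<bar>ln (t / a)\<bar>)) * y)
    \<le> ennreal ((2 / (\<sigma> * \<beta>)) powr (1 / \<beta>)) * y"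
proof -
  let ?g = "\<lambda>t. ennreal (t powr (- (1 / \<beta>)) * exp (- \<sigma> * \<bar>ln (t / a)\<bar>)) * y"
  define E where "E t = t powr (-1) * exp (- (\<sigma> * \<beta>) * \<bar>ln (t / a)\<bar>)" for t
  have "epowr (?g t) \<beta> = ennreal (E t) * epowr y \<beta>" if "t > 0" for t
    using that assms
    by (subst epowr_mult) (auto simp: E_def powr_mult powr_powr exp_powr_real mult_ac)
  then have "(\<integral>\<^sup>+t\<in>{0<..}. epowr (?g t) \<beta> \<partial>lborel)
      = (\<integral>\<^sup>+t. (ennreal (E t) * indicator {0<..} t) * epowr y \<beta> \<partial>lborel)"
    by (intro nn_integral_cong) (simp split: split_indicator)
  also have "\<dots> = (\<integral>\<^sup>+t\<in>{0<..}. ennreal (E t) \<partial>lborel) * epowr y \<beta>"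
    unfolding E_def by (rule nn_integral_multc) measurable
  also have "\<dots> \<le> ennreal (2 / (\<sigma> * \<beta>)) * epowr y \<beta>"
    unfolding E_def using assms by (intro mult_right_mono nn_integral_two_sided_power_le) auto
  finally have "Lb_norm (ennreal \<beta>) ?g \<le> epowr (ennreal (2 / (\<sigma> * \<beta>)) * epowr y \<beta>) (1 / \<beta>)"
    using assms by (simp add: Lb_norm_ennreal epowr_mono)
  also have "\<dots> = ennreal ((2 / (\<sigma> * \<beta>)) powr (1 / \<beta>)) * y"
    using assms by (simp add: epowr_mult epowr_epowr_inverse)
  finally show ?thesis .
qed

lemma Lb_norm_two_sided_power_le:
  fixes \<sigma> :: real
  assumes "0 < b" and "0 < \<sigma>"
  obtains Z where "Z > 0" "\<And>a y. a > 0 \<Longrightarrow>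
    Lb_norm b (\<lambda>t. ennreal (t powr (- recip b) * exp (- \<sigma> * \<bar>ln (t / a)\<bar>)) * y) \<le> ennreal Z * y"
proof (cases b)
  case (real \<beta>)
  with \<open>0 < b\<close> have "\<beta> > 0" by auto
  with real \<open>0 < \<sigma>\<close> show ?thesis
    using Lb_norm_ennreal_two_sided_power_le[of \<beta> \<sigma>]
    by (intro that[of "(2 / (\<sigma> * \<beta>)) powr (1 / \<beta>)"]) (simp_all add: recip_ennreal)
next
  case top
  have "Lb_norm \<infinity> (\<lambda>t. ennreal (t powr (- recip b) * exp (- \<sigma> * \<bar>ln (t / a)\<bar>)) * y) \<le> y" for a y
  proof (rule Lb_norm_top_le)
    fix t :: real assume "t > 0"
    have "ennreal (exp (- \<sigma> * \<bar>ln (t / a)\<bar>)) * y \<le> 1 * y"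
      using \<open>0 < \<sigma>\<close> by (intro mult_right_mono) (auto simp: ennreal_le_1)
    with top \<open>t > 0\<close> show "ennreal (t powr (- recip b) * exp (- \<sigma> * \<bar>ln (t / a)\<bar>)) * y \<le> y"
      by (simp add: recip_top)
  qed measurable
  with top show ?thesis by (intro that[of 1]) auto
qed

section \<open>Lorentz--Zygmund norms\<close>

lemma LZ_norm_eq:
  "LZ_norm p b A f
    = Lb_norm b (\<lambda>t. ennreal (log_power (recip p - recip b) A t) * rearrangement f t)"
  by (simp add: LZ_norm_def log_power_def)

lemma ennreal_le_if_mult_le:
  assumes "0 < w" "ennreal w * x \<le> y"
  shows "x \<le> ennreal (1 / w) * y"
proof -
  have "x = ennreal (1 / w) * (ennreal w * x)"
    using assms(1) by (simp add: mult.assoc[symmetric] ennreal_mult[symmetric])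
  also have "\<dots> \<le> ennreal (1 / w) * y"
    using assms(2) by (intro mult_left_mono) auto
  finally show ?thesis .
qed

lemma rearrangement_le_LZ_norm:
  assumes "0 < c"
  obtains K where "K > 0" "\<And>(f :: 'a::euclidean_space \<Rightarrow> complex) t. t > 0 \<Longrightarrow>
    rearrangement f t \<le> ennreal (K * log_power (- recip q) (- B) t) * LZ_norm q c B f"
proof -
  define e where "e = recip q - recip c"
  obtain k where "k > 0" and doubling: "\<And>s t. t > 0 \<Longrightarrow> s \<in> {t / 2..t} \<Longrightarrow>
      log_power e B t \<le> k * log_power e B s"
    using log_power_le_on_dyadic_interval by blast
  define K where "K = 2 powr recip c * k"
  have "rearrangement f t \<le> ennreal (K * log_power (- recip q) (- B) t) * LZ_norm q c B f"
    if "t > 0" for f :: "'a \<Rightarrow> complex" and t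
  proof -
    define w where "w = log_power e B t / k"
    have "w > 0" using \<open>k > 0\<close> log_power_pos[OF \<open>t > 0\<close>] by (simp add: w_def)
    have "ennreal ((t / 2) powr recip c) * (ennreal w * rearrangement f t) \<le> LZ_norm q c B f"
      unfolding LZ_norm_eq e_def[symmetric]
    proof (rule Lb_norm_ge_if_ge_on_dyadic_interval[OF _ \<open>0 < c\<close> \<open>t > 0\<close>])
      fix s assume s: "s \<in> {t / 2..t}"
      then have "w \<le> log_power e B s"
        using doubling[OF \<open>t > 0\<close> s] \<open>k > 0\<close> by (simp add: w_def field_simps)
      with s show "ennreal w * rearrangement f t \<le> ennreal (log_power e B s) * rearrangement f s"
        by (intro mult_mono ennreal_leI rearrangement_antimono) auto
    qed measurable
    then have "ennreal ((t / 2) powr recip c * w) * rearrangement f t \<le> LZ_norm q c B f"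
      using \<open>w > 0\<close> by (simp add: ennreal_mult mult.assoc)
    then have "rearrangement f t \<le> ennreal (1 / ((t / 2) powr recip c * w)) * LZ_norm q c B f"
      using \<open>w > 0\<close> \<open>t > 0\<close> by (intro ennreal_le_if_mult_le) auto
    also have "(t / 2) powr recip c * w = log_power (recip q) B t / K"
      using \<open>t > 0\<close> powr_mult_log_power[of t "recip c" e B]
      by (simp add: w_def K_def e_def powr_divide)
    finally show ?thesis
      by (simp add: log_power_uminus)
  qed
  moreover have "K > 0" using \<open>k > 0\<close> by (simp add: K_def)
  ultimately show ?thesis using that by blast
qed

lemma LZ_norm_1_1:
  "LZ_norm 1 1 (0, 0) f = (\<integral>\<^sup>+t\<in>{0<..}. rearrangement f t \<partial>lborel)"
proof -
  have "(\<integral>\<^sup>+t\<in>{0<..}. epowr (ennreal (log_power 0 (0, 0) t) * rearrangement f t) 1 \<partial>lborel)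
      = (\<integral>\<^sup>+t\<in>{0<..}. epowr (rearrangement f t) 1 \<partial>lborel)"
    by (intro nn_integral_cong) (simp add: log_power_0 split: split_indicator)
  moreover have "epowr x 1 = x" for x
    by (cases x) (simp_all add: epowr_def)
  ultimately show ?thesis
    using Lb_norm_ennreal[of "\<lambda>t. ennreal (log_power 0 (0, 0) t) * rearrangement f t" 1]
    by (simp add: LZ_norm_eq recip_1)
qed

section \<open>Band-limited functions\<close>

definition admissible_exponents :: "ennreal \<Rightarrow> ennreal \<Rightarrow> real \<times> real \<Rightarrow> bool" where
  "admissible_exponents q c B \<longleftrightarrow> (q = 1 \<and> c = 1 \<and> B = (0, 0)) \<or> (1 < q \<and> q < \<infinity> \<and> 0 < c)"

lemma nn_integral_rearrangement_le_LZ_norm: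
  assumes "admissible_exponents q c B"
  obtains K where "K > 0" "\<And>(f :: 'a::euclidean_space \<Rightarrow> complex) a. a > 0 \<Longrightarrow>
    (\<integral>\<^sup>+t\<in>{0<..<a}. rearrangement f t \<partial>lborel)
      \<le> ennreal (K * log_power (1 - recip q) (- B) a) * LZ_norm q c B f"
  using assms unfolding admissible_exponents_def
proof
  assume q_1: "q = 1 \<and> c = 1 \<and> B = (0, 0)"
  have "(\<integral>\<^sup>+t\<in>{0<..<a}. rearrangement f t \<partial>lborel)
      \<le> ennreal (1 * log_power (1 - recip q) (- B) a) * LZ_norm q c B f"
    if "a > 0" for f :: "'a \<Rightarrow> complex" and a
  proof -
    have "(\<integral>\<^sup>+t\<in>{0<..<a}. rearrangement f t \<partial>lborel) \<le> LZ_norm q c B f"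
      using q_1 by (auto intro!: nn_integral_mono simp: LZ_norm_1_1 split: split_indicator)
    moreover have "log_power (1 - recip q) (- B) a = 1"
      using q_1 that by (simp add: log_power_0 recip_1)
    ultimately show ?thesis by simp
  qed
  then show ?thesis by (intro that[of 1]) auto
next
  assume q_gt_1: "1 < q \<and> q < \<infinity> \<and> 0 < c"
  then have "0 < 1 - recip q"
    using recip_strict_antimono[of 1 q] by (simp add: recip_1)
  then obtain L where "L > 0" and weight_integral: "\<And>a. a > 0 \<Longrightarrow>
      (\<integral>\<^sup>+t\<in>{0<..<a}. ennreal (log_power ((1 - recip q) - 1) (- B) t) \<partial>lborel)
        \<le> ennreal (L * log_power (1 - recip q) (- B) a)"
    using nn_integral_log_power_le by blast
  obtain K where "K > 0" and pointwise: "\<And>(f :: 'a \<Rightarrow> complex) t. t > 0 \<Longrightarrow>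
      rearrangement f t \<le> ennreal (K * log_power (- recip q) (- B) t) * LZ_norm q c B f"
    using rearrangement_le_LZ_norm[of c q B] q_gt_1 by blast
  have "(\<integral>\<^sup>+t\<in>{0<..<a}. rearrangement f t \<partial>lborel)
      \<le> ennreal (K * L * log_power (1 - recip q) (- B) a) * LZ_norm q c B f"
    if "a > 0" for f :: "'a \<Rightarrow> complex" and a
  proof -
    have "(\<integral>\<^sup>+t\<in>{0<..<a}. rearrangement f t \<partial>lborel)
        \<le> (\<integral>\<^sup>+t. ennreal K * LZ_norm q c B f
            * (ennreal (log_power ((1 - recip q) - 1) (- B) t) * indicator {0<..<a} t) \<partial>lborel)"
      using pointwise \<open>K > 0\<close>
      by (intro nn_integral_mono) (simp add: ennreal_mult' mult_ac split: split_indicator)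
    also have "\<dots> = ennreal K * LZ_norm q c B f
        * (\<integral>\<^sup>+t\<in>{0<..<a}. ennreal (log_power ((1 - recip q) - 1) (- B) t) \<partial>lborel)"
      by (rule nn_integral_cmult) measurable
    also have "\<dots> \<le> ennreal K * LZ_norm q c B f * ennreal (L * log_power (1 - recip q) (- B) a)"
      by (intro mult_left_mono weight_integral that) auto
    finally show ?thesis
      using \<open>K > 0\<close> by (simp add: ennreal_mult' mult_ac)
  qed
  then show ?thesis using \<open>K > 0\<close> \<open>L > 0\<close> by (intro that[of "K * L"]) auto
qed

lemma bandlimited_rearrangement_le_LZ_norm:
  assumes "admissible_exponents q c B"
  obtains K where "K > 0" "\<And>R (f :: 'a::euclidean_space \<Rightarrow> complex) t. R > 0 \<Longrightarrow>
    f \<in> LZ_bandlimited R q c B \<Longrightarrow> rearrangement f t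
      \<le> ennreal (K * log_power (- recip q) (- B) (1 / R ^ DIM('a))) * LZ_norm q c B f"
proof -
  obtain K where "K > 0" and integral: "\<And>(f :: 'a \<Rightarrow> complex) a. a > 0 \<Longrightarrow>
      (\<integral>\<^sup>+t\<in>{0<..<a}. rearrangement f t \<partial>lborel)
        \<le> ennreal (K * log_power (1 - recip q) (- B) a) * LZ_norm q c B f"
    using nn_integral_rearrangement_le_LZ_norm[OF assms, where 'a = 'a] by blast
  obtain C where "C > 0" and uniform: "\<And>R t (f :: 'a \<Rightarrow> complex).
      R > 0 \<Longrightarrow> f \<in> borel_measurable lebesgue \<Longrightarrow> spectrum f \<subseteq> cball 0 R \<Longrightarrow>
      rearrangement f t
        \<le> ennreal (C * R ^ DIM('a)) * (\<integral>\<^sup>+u\<in>{0<..<1 / R ^ DIM('a)}. rearrangement f u \<partial>lborel)"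
    using bandlimited_rearrangement_le[where 'a = 'a] by blast
  have "rearrangement f t
      \<le> ennreal (C * K * log_power (- recip q) (- B) (1 / R ^ DIM('a))) * LZ_norm q c B f"
    if "R > 0" and "f \<in> LZ_bandlimited R q c B" for R t and f :: "'a \<Rightarrow> complex"
  proof -
    let ?a = "1 / R ^ DIM('a)"
    have "f \<in> borel_measurable lebesgue" "spectrum f \<subseteq> cball 0 R"
      using that by (auto simp: LZ_bandlimited_def LZ_space_def spectrum_def)
    from uniform[OF \<open>R > 0\<close> this, of t]
    have "rearrangement f t
        \<le> ennreal (C * R ^ DIM('a)) * (\<integral>\<^sup>+u\<in>{0<..<?a}. rearrangement f u \<partial>lborel)" .
    also have "\<dots> \<le> ennreal (C * R ^ DIM('a))
        * (ennreal (K * log_power (1 - recip q) (- B) ?a) * LZ_norm q c B f)"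
      using \<open>R > 0\<close> by (intro mult_left_mono integral) auto
    also have "\<dots> = ennreal (C * R ^ DIM('a) * (K * log_power (1 - recip q) (- B) ?a))
        * LZ_norm q c B f"
      using \<open>C > 0\<close> \<open>K > 0\<close> \<open>R > 0\<close> log_power_nonneg by (simp add: ennreal_mult mult.assoc)
    also have "C * R ^ DIM('a) * (K * log_power (1 - recip q) (- B) ?a)
        = C * K * log_power (- recip q) (- B) ?a"
      using powr_mult_log_power[of ?a "- 1" "1 - recip q" "- B"] \<open>R > 0\<close>
      by (simp add: powr_minus_divide)
    finally show ?thesis .
  qed
  then show ?thesis using \<open>C > 0\<close> \<open>K > 0\<close> by (intro that[of "C * K"]) auto
qed

lemma bandlimited_rearrangement_le_max:
  assumes "admissible_exponents q c B"
  obtains K where "K > 0" "\<And>R (f :: 'a::euclidean_space \<Rightarrow> complex) t. R > 0 \<Longrightarrow> t > 0 \<Longrightarrow>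
    f \<in> LZ_bandlimited R q c B \<Longrightarrow> rearrangement f t
      \<le> ennreal (K * log_power (- recip q) (- B) (max t (1 / R ^ DIM('a)))) * LZ_norm q c B f"
proof -
  obtain K\<^sub>1 where "K\<^sub>1 > 0" and uniform: "\<And>R (f :: 'a \<Rightarrow> complex) t. R > 0 \<Longrightarrow>
      f \<in> LZ_bandlimited R q c B \<Longrightarrow> rearrangement f t
        \<le> ennreal (K\<^sub>1 * log_power (- recip q) (- B) (1 / R ^ DIM('a))) * LZ_norm q c B f"
    using bandlimited_rearrangement_le_LZ_norm[OF assms, where 'a = 'a] by blast
  have "0 < c" using assms by (auto simp: admissible_exponents_def)
  then obtain K\<^sub>2 where pointwise: "\<And>(f :: 'a \<Rightarrow> complex) t. t > 0 \<Longrightarrow>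
      rearrangement f t \<le> ennreal (K\<^sub>2 * log_power (- recip q) (- B) t) * LZ_norm q c B f"
    using rearrangement_le_LZ_norm[of c q B, where 'a = 'a] by blast
  have "rearrangement f t
      \<le> ennreal (max K\<^sub>1 K\<^sub>2 * log_power (- recip q) (- B) (max t (1 / R ^ DIM('a))))
        * LZ_norm q c B f"
    if "R > 0" "t > 0" "f \<in> LZ_bandlimited R q c B" for R t and f :: "'a \<Rightarrow> complex"
  proof -
    have "rearrangement f t \<le> ennreal (k * w) * LZ_norm q c B f \<Longrightarrow> k \<le> max K\<^sub>1 K\<^sub>2 \<Longrightarrow> 0 \<le> w \<Longrightarrow>
        rearrangement f t \<le> ennreal (max K\<^sub>1 K\<^sub>2 * w) * LZ_norm q c B f" for k w
      by (erule order_trans) (intro mult_right_mono ennreal_leI; simp)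
    from this[OF uniform[OF that(1,3)]] this[OF pointwise[OF that(2)]] show ?thesis
      by (cases "t \<le> 1 / R ^ DIM('a)") (simp_all add: max_def log_power_nonneg)
  qed
  then show ?thesis using \<open>K\<^sub>1 > 0\<close> by (intro that[of "max K\<^sub>1 K\<^sub>2"]) auto
qed

lemma bandlimited_weighted_rearrangement_le:
  assumes "admissible_exponents q c B" and "0 < recip p" "recip p < recip q"
  obtains \<sigma> K where "\<sigma> > 0" "K > 0"
    "\<And>R (f :: 'a::euclidean_space \<Rightarrow> complex) t. R > 0 \<Longrightarrow> t > 0 \<Longrightarrow>
      f \<in> LZ_bandlimited R q c B \<Longrightarrow> ennreal (log_power (recip p) A t) * rearrangement f t
        \<le> ennreal (K * log_power (recip p - recip q) (A - B) (1 / R ^ DIM('a))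
            * exp (- \<sigma> * \<bar>ln (t / (1 / R ^ DIM('a)))\<bar>)) * LZ_norm q c B f"
proof -
  obtain K where "K > 0" and rearrangement_le: "\<And>R (f :: 'a \<Rightarrow> complex) t. R > 0 \<Longrightarrow> t > 0 \<Longrightarrow>
      f \<in> LZ_bandlimited R q c B \<Longrightarrow> rearrangement f t
        \<le> ennreal (K * log_power (- recip q) (- B) (max t (1 / R ^ DIM('a)))) * LZ_norm q c B f"
    using bandlimited_rearrangement_le_max[OF assms(1), where 'a = 'a] by blast
  obtain \<sigma> L where "\<sigma> > 0" "L > 0" and weights: "\<And>t a. t > 0 \<Longrightarrow> a > 0 \<Longrightarrow>
      log_power (recip p) A t * log_power (- recip q) (- B) (max t a)
        \<le> L * log_power (recip p - recip q) (A - B) a * exp (- \<sigma> * \<bar>ln (t / a)\<bar>)"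
    using log_power_mult_max_le[OF assms(2,3)] by blast
  have "ennreal (log_power (recip p) A t) * rearrangement f t
      \<le> ennreal (K * L * log_power (recip p - recip q) (A - B) (1 / R ^ DIM('a))
          * exp (- \<sigma> * \<bar>ln (t / (1 / R ^ DIM('a)))\<bar>)) * LZ_norm q c B f"
    if "R > 0" "t > 0" "f \<in> LZ_bandlimited R q c B" for R t and f :: "'a \<Rightarrow> complex"
  proof -
    let ?a = "1 / R ^ DIM('a)"
    have "ennreal (log_power (recip p) A t) * rearrangement f t
        \<le> ennreal (log_power (recip p) A t)
          * (ennreal (K * log_power (- recip q) (- B) (max t ?a)) * LZ_norm q c B f)"
      by (intro mult_left_mono rearrangement_le that) simp
    also have "\<dots> = ennreal (K * (log_power (recip p) A t * log_power (- recip q) (- B) (max t ?a)))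
        * LZ_norm q c B f"
      using \<open>K > 0\<close> by (simp add: ennreal_mult log_power_nonneg mult_ac)
    also have "\<dots> \<le> ennreal (K * (L * log_power (recip p - recip q) (A - B) ?a
        * exp (- \<sigma> * \<bar>ln (t / ?a)\<bar>))) * LZ_norm q c B f"
      using \<open>K > 0\<close> \<open>R > 0\<close> \<open>t > 0\<close>
      by (intro mult_right_mono ennreal_leI mult_left_mono weights) auto
    finally show ?thesis by (simp only: mult.assoc)
  qed
  then show ?thesis using \<open>\<sigma> > 0\<close> \<open>K > 0\<close> \<open>L > 0\<close> by (intro that[of \<sigma> "K * L"]) auto
qed

lemma LZ_norm_bandlimited_le_finite:
  assumes "admissible_exponents q c B" and "0 < recip p" "recip p < recip q" and "0 < b"
  obtains C where "C > 0" "\<And>R (f :: 'a::euclidean_space \<Rightarrow> complex). R > 0 \<Longrightarrow>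
    f \<in> LZ_bandlimited R q c B \<Longrightarrow> LZ_norm p b A f
      \<le> ennreal (C * log_power (recip p - recip q) (A - B) (1 / R ^ DIM('a))) * LZ_norm q c B f"
proof -
  obtain \<sigma> K where "\<sigma> > 0" "K > 0" and pointwise: "\<And>R (f :: 'a \<Rightarrow> complex) t. R > 0 \<Longrightarrow> t > 0 \<Longrightarrow>
      f \<in> LZ_bandlimited R q c B \<Longrightarrow> ennreal (log_power (recip p) A t) * rearrangement f t
        \<le> ennreal (K * log_power (recip p - recip q) (A - B) (1 / R ^ DIM('a))
            * exp (- \<sigma> * \<bar>ln (t / (1 / R ^ DIM('a)))\<bar>)) * LZ_norm q c B f"
    using bandlimited_weighted_rearrangement_le[OF assms(1-3), where 'a = 'a] by blast
  obtain Z where "Z > 0" and two_sided_power: "\<And>a y. a > 0 \<Longrightarrow>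
      Lb_norm b (\<lambda>t. ennreal (t powr (- recip b) * exp (- \<sigma> * \<bar>ln (t / a)\<bar>)) * y) \<le> ennreal Z * y"
    using Lb_norm_two_sided_power_le[OF assms(4) \<open>\<sigma> > 0\<close>] by blast
  have "LZ_norm p b A f \<le> ennreal (Z * K * log_power (recip p - recip q) (A - B) (1 / R ^ DIM('a)))
      * LZ_norm q c B f"
    if "R > 0" and "f \<in> LZ_bandlimited R q c B" for R and f :: "'a \<Rightarrow> complex"
  proof -
    define a where "a = 1 / R ^ DIM('a)"
    have "a > 0" using \<open>R > 0\<close> by (simp add: a_def)
    define D where "D = K * log_power (recip p - recip q) (A - B) a"
    have "D \<ge> 0" using \<open>K > 0\<close> log_power_nonneg by (simp add: D_def)
    have "LZ_norm p b A f \<le> Lb_norm b (\<lambda>t. ennreal (t powr (- recip b) * exp (- \<sigma> * \<bar>ln (t / a)\<bar>))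
        * (ennreal D * LZ_norm q c B f))"
      unfolding LZ_norm_eq[of p]
    proof (rule Lb_norm_mono[OF _ _ assms(4)])
      fix t :: real assume "t > 0"
      have "ennreal (log_power (recip p - recip b) A t) * rearrangement f t
          = ennreal (t powr (- recip b)) * (ennreal (log_power (recip p) A t) * rearrangement f t)"
        using powr_mult_log_power[of t "- recip b" "recip p" A]
        by (simp add: log_power_nonneg flip: mult.assoc ennreal_mult)
      also have "\<dots> \<le> ennreal (t powr (- recip b))
          * (ennreal (D * exp (- \<sigma> * \<bar>ln (t / a)\<bar>)) * LZ_norm q c B f)"
        unfolding D_def a_def by (intro mult_left_mono pointwise \<open>t > 0\<close> that) simp
      finally show "ennreal (log_power (recip p - recip b) A t) * rearrangement f t
          \<le> ennreal (t powr (- recip b) * exp (- \<sigma> * \<bar>ln (t / a)\<bar>)) * (ennreal D * LZ_norm q c B f)"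
        using \<open>D \<ge> 0\<close> by (simp add: ennreal_mult mult_ac)
    qed measurable
    also have "\<dots> \<le> ennreal Z * (ennreal D * LZ_norm q c B f)"
      by (rule two_sided_power[OF \<open>a > 0\<close>])
    also have "\<dots> = ennreal (Z * D) * LZ_norm q c B f"
      using \<open>Z > 0\<close> \<open>D \<ge> 0\<close> by (simp add: ennreal_mult mult.assoc)
    finally show ?thesis by (simp add: D_def a_def mult.assoc)
  qed
  then show ?thesis using \<open>Z > 0\<close> \<open>K > 0\<close> by (intro that[of "Z * K"]) auto
qed

lemma LZ_norm_bandlimited_le_top:
  assumes "admissible_exponents q c B"
  obtains C where "C > 0" "\<And>R (f :: 'a::euclidean_space \<Rightarrow> complex). R > 0 \<Longrightarrow>
    f \<in> LZ_bandlimited R q c B \<Longrightarrow> LZ_norm \<infinity> \<infinity> (0, 0) f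
      \<le> ennreal (C * log_power (- recip q) (- B) (1 / R ^ DIM('a))) * LZ_norm q c B f"
proof -
  obtain K where "K > 0" and uniform: "\<And>R (f :: 'a \<Rightarrow> complex) t. R > 0 \<Longrightarrow>
      f \<in> LZ_bandlimited R q c B \<Longrightarrow> rearrangement f t
        \<le> ennreal (K * log_power (- recip q) (- B) (1 / R ^ DIM('a))) * LZ_norm q c B f"
    using bandlimited_rearrangement_le_LZ_norm[OF assms, where 'a = 'a] by blast
  have "LZ_norm \<infinity> \<infinity> (0, 0) f
      \<le> ennreal (K * log_power (- recip q) (- B) (1 / R ^ DIM('a))) * LZ_norm q c B f"
    if "R > 0" "f \<in> LZ_bandlimited R q c B" for R and f :: "'a \<Rightarrow> complex"
    unfolding LZ_norm_eq[of \<infinity>] diff_self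
  proof (rule Lb_norm_top_le)
    show "ennreal (log_power 0 (0, 0) t) * rearrangement f t
        \<le> ennreal (K * log_power (- recip q) (- B) (1 / R ^ DIM('a))) * LZ_norm q c B f"
      if "t > 0" for t
      using uniform[OF \<open>R > 0\<close> \<open>f \<in> _\<close>] by (simp only: log_power_0[OF that] ennreal_1 mult_1)
  qed measurable
  with \<open>K > 0\<close> show ?thesis by (rule that)
qed

lemma LZ_norm_bandlimited_le:
  assumes "admissible_exponents q c B"
    and "(q < p \<and> p < \<infinity> \<and> 0 < b) \<or> (p = \<infinity> \<and> b = \<infinity> \<and> A = (0, 0))"
  obtains C where "C > 0" "\<And>R (f :: 'a::euclidean_space \<Rightarrow> complex). R > 0 \<Longrightarrow>
    f \<in> LZ_bandlimited R q c B \<Longrightarrow> LZ_norm p b A f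
      \<le> ennreal (C * log_power (recip p - recip q) (A - B) (1 / R ^ DIM('a))) * LZ_norm q c B f"
  using assms(2)
proof
  assume p_finite: "q < p \<and> p < \<infinity> \<and> 0 < b"
  have "0 < q" using assms(1) by (auto simp: admissible_exponents_def intro: less_trans[of 0 1])
  then have "0 < recip p" "recip p < recip q"
    using p_finite by (auto intro: recip_pos recip_strict_antimono)
  then show ?thesis
    using LZ_norm_bandlimited_le_finite[OF assms(1), where 'a = 'a] p_finite that by metis
next
  assume p_infinite: "p = \<infinity> \<and> b = \<infinity> \<and> A = (0, 0)"
  then have "recip p - recip q = - recip q" "A - B = - B"
    by (simp_all add: recip_top flip: zero_prod_def)
  then show ?thesis
    using LZ_norm_bandlimited_le_top[OF assms(1), where 'a = 'a] p_infinite that by metis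
qed

theorem theorem11:
  fixes q c p b :: ennreal and A B :: "real \<times> real"
  assumes "(q = 1 \<and> c = 1 \<and> B = (0, 0)) \<or> (1 < q \<and> q < \<infinity> \<and> 0 < c)"
    and "(q < p \<and> p < \<infinity> \<and> 0 < b) \<or> (p = \<infinity> \<and> b = \<infinity> \<and> A = (0, 0))"
  shows "\<exists>C>0. \<forall>R>0. \<forall>f \<in> (LZ_bandlimited R q c B :: (real ^ 'n \<Rightarrow> complex) set).
    LZ_norm p b A f
      \<le> ennreal (C * R powr (real CARD('n) * (recip q - recip p))
                   * broken_log (prod.swap A - prod.swap B) R) * LZ_norm q c B f"
proof -
  let ?factor = "\<lambda>R. R powr (real CARD('n) * (recip q - recip p))
    * broken_log (prod.swap A - prod.swap B) R"
  obtain C where "C > 0" and bound: "\<And>R (f :: real ^ 'n \<Rightarrow> complex). R > 0 \<Longrightarrow>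
      f \<in> LZ_bandlimited R q c B \<Longrightarrow> LZ_norm p b A f
        \<le> ennreal (C * log_power (recip p - recip q) (A - B) (1 / R ^ CARD('n))) * LZ_norm q c B f"
    using LZ_norm_bandlimited_le[OF _ assms(2), of c B, where 'a = "real ^ 'n"] assms(1)
    by (auto simp: admissible_exponents_def)
  define M where "M = real CARD('n) powr (\<bar>fst (A - B)\<bar> + \<bar>snd (A - B)\<bar>)"
  have "LZ_norm p b A f \<le> ennreal (C * M * ?factor R) * LZ_norm q c B f"
    if "R > 0" and "f \<in> LZ_bandlimited R q c B" for R and f :: "real ^ 'n \<Rightarrow> complex"
  proof -
    have "log_power (recip p - recip q) (A - B) (1 / R ^ CARD('n)) \<le> M * ?factor R"
      using log_power_inverse_power_le[OF \<open>R > 0\<close>, of "CARD('n)" "recip p - recip q" "A - B"]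
      by (simp add: M_def prod.swap_def right_diff_distrib Suc_leI)
    then show ?thesis
      using \<open>C > 0\<close> by (intro order_trans[OF bound[OF that]] mult_right_mono ennreal_leI)
        (simp_all add: mult.assoc)
  qed
  moreover have "C * M > 0" using \<open>C > 0\<close> by (simp add: M_def)
  ultimately show ?thesis by (auto simp: mult.assoc)
qed

end
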